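(* Let $S_t^{Z,d}=d^{-1/2}\langle\xi_t^d,v_t^d\rangle$ be the angular momentum process of the stationary $d$-dimensional Zig-Zag process with standard normal target. Then for any $T>0$, the number of switches of $S^{Z,d}$ over $(0,T]$ scaled by $d^{-1}$ satisfies $$d^{-1}\sum_{0\le t\le T}1_{\{\Delta S_t^{Z,d}\neq0\}}\longrightarrow\frac{T}{\sqrt{2\pi}}\quad\text{in probability as } d\to\infty,$$ where $\Delta X_t=X_t-X_{t-}$.
   Context: Zig-Zag process: for $d\in\mathbb{N}$, $(\xi_t^d,v_t^d)_{t\ge0}$ is the process on $\mathbb{R}^d\times\{-1,+1\}^d$ with $\xi_t^d=\xi_0^d+\int_0^t v_s^d\,ds$ and, for $i=1,\dots,d$, $$v_{i,t}^d=v_{i,0}^d-2\int_{(0,t]\times\mathbb{R}_+}v_{i,s-}^d\,1_{\{z\le(\xi_{i,s-}^d v_{i,s-}^d)^+\}}\,N^i(ds,dz),$$ where $x^+=\max\{x,0\}$ and $N^1,\dots,N^d$ are independent Poisson random measures on $\mathbb{R}_+\times\mathbb{R}_+$ with intensity $ds\,dz$. The initial values are stationary: $\xi_0^d\sim\mathcal{N}(0,I_d)$ and $v_0^d$ uniform on $\{-1,+1\}^d$, independent of each other and of the Poisson measures. The convention is that there is no jump at time $0$. *)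

theory Defs
  imports "HOL-Probability.Probability"
begin

text \<open>Paths are functions on \<open>real\<close> of which only the restriction to \<open>[0,\<infinity>)\<close> matters.
  By convention \<open>f(0-) = f(0)\<close>, so a path has no jump at time 0.\<close>

definition left_lim :: "(real \<Rightarrow> real) \<Rightarrow> real \<Rightarrow> real" where
  "left_lim f t = (if t \<le> 0 then f t else Lim (at_left t) f)"

definition jump :: "(real \<Rightarrow> real) \<Rightarrow> real \<Rightarrow> real" where
  "jump f t = f t - left_lim f t"

definition cadlag :: "(real \<Rightarrow> real) \<Rightarrow> bool" where
  "cadlag f \<longleftrightarrow>
    (\<forall>t\<ge>0. (f \<longlongrightarrow> f t) (at_right t)) \<and> (\<forall>t>0. \<exists>l. (f \<longlongrightarrow> l) (at_left t))"

text \<open>A Poisson random measure with intensity \<open>\<mu>\<close>. The point-measure property is only required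
  almost surely.\<close>

definition (in prob_space) poisson_random_measure :: "'e measure \<Rightarrow> ('a \<Rightarrow> 'e measure) \<Rightarrow> bool" where
  "poisson_random_measure \<mu> N \<longleftrightarrow>
    (\<forall>\<omega>\<in>space M. sets (N \<omega>) = sets \<mu>) \<and>
    (\<forall>A\<in>sets \<mu>. random_variable borel (\<lambda>\<omega>. emeasure (N \<omega>) A)) \<and>
    (AE \<omega> in M. \<forall>A\<in>sets \<mu>. emeasure (N \<omega>) A \<in> range of_nat \<union> {\<infinity>}) \<and>
    (\<forall>A\<in>sets \<mu>. emeasure \<mu> A < \<infinity> \<longrightarrow>
      (\<forall>k::nat. prob {\<omega>\<in>space M. emeasure (N \<omega>) A = of_nat k}
        = exp (- measure \<mu> A) * measure \<mu> A ^ k / fact k)) \<and>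
    (\<forall>A\<in>sets \<mu>. emeasure \<mu> A = \<infinity> \<longrightarrow> (AE \<omega> in M. emeasure (N \<omega>) A = \<infinity>)) \<and>
    (\<forall>(n::nat) A. (\<forall>k<n. A k \<in> sets \<mu>) \<and> disjoint_family_on A {..<n} \<longrightarrow>
      indep_vars (\<lambda>_. borel) (\<lambda>k \<omega>. emeasure (N \<omega>) (A k)) {..<n})"

text \<open>The \<open>\<sigma>\<close>-algebra on \<open>\<Omega>\<close> generated by a random measure.\<close>

definition random_measure_sets :: "'w set \<Rightarrow> 'e measure \<Rightarrow> ('w \<Rightarrow> 'e measure) \<Rightarrow> 'w set set" where
  "random_measure_sets \<Omega> \<mu> N = sigma_sets \<Omega>
    {(\<lambda>\<omega>. emeasure (N \<omega>) A) -` B \<inter> \<Omega> | A B. A \<in> sets \<mu> \<and> B \<in> sets borel}"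

text \<open>The independent sources of randomness: initial position, initial velocity and the driving
  Poisson random measure of each coordinate.\<close>

datatype source = Position | Velocity | Noise nat

text \<open>Coordinates are indexed by \<open>{..<d}\<close>; \<open>\<xi> i t \<omega>\<close> and \<open>v i t \<omega>\<close> are the \<open>i\<close>-th coordinates of
  position and velocity at time \<open>t\<close>. The state space and measurability conditions hold for all
  \<open>\<omega>\<close>, the path equations almost surely, simultaneously in \<open>i\<close> and \<open>t\<close>.\<close>

locale stationary_zigzag = prob_space M
  for M :: "'w measure" +
  fixes d :: nat
    and N :: "nat \<Rightarrow> 'w \<Rightarrow> (real \<times> real) measure"
    and \<xi> v :: "nat \<Rightarrow> real \<Rightarrow> 'w \<Rightarrow> real"
  assumes position_measurable:
      "\<And>i t. i < d \<Longrightarrow> 0 \<le> t \<Longrightarrow> random_variable borel (\<xi> i t)"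
    and velocity_measurable:
      "\<And>i t. i < d \<Longrightarrow> 0 \<le> t \<Longrightarrow> random_variable (count_space {-1, 1}) (v i t)"
    and velocity_cadlag: "AE \<omega> in M. \<forall>i<d. cadlag (\<lambda>t. v i t \<omega>)"
    and noise: "\<And>i. i < d \<Longrightarrow>
      poisson_random_measure (restrict_space lborel ({0..} \<times> {0..})) (N i)"
    and position_eq: "AE \<omega> in M. \<forall>i<d. \<forall>t\<ge>0.
      \<xi> i t \<omega> = \<xi> i 0 \<omega> + (LBINT s:{0..t}. v i s \<omega>)"
    and velocity_integrable: "AE \<omega> in M. \<forall>i<d. \<forall>t\<ge>0.
      set_integrable (N i \<omega>) ({0<..t} \<times> {0..})
        (\<lambda>(s, z). left_lim (\<lambda>u. v i u \<omega>) s *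
          (if z \<le> max (left_lim (\<lambda>u. \<xi> i u \<omega>) s * left_lim (\<lambda>u. v i u \<omega>) s) 0 then 1 else 0))"
    and velocity_eq: "AE \<omega> in M. \<forall>i<d. \<forall>t\<ge>0.
      v i t \<omega> = v i 0 \<omega> - 2 * (LINT (s, z):{0<..t} \<times> {0..}|N i \<omega>.
        left_lim (\<lambda>u. v i u \<omega>) s *
          (if z \<le> max (left_lim (\<lambda>u. \<xi> i u \<omega>) s * left_lim (\<lambda>u. v i u \<omega>) s) 0 then 1 else 0))"
    and position_init:
      "distr M (PiM {..<d} (\<lambda>_. borel)) (\<lambda>\<omega>. \<lambda>i\<in>{..<d}. \<xi> i 0 \<omega>)
        = PiM {..<d} (\<lambda>_. density lborel std_normal_density)"
    and velocity_init:
      "distr M (count_space ({..<d} \<rightarrow>\<^sub>E {-1, 1})) (\<lambda>\<omega>. \<lambda>i\<in>{..<d}. v i 0 \<omega>)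
        = uniform_count_measure ({..<d} \<rightarrow>\<^sub>E {-1, 1})"
    and independent:
      "indep_sets
        (\<lambda>j. case j of
            Position \<Rightarrow> sets (vimage_algebra (space M) (\<lambda>\<omega>. \<lambda>i\<in>{..<d}. \<xi> i 0 \<omega>)
                                (PiM {..<d} (\<lambda>_. borel)))
          | Velocity \<Rightarrow> sets (vimage_algebra (space M) (\<lambda>\<omega>. \<lambda>i\<in>{..<d}. v i 0 \<omega>)
                                (count_space ({..<d} \<rightarrow>\<^sub>E {-1, 1})))
          | Noise i \<Rightarrow> random_measure_sets (space M)
                         (restrict_space lborel ({0..} \<times> {0..})) (N i))
        ({Position, Velocity} \<union> Noise ` {..<d})"

definition angular_momentum ::
    "nat \<Rightarrow> (nat \<Rightarrow> real \<Rightarrow> 'w \<Rightarrow> real) \<Rightarrow> (nat \<Rightarrow> real \<Rightarrow> 'w \<Rightarrow> real) \<Rightarrow> real \<Rightarrow> 'w \<Rightarrow> real" where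
  "angular_momentum d \<xi> v t \<omega> = (\<Sum>i<d. \<xi> i t \<omega> * v i t \<omega>) / sqrt (real d)"

text \<open>Valued in \<open>ereal\<close>, so that infinitely many jumps give \<open>\<infinity>\<close> rather than a default value.\<close>

definition num_jumps :: "real \<Rightarrow> (real \<Rightarrow> real) \<Rightarrow> ereal" where
  "num_jumps T f = (\<Sum>\<^sub>\<infinity>t\<in>{0..T}. if jump f t \<noteq> 0 then 1 else 0)"

text \<open>Convergence in probability to a constant, for variables \<open>X d\<close> on possibly different
  probability spaces \<open>M d\<close>. Since paths are constrained only almost surely, measurability is with
  respect to the completion; it is part of the notion because \<open>measure\<close> vanishes on
  non-measurable sets.\<close>

definition tendsto_in_probability ::
    "(nat \<Rightarrow> 'w measure) \<Rightarrow> (nat \<Rightarrow> 'w \<Rightarrow> ereal) \<Rightarrow> real \<Rightarrow> bool" where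
  "tendsto_in_probability M X c \<longleftrightarrow>
    (\<forall>\<^sub>F d in sequentially. X d \<in> borel_measurable (completion (M d))) \<and>
    (\<forall>\<epsilon>>0. (\<lambda>d. measure (completion (M d)) {\<omega>\<in>space (M d). \<bar>X d \<omega> - ereal c\<bar> > ereal \<epsilon>})
      \<longlonglongrightarrow> 0)"

end

theory Submission
  imports Defs
begin

text \<open>The momentum jumps exactly when some coordinate switches: a switch of coordinate \<open>i\<close> at time
  \<open>t\<close> moves it by \<open>- 2 \<xi>\<^sub>i v\<^sub>i / sqrt d\<close>, with \<open>\<xi>\<^sub>i v\<^sub>i > 0\<close> just before the switch, and two coordinates almost
  surely never switch together. So the jumps are counted by a sum of \<open>d\<close> independent copies of the
  number of switches of one coordinate. In equilibrium \<open>y = \<xi>\<^sub>i v\<^sub>i\<close> is standard normal at every time and switches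
  at rate \<open>max y 0\<close>, whose mean is \<open>1 / sqrt (2 \<pi>)\<close>; the weak law of large numbers gives the claim.

  The proof makes this rigorous without any theory of jump Markov processes, by comparison with a
  discrete chain that has the normal law \<^emph>\<open>exactly\<close> as invariant law. Cut \<open>(0, T]\<close> into \<open>n\<close> cells of length
  \<open>h = T / n\<close> and let \<open>Z\<^sub>k\<close> be the height of the lowest Poisson point above cell \<open>k\<close>; these heights are
  independent exponential variables of rate \<open>h\<close>. The guided walk (\<open>walk\<close>) starts at \<open>\<xi>\<^sub>0 v\<^sub>0\<close> and goes from \<open>x\<close> to \<open>- x\<close> if
  \<open>Z\<^sub>k < x + h / 2\<close>, and to \<open>x + h\<close> otherwise. The shift \<open>h / 2\<close> turns the flip probability into
  a Metropolis rejection probability, and \<open>guided_walk_invariant\<close> follows from a one-line identity between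
  Gaussian densities. Hence the number of flips has mean \<open>n\<close> times an explicit integral, which
  tends to \<open>T / sqrt (2 \<pi>)\<close> (\<open>flip_prob_limit\<close>), and a second moment bounded uniformly in \<open>n\<close>
  (\<open>nn_integral_J_square\<close>).

  The comparison is pathwise (\<open>walk_tracks_path\<close>): while a coordinate keeps its velocity, \<open>y\<close> grows at unit speed, so
  whether it switches inside a cell is decided by the points below an explicit line. Up to the \<open>k\<close>-th cell the walk is off by at
  most \<open>h\<close> per flip, so path and walk agree about the next cell unless \<open>Z\<^sub>k\<close>
  falls in a strip of width of order \<open>h\<close> around the threshold, or the cell contains two points below a level \<open>K\<close>
  that exceeds all thresholds with high probability. A cell sees either event with probability of order \<open>h\<^sup>2\<close>; over \<open>n\<close> cells and \<open>d\<close> coordinates this vanishes as \<open>n \<rightarrow> \<infinity>\<close> with \<open>d\<close> fixed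
  (\<open>num_jumps_eq_total_flips_whp\<close>). Thus for each \<open>d\<close> the count is a limit in probability of sums of \<open>d\<close> independent
  flip counts, and the bound of order \<open>1 / d\<close> that Chebyshev's inequality gives for those
  passes to it (\<open>scaled_num_jumps_concentration\<close>).\<close>

section \<open>Paths driven by a point measure\<close>

abbreviation quadrant :: "(real \<times> real) measure" where
  "quadrant \<equiv> restrict_space lborel ({0..} \<times> {0..})"

text \<open>A right-continuous function is the pointwise limit of its values at the next point of the
  grid of mesh \<open>1 / (n + 1)\<close>, strictly to the right of the argument.\<close>

lemma set_borel_measurable_right_continuous:
  fixes f :: "real \<Rightarrow> real"
  assumes "\<And>t. a \<le> t \<Longrightarrow> (f \<longlongrightarrow> f t) (at_right t)"
  shows "set_borel_measurable borel {a..} f"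
proof -
  define g where "g n t = f ((of_int \<lfloor>real (Suc n) * t\<rfloor> + 1) / real (Suc n))" for n t
  have meas: "(\<lambda>t. indicator {a..} t *\<^sub>R g n t) \<in> borel_measurable borel" for n
  proof -
    have "(\<lambda>k::int. f ((of_int k + 1) / real (Suc n))) \<in> borel_measurable (count_space UNIV)"
      by simp
    then have "g n \<in> borel_measurable borel"
      unfolding g_def by measurable
    then show ?thesis by measurable
  qed
  have lim: "(\<lambda>n. indicator {a..} t *\<^sub>R g n t) \<longlonglongrightarrow> indicator {a..} t *\<^sub>R f t" for t
  proof (cases "a \<le> t")
    case True
    define r where "r n = (of_int \<lfloor>real (Suc n) * t\<rfloor> + 1) / real (Suc n)" for n
    have gt: "t < r n" for n
    proof -
      have "real (Suc n) * t < of_int \<lfloor>real (Suc n) * t\<rfloor> + 1" by linarith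
      then show ?thesis unfolding r_def by (simp add: pos_less_divide_eq mult.commute)
    qed
    have le: "r n \<le> t + inverse (real (Suc n))" for n
    proof -
      have "of_int \<lfloor>real (Suc n) * t\<rfloor> + 1 \<le> real (Suc n) * t + 1" by linarith
      then have "r n \<le> (real (Suc n) * t + 1) / real (Suc n)"
        unfolding r_def by (rule divide_right_mono) simp
      also have "\<dots> = t + inverse (real (Suc n))" by (simp add: field_simps)
      finally show ?thesis .
    qed
    have "(\<lambda>n. t + inverse (real (Suc n))) \<longlonglongrightarrow> t + 0"
      by (intro tendsto_add tendsto_const LIMSEQ_inverse_real_of_nat)
    then have "(\<lambda>n. t + inverse (real (Suc n))) \<longlonglongrightarrow> t" by simp
    then have "r \<longlonglongrightarrow> t"
      by (rule tendsto_sandwich[rotated 3]) (use gt le in \<open>auto intro!: always_eventually less_imp_le\<close>)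
    then have "filterlim r (at_right t) sequentially"
      unfolding filterlim_at using gt by (auto intro!: always_eventually simp: less_imp_neq[symmetric])
    then have "(\<lambda>n. f (r n)) \<longlonglongrightarrow> f t"
      using assms[OF True] by (rule filterlim_compose[rotated])
    then show ?thesis using True by (simp add: g_def r_def)
  qed simp
  show ?thesis unfolding set_borel_measurable_def
    by (rule borel_measurable_LIMSEQ_real[OF lim meas])
qed

lemma left_lim_eqI:
  assumes "0 < t" "(f \<longlongrightarrow> l) (at_left t)"
  shows "left_lim f t = l"
  using assms by (simp add: left_lim_def tendsto_Lim)

lemma left_lim_eq_const:
  assumes "s < t" "0 < t" and "\<And>u. s \<le> u \<Longrightarrow> u < t \<Longrightarrow> f u = c"
  shows "left_lim f t = c"
proof (rule left_lim_eqI[OF assms(2)])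
  have "\<forall>\<^sub>F u in at_left t. f u = c"
    using eventually_at_left_real[OF assms(1)] by eventually_elim (use assms(3) in auto)
  then show "(f \<longlongrightarrow> c) (at_left t)"
    by (rule tendsto_eventually)
qed

text \<open>One coordinate of the Zig-Zag process for a fixed outcome. The axis carries no point, so that
  a state with \<open>x v \<le> 0\<close>, whose switching region degenerates to height \<open>0\<close>, cannot switch.\<close>

locale switching_path =
  fixes m :: "(real \<times> real) measure" and x v :: "real \<Rightarrow> real"
  assumes sets_m: "sets m = sets quadrant"
    and cadlag_v: "cadlag v"
    and v_pm: "0 \<le> t \<Longrightarrow> v t \<in> {-1, 1}"
    and x_eq: "0 \<le> t \<Longrightarrow> x t = x 0 + (LBINT s:{0..t}. v s)"
    and v_int: "0 \<le> t \<Longrightarrow> set_integrable m ({0<..t} \<times> {0..})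
        (\<lambda>(s, z). left_lim v s * (if z \<le> max (left_lim x s * left_lim v s) 0 then 1 else 0))"
    and v_eq: "0 \<le> t \<Longrightarrow> v t = v 0 - 2 * (LINT (s, z):{0<..t} \<times> {0..}|m.
        left_lim v s * (if z \<le> max (left_lim x s * left_lim v s) 0 then 1 else 0))"
    and axis: "emeasure m ({0..} \<times> {0}) = 0"
begin

lemma borel_sets_m: "A \<in> sets borel \<Longrightarrow> A \<subseteq> {0..} \<times> {0..} \<Longrightarrow> A \<in> sets m"
  using sets_m by (simp add: sets_restrict_space_iff borel_closed closed_Times)

lemma rect_sets_m: "I \<in> sets borel \<Longrightarrow> J \<in> sets borel \<Longrightarrow> I \<subseteq> {0..} \<Longrightarrow> J \<subseteq> {0..} \<Longrightarrow> I \<times> J \<in> sets m"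
  by (intro borel_sets_m borel_Times) auto

text \<open>Makes the integral in \<open>x_eq\<close> a genuine one, whence the position is Lipschitz.\<close>

lemma v_integrable: assumes "0 \<le> a" shows "set_integrable lborel {a..b} v"
proof -
  have "set_borel_measurable borel {0..} v"
    using cadlag_v unfolding cadlag_def by (intro set_borel_measurable_right_continuous) auto
  then have "set_borel_measurable lborel {0..} v"
    by (simp add: set_borel_measurable_def)
  then have meas: "set_borel_measurable lborel {a..b} v"
    by (rule set_borel_measurable_subset) (use assms in auto)
  have "set_integrable lborel {a..b} (\<lambda>_. 1::real)"
    unfolding set_integrable_def by (simp add: integrable_indicator_iff emeasure_lborel_Icc_eq)
  then show ?thesis
  proof (rule set_integrable_bound)
    have "\<bar>v s\<bar> \<le> 1" if "s \<in> {a..b}" for s using v_pm[of s] that assms by auto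
    then show "AE s in lborel. s \<in> {a..b} \<longrightarrow> norm (v s) \<le> norm (1::real)" by (intro AE_I2) simp
  qed (rule meas)
qed

lemma x_increment:
  assumes "0 \<le> a" "a \<le> b"
  shows "x b - x a = (LBINT s:{a..b}. v s)"
proof -
  have "(LBINT s:{0..a} \<union> {a..b}. v s) = (LBINT s:{0..a}. v s) + (LBINT s:{a..b}. v s)"
  proof (rule set_integral_Un_AE)
    show "AE s in lborel. \<not> (s \<in> {0..a} \<and> s \<in> {a..b})"
      using AE_lborel_singleton[of a] by eventually_elim auto
  qed (use v_integrable assms in auto)
  moreover have "{0..a} \<union> {a..b} = {0..b}" using assms by auto
  ultimately show ?thesis using x_eq[of a] x_eq[of b] assms by simp
qed

lemma x_lipschitz:
  assumes "0 \<le> a" "a \<le> b"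
  shows "\<bar>x b - x a\<bar> \<le> b - a"
proof -
  have "norm (LBINT s:{a..b}. v s) \<le> (LBINT s:{a..b}. norm (v s))"
    by (rule set_integral_norm_bound[OF v_integrable[OF assms(1)]])
  also have "\<dots> = (LBINT s:{a..b}. 1)"
  proof (rule set_lebesgue_integral_cong)
    have "norm (v s) = 1" if "s \<in> {a..b}" for s using v_pm[of s] that assms by auto
    then show "\<forall>s. s \<in> {a..b} \<longrightarrow> norm (v s) = 1" by blast
  qed simp
  also have "\<dots> = b - a" using assms by (simp add: set_integral_const)
  finally show ?thesis using x_increment[OF assms] by simp
qed

lemma x_const_velocity:
  assumes "0 \<le> a" "a \<le> b" and "\<And>u. a \<le> u \<Longrightarrow> u < b \<Longrightarrow> v u = c"
  shows "x b = x a + c * (b - a)"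
proof -
  have "(LBINT s:{a..b}. v s) = (LBINT s:{a..b}. c)"
    unfolding set_lebesgue_integral_def
  proof (rule integral_cong_AE)
    show "AE s in lborel. indicator {a..b} s *\<^sub>R v s = indicator {a..b} s *\<^sub>R c"
      using AE_lborel_singleton[of b] by eventually_elim (use assms in \<open>auto simp: indicator_def\<close>)
  qed (use v_integrable[OF assms(1), of b] in \<open>auto simp: set_integrable_def intro: borel_measurable_integrable\<close>)
  also have "\<dots> = c * (b - a)" using assms by (simp add: set_integral_const)
  finally show ?thesis using x_increment[OF assms(1,2)] by simp
qed

lemma x_left_lim: assumes "0 < t" shows "(x \<longlongrightarrow> x t) (at_left t)"
proof -
  have "((\<lambda>u. x t - (t - u)) \<longlongrightarrow> x t - (t - t)) (at_left t)" by (intro tendsto_intros)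
  moreover have "((\<lambda>u. x t + (t - u)) \<longlongrightarrow> x t + (t - t)) (at_left t)" by (intro tendsto_intros)
  moreover have ev: "\<forall>\<^sub>F u in at_left t. x t - (t - u) \<le> x u \<and> x u \<le> x t + (t - u)"
    using eventually_at_left_real[OF assms]
  proof eventually_elim
    case (elim u)
    then show ?case using x_lipschitz[of u t] by (auto simp: abs_le_iff)
  qed
  ultimately show ?thesis
    by (intro tendsto_sandwich[of "\<lambda>u. x t - (t - u)" x _ "\<lambda>u. x t + (t - u)"])
       (use ev in \<open>auto elim!: eventually_mono\<close>)
qed

lemma left_lim_x: "0 \<le> t \<Longrightarrow> left_lim x t = x t"
  using left_lim_eqI[OF _ x_left_lim] by (cases "t = 0") (auto simp: left_lim_def)

lemma v_left_lim: assumes "0 < t" shows "(v \<longlongrightarrow> left_lim v t) (at_left t)" "left_lim v t \<in> {-1, 1}"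
proof -
  obtain l where l: "(v \<longlongrightarrow> l) (at_left t)" using cadlag_v assms unfolding cadlag_def by blast
  then have eq: "left_lim v t = l" using assms by (rule left_lim_eqI[rotated])
  then show "(v \<longlongrightarrow> left_lim v t) (at_left t)" using l by simp
  have "\<forall>\<^sub>F u in at_left t. v u \<in> {-1, 1}"
    using eventually_at_left_real[OF assms] by eventually_elim (use v_pm in auto)
  then show "left_lim v t \<in> {-1, 1}" unfolding eq
    by (intro Lim_in_closed_set[OF _ _ _ l]) auto
qed

lemma v_increment:
  assumes "0 \<le> s" "s \<le> t"
  shows "v t - v s = - 2 * (LINT (u, z):{s<..t} \<times> {0..}|m.
      left_lim v u * (if z \<le> max (x u * left_lim v u) 0 then 1 else 0))"
proof -
  let ?f = "\<lambda>(u, z). left_lim v u * (if z \<le> max (left_lim x u * left_lim v u) 0 then 1 else 0)"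
  have un: "{0<..s} \<times> {0::real..} \<union> {s<..t} \<times> {0..} = {0<..t} \<times> {0..}" using assms by auto
  have i: "set_integrable m ({s<..t} \<times> {0..}) ?f"
    using v_int[of t] by (rule set_integrable_subset) (use assms in \<open>auto intro!: rect_sets_m\<close>)
  have "set_lebesgue_integral m ({0<..s} \<times> {0..} \<union> {s<..t} \<times> {0..}) ?f
      = set_lebesgue_integral m ({0<..s} \<times> {0..}) ?f + set_lebesgue_integral m ({s<..t} \<times> {0..}) ?f"
    by (rule set_integral_Un[OF _ v_int i]) (use assms in auto)
  then have "v t - v s = - 2 * set_lebesgue_integral m ({s<..t} \<times> {0..}) ?f"
    unfolding un using v_eq[of t] v_eq[of s] assms by (simp add: algebra_simps)
  also have "set_lebesgue_integral m ({s<..t} \<times> {0..}) ?f = (LINT (u, z):{s<..t} \<times> {0..}|m.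
      left_lim v u * (if z \<le> max (x u * left_lim v u) 0 then 1 else 0))"
    unfolding set_lebesgue_integral_def
    by (rule Bochner_Integration.integral_cong) (use assms in \<open>auto simp: indicator_def left_lim_x\<close>)
  finally show ?thesis .
qed

lemma v_const_of_null:
  assumes "0 \<le> s" "s \<le> t" "0 \<le> K" and null: "emeasure m ({s<..t} \<times> {0..K}) = 0"
    and K: "\<And>u. s \<le> u \<Longrightarrow> u \<le> t \<Longrightarrow> \<bar>x u\<bar> \<le> K"
  shows "v t = v s"
proof -
  let ?A = "{s<..t} \<times> {0..K}"
  have "?A \<in> null_sets m" using null assms by (auto intro!: rect_sets_m)
  then have "AE p in m. p \<notin> ?A" by (rule AE_not_in)
  then have "AE p in m. indicator ({s<..t} \<times> {0..}) p *\<^sub>R (case p of (u, z) \<Rightarrow> 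
      left_lim v u * (if z \<le> max (x u * left_lim v u) 0 then 1 else 0)) = (0::real)"
  proof eventually_elim
    case (elim p)
    obtain u z where p: "p = (u, z)" by force
    have "x u * left_lim v u \<le> K" if "s < u" "u \<le> t"
    proof -
      have "left_lim v u \<in> {-1, 1}" using v_left_lim that assms by auto
      then show ?thesis using K[of u] that by auto
    qed
    then show ?case using elim p \<open>0 \<le> K\<close> by (cases "s < u \<and> u \<le> t") (auto simp: indicator_def)
  qed
  then show ?thesis
    using v_increment[OF assms(1,2)] unfolding set_lebesgue_integral_def
    by (simp add: integral_eq_zero_AE)
qed

text \<open>The points that would make the path switch in \<open>(a, t]\<close>, had it kept its velocity since \<open>a\<close>:
  then \<open>x v\<close> has slope \<open>1\<close>, and the switching region is bounded by a straight line.\<close>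

definition exposed :: "real \<Rightarrow> real \<Rightarrow> (real \<times> real) set" where
  "exposed a t = {(u, z). a < u \<and> u \<le> t \<and> 0 \<le> z \<and> z \<le> max (x a * v a + (u - a)) 0}"

lemma exposed_sets: assumes "0 \<le> a" shows "exposed a t \<in> sets m"
proof -
  have "{p \<in> space (borel \<Otimes>\<^sub>M borel). a < fst p \<and> fst p \<le> t \<and> 0 \<le> snd p
      \<and> snd p \<le> max (x a * v a + (fst p - a)) 0} \<in> sets (borel \<Otimes>\<^sub>M borel)"
    by measurable
  moreover have "exposed a t = {p \<in> space (borel \<Otimes>\<^sub>M borel). a < fst p \<and> fst p \<le> t \<and> 0 \<le> snd p
      \<and> snd p \<le> max (x a * v a + (fst p - a)) 0}"
    unfolding exposed_def by (auto simp: space_pair_measure)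
  ultimately have "exposed a t \<in> sets borel" by (simp only: borel_prod)
  then show ?thesis using assms by (intro borel_sets_m) (auto simp: exposed_def)
qed

text \<open>Up to and including its first switch, the velocity has the left limit \<open>v a\<close>, so the
  stochastic integral is that constant times the mass of an explicit set. This replaces all
  stochastic calculus: a first switch at \<open>t\<close> means that \<open>exposed a t\<close> has mass \<open>1\<close>.\<close>

lemma increment_until_switch:
  assumes "0 \<le> a" "a < t" and const: "\<And>u. a \<le> u \<Longrightarrow> u < t \<Longrightarrow> v u = v a"
  shows "v t - v a = - 2 * v a * measure m (exposed a t)"
proof -
  have eq: "indicator ({a<..t} \<times> {0..}) p *\<^sub>R (case p of (u, z) \<Rightarrow> 
      left_lim v u * (if z \<le> max (x u * left_lim v u) 0 then 1 else 0)) = v a * indicator (exposed a t) p" for p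
  proof -
    obtain u z where p: "p = (u, z)" by force
    have "left_lim v u = v a \<and> x u * v a = x a * v a + (u - a)" if "a < u" "u \<le> t"
    proof
      show "left_lim v u = v a" by (rule left_lim_eq_const[OF \<open>a < u\<close> _ const]) (use assms(1) that in linarith)+
      have "x u = x a + v a * (u - a)" by (rule x_const_velocity[OF \<open>0 \<le> a\<close> _ const]) (use that in linarith)+
      then show "x u * v a = x a * v a + (u - a)" using v_pm[OF \<open>0 \<le> a\<close>] by (auto simp: algebra_simps)
    qed
    then show ?thesis unfolding p exposed_def
      by (cases "a < u \<and> u \<le> t") (auto simp: indicator_def)
  qed
  show ?thesis
    using v_increment[of a t] assms(1,2) exposed_sets[OF assms(1)]
    unfolding set_lebesgue_integral_def eq by simp
qed

text \<open>Right-continuity makes the infimum of the times with a different velocity one of these times.\<close>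

lemma first_switch:
  assumes "0 \<le> a" "a \<le> t" "v t \<noteq> v a"
  obtains \<tau> where "a < \<tau>" "\<tau> \<le> t" "v \<tau> = - v a" "\<And>u. a \<le> u \<Longrightarrow> u < \<tau> \<Longrightarrow> v u = v a"
proof -
  define S where "S = {u. a \<le> u \<and> v u \<noteq> v a}"
  define \<tau> where "\<tau> = Inf S"
  have tS: "t \<in> S" and bdd: "bdd_below S" using assms by (auto simp: S_def intro: bdd_belowI[of _ a])
  have le: "\<tau> \<le> t" unfolding \<tau>_def by (rule cInf_lower[OF tS bdd])
  have ge: "a \<le> \<tau>" unfolding \<tau>_def by (rule cInf_greatest) (use tS in \<open>auto simp: S_def\<close>)
  have before: "v u = v a" if "a \<le> u" "u < \<tau>" for u
    using that cInf_lower[OF _ bdd, of u] unfolding \<tau>_def[symmetric] by (auto simp: S_def)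
  have "v \<tau> \<noteq> v a"
  proof
    assume eq: "v \<tau> = v a"
    have "(v \<longlongrightarrow> v a) (at_right \<tau>)" using cadlag_v order_trans[OF \<open>0 \<le> a\<close> ge] eq unfolding cadlag_def by metis
    then have "\<forall>\<^sub>F u in at_right \<tau>. dist (v u) (v a) < 1" by (rule tendstoD) simp
    then obtain b where b: "b > \<tau>" "\<And>y. y > \<tau> \<Longrightarrow> y < b \<Longrightarrow> dist (v y) (v a) < 1"
      unfolding eventually_at_right_field by blast
    have "b \<le> u" if u: "u \<in> S" for u
    proof (rule ccontr)
      assume "\<not> b \<le> u"
      moreover have "\<tau> \<le> u" unfolding \<tau>_def by (rule cInf_lower[OF u bdd])
      moreover have "u \<noteq> \<tau>" using u eq by (auto simp: S_def)
      ultimately have "dist (v u) (v a) < 1" using b(2)[of u] by simp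
      then show False using v_pm[of u] v_pm[of a] u assms by (auto simp: S_def dist_real_def)
    qed
    then have "b \<le> \<tau>" unfolding \<tau>_def using tS by (intro cInf_greatest) auto
    then show False using b(1) by simp
  qed
  moreover from this have "a < \<tau>" using ge by (cases "a = \<tau>") auto
  moreover have "v \<tau> = - v a" using \<open>v \<tau> \<noteq> v a\<close> v_pm[of \<tau>] v_pm[of a] ge assms by auto
  ultimately show thesis using that le before by blast
qed

end

section \<open>The guided walk and how it tracks a path\<close>

text \<open>The input \<open>c\<close> holds the initial value at \<open>0\<close> and the height for step \<open>k\<close> at \<open>Suc k\<close>. For exponential
  heights this is a guided random walk in the sense of Gustafson for the normal law, in the coordinate position
  times direction: a rejected move reverses the direction.\<close>

primrec walk :: "real \<Rightarrow> (nat \<Rightarrow> real) \<Rightarrow> nat \<Rightarrow> real" where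
  "walk h c 0 = c 0"
| "walk h c (Suc k) =
    (if c (Suc k) < walk h c k + h / 2 then - walk h c k else walk h c k + h)"

primrec flips :: "real \<Rightarrow> (nat \<Rightarrow> real) \<Rightarrow> nat \<Rightarrow> nat" where
  "flips h c 0 = 0"
| "flips h c (Suc k) = flips h c k + (if c (Suc k) < walk h c k + h / 2 then 1 else 0)"

definition switches :: "(real \<Rightarrow> real) \<Rightarrow> real \<Rightarrow> real \<Rightarrow> real set" where
  "switches v a b = {t. a < t \<and> t \<le> b \<and> v t \<noteq> left_lim v t}"

lemma switches_split:
  assumes "a \<le> b" "b \<le> c"
  shows "switches v a c = switches v a b \<union> switches v b c" "switches v a b \<inter> switches v b c = {}"
  using assms by (auto simp: switches_def)

lemma switches_const:
  assumes "0 \<le> a" and "\<And>u. a \<le> u \<Longrightarrow> u \<le> b \<Longrightarrow> v u = w"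
  shows "switches v a b = {}"
proof -
  have False if "t \<in> switches v a b" for t
  proof -
    have t: "a < t" "t \<le> b" "v t \<noteq> left_lim v t" using that by (auto simp: switches_def)
    then have "left_lim v t = w" by (intro left_lim_eq_const[of a]) (use assms in auto)
    moreover have "v t = w" using t by (intro assms) auto
    ultimately show False using t by simp
  qed
  then show ?thesis by blast
qed

lemma switches_single:
  assumes "0 \<le> a" "a < \<tau>" "\<tau> \<le> b" "w \<noteq> w'"
    and "\<And>u. a \<le> u \<Longrightarrow> u < \<tau> \<Longrightarrow> v u = w" "\<And>u. \<tau> \<le> u \<Longrightarrow> u \<le> b \<Longrightarrow> v u = w'"
  shows "switches v a b = {\<tau>}"
proof -
  have ll: "left_lim v t = (if t \<le> \<tau> then w else w')" if "a < t" "t \<le> b" for t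
  proof (cases "t \<le> \<tau>")
    case True
    then show ?thesis by (simp, intro left_lim_eq_const[of a]) (use assms that in auto)
  next
    case False
    then show ?thesis by (simp, intro left_lim_eq_const[of \<tau>]) (use assms that in auto)
  qed
  show ?thesis
  proof (intro set_eqI iffI)
    fix t assume "t \<in> switches v a b"
    then have t: "a < t" "t \<le> b" "v t \<noteq> left_lim v t" by (auto simp: switches_def)
    then show "t \<in> {\<tau>}"
      using ll[of t] assms(5)[of t] assms(6)[of t] by (cases t \<tau> rule: linorder_cases) auto
  next
    fix t assume "t \<in> {\<tau>}"
    then show "t \<in> switches v a b"
      using ll[of \<tau>] assms(6)[of \<tau>] assms by (auto simp: switches_def)
  qed
qed

context switching_path begin

text \<open>A first switch would need mass in the exposed set, which lies below the height \<open>c\<close> or on the axis.\<close>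

lemma no_switch_if_no_point_exposed:
  assumes "0 \<le> a" and null: "emeasure m ({a<..b} \<times> {0..<c}) = 0"
    and below: "x a * v a + (b - a) < c"
    and u: "a \<le> u" "u \<le> b"
  shows "v u = v a"
proof (rule ccontr)
  assume "v u \<noteq> v a"
  then obtain \<tau> where \<tau>: "a < \<tau>" "\<tau> \<le> u" "v \<tau> = - v a" "\<And>s. a \<le> s \<Longrightarrow> s < \<tau> \<Longrightarrow> v s = v a"
    using first_switch[OF assms(1) u(1)] by metis
  have sub: "exposed a \<tau> \<subseteq> {0..} \<times> {0} \<union> {a<..b} \<times> {0..<c}"
    unfolding exposed_def using \<tau>(1,2) u assms(1) below by (auto simp: max_def split: if_splits)
  have "{0..} \<times> {0} \<union> {a<..b} \<times> {0..<c} \<in> null_sets m"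
    using null axis assms(1) by (intro null_sets.Un null_setsI rect_sets_m) auto
  then have "exposed a \<tau> \<in> null_sets m"
    using sub by (rule null_sets_subset[OF _ exposed_sets[OF assms(1)]])
  then have "measure m (exposed a \<tau>) = 0" by (simp add: measure_def null_setsD1)
  then have "v \<tau> = v a" using increment_until_switch[OF assms(1) \<tau>(1,4)] by simp
  then show False using \<tau>(3) v_pm[OF assms(1)] by auto
qed

text \<open>A point below height \<open>c\<close> is exposed from the start of the interval, so a switch occurs. It uses up the
  total mass \<open>1\<close> allowed below \<open>K\<close>, and leaves nothing to switch at afterwards.\<close>

lemma one_switch_if_point_exposed:
  assumes "0 \<le> a" "a \<le> b" and pt: "emeasure m ({a<..b} \<times> {0..<c}) \<noteq> 0"
    and above: "c \<le> x a * v a"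
    and le1: "emeasure m ({a<..b} \<times> {0..K}) \<le> 1"
    and K: "\<And>u. a \<le> u \<Longrightarrow> u \<le> b \<Longrightarrow> \<bar>x u\<bar> \<le> K"
  obtains \<tau> where "a < \<tau>" "\<tau> \<le> b" "x \<tau> * v a = x a * v a + (\<tau> - a)"
    "\<And>u. a \<le> u \<Longrightarrow> u < \<tau> \<Longrightarrow> v u = v a" "\<And>u. \<tau> \<le> u \<Longrightarrow> u \<le> b \<Longrightarrow> v u = - v a"
proof -
  have c0: "0 < c" using pt by (cases "0 < c") auto
  have va: "v a \<in> {-1, 1}" using v_pm assms by simp
  have "{a<..b} \<times> {0::real..<c} \<noteq> {}" using pt by (metis emeasure_empty)
  then have ab: "a < b" by auto
  have K0: "0 \<le> K" using K[of a] assms by force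
  have cell: "{a<..b} \<times> {0..K} \<in> sets m" using assms by (intro rect_sets_m) auto
  have xK: "x u * v a = x a * v a + (u - a) \<and> x a * v a + (u - a) \<le> K"
    if "a \<le> u" "u \<le> b" "\<And>s. a \<le> s \<Longrightarrow> s < u \<Longrightarrow> v s = v a" for u
  proof -
    have "x u = x a + v a * (u - a)" by (rule x_const_velocity[OF assms(1) that(1,3)])
    then have "x u * v a = x a * v a + (u - a)" using va by (auto simp: algebra_simps)
    moreover have "x u * v a \<le> K" using K[of u] va that by auto
    ultimately show ?thesis by simp
  qed
  have sub: "exposed a u \<subseteq> {a<..u} \<times> {0..K}"
    if "a \<le> u" "u \<le> b" "\<And>s. a \<le> s \<Longrightarrow> s < u \<Longrightarrow> v s = v a" for u
  proof
    fix p assume "p \<in> exposed a u"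
    then obtain s z where p: "p = (s, z)" "a < s" "s \<le> u" "0 \<le> z" "z \<le> max (x a * v a + (s - a)) 0"
      unfolding exposed_def by blast
    have "max (x a * v a + (s - a)) 0 \<le> K" using xK[OF that] K0 p(3) by simp
    then have "z \<le> K" using p(5) by (rule order_trans[rotated])
    then show "p \<in> {a<..u} \<times> {0..K}" using p by simp
  qed
  have "\<exists>u. a \<le> u \<and> u \<le> b \<and> v u \<noteq> v a"
  proof (rule ccontr)
    assume "\<not> ?thesis"
    then have const: "v u = v a" if "a \<le> u" "u \<le> b" for u using that by blast
    have "{a<..b} \<times> {0..<c} \<subseteq> exposed a b" using above c0 unfolding exposed_def by auto
    then have "emeasure m ({a<..b} \<times> {0..<c}) \<le> emeasure m (exposed a b)"
      by (rule emeasure_mono[OF _ exposed_sets[OF assms(1)]])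
    then have "emeasure m (exposed a b) \<noteq> 0" using pt by auto
    moreover have "emeasure m (exposed a b) \<le> 1"
      using emeasure_mono[OF sub[OF assms(2) order_refl const] cell] le1 by (meson less_imp_le order_trans)
    ultimately have "measure m (exposed a b) \<noteq> 0"
      unfolding measure_def by (auto simp: enn2real_eq_0_iff top_unique)
    moreover have "v b - v a = - 2 * v a * measure m (exposed a b)"
      by (rule increment_until_switch[OF assms(1) ab const]) simp_all
    ultimately show False using const[of b] ab va by auto
  qed
  then obtain u where u: "a \<le> u" "u \<le> b" "v u \<noteq> v a" by blast
  then obtain \<tau> where \<tau>: "a < \<tau>" "\<tau> \<le> u" "v \<tau> = - v a" "\<And>s. a \<le> s \<Longrightarrow> s < \<tau> \<Longrightarrow> v s = v a"
    using first_switch[OF assms(1) u(1)] by metis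
  have \<tau>b: "\<tau> \<le> b" using \<tau>(2) u(2) by simp
  have "v \<tau> - v a = - 2 * v a * measure m (exposed a \<tau>)"
    by (rule increment_until_switch[OF assms(1) \<tau>(1,4)])
  then have "measure m (exposed a \<tau>) = 1" using \<tau>(3) va by auto
  moreover have "emeasure m (exposed a \<tau>) \<noteq> \<infinity>"
    using calculation unfolding measure_def by auto
  ultimately have one: "emeasure m (exposed a \<tau>) = 1"
    by (metis emeasure_eq_ennreal_measure ennreal_1 infinity_ennreal_def)
  let ?R = "{\<tau><..b} \<times> {0..K}"
  have R: "?R \<in> sets m" using assms(1) \<tau>(1) by (intro rect_sets_m) auto
  have ex: "exposed a \<tau> \<subseteq> {a<..\<tau>} \<times> {0..K}"
    using sub[OF less_imp_le[OF \<tau>(1)] \<tau>b \<tau>(4)] .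
  have "emeasure m (exposed a \<tau>) + emeasure m ?R = emeasure m (exposed a \<tau> \<union> ?R)"
    by (rule plus_emeasure[OF exposed_sets[OF assms(1)] R]) (use ex in auto)
  also have "\<dots> \<le> emeasure m ({a<..b} \<times> {0..K})"
  proof (rule emeasure_mono[OF _ cell])
    have "{a<..\<tau>} \<times> {0..K} \<subseteq> {a<..b} \<times> {0..K}" "?R \<subseteq> {a<..b} \<times> {0..K}"
      using \<tau>(1) \<tau>b by auto
    then show "exposed a \<tau> \<union> ?R \<subseteq> {a<..b} \<times> {0..K}" using ex by blast
  qed
  also have "\<dots> \<le> 1" by (rule le1)
  finally have "1 + emeasure m ?R \<le> 1 + 0" using one by simp
  then have R0: "emeasure m ?R = 0" by (subst (asm) ennreal_add_left_cancel_le) auto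
  have after: "v s = - v a" if "\<tau> \<le> s" "s \<le> b" for s
  proof -
    have "emeasure m ({\<tau><..s} \<times> {0..K}) \<le> emeasure m ?R"
      by (rule emeasure_mono[OF _ R]) (use that in auto)
    then have "emeasure m ({\<tau><..s} \<times> {0..K}) = 0" using R0 by simp
    then have "v s = v \<tau>"
      by (intro v_const_of_null[of \<tau> s K]) (use that \<tau>(1) assms(1) K0 K in auto)
    then show ?thesis using \<tau>(3) by simp
  qed
  show thesis
    using that[OF \<tau>(1) \<tau>b _ \<tau>(4) after] xK[OF less_imp_le[OF \<tau>(1)] \<tau>b \<tau>(4)] by blast
qed

text \<open>Each flip adds at most \<open>h\<close> to the distance between \<open>x v\<close> and the walk, which reflects as if
  the switch took place in the middle of the cell. In the next cell, threshold and path then differ by this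
  accumulated error, by at most \<open>h\<close> for the motion inside the cell and by the shift \<open>h / 2\<close>. A margin of
  \<open>flips + 2\<close> steps covers all three, so a height outside this margin is judged alike by both.\<close>

theorem walk_tracks_path:
  fixes h K :: real and n :: nat and c :: "nat \<Rightarrow> real"
  assumes h: "0 < h" and c0: "c 0 = x 0 * v 0" and K: "\<bar>x 0\<bar> + real n * h \<le> K"
    and height: "\<And>k a. k < n \<Longrightarrow>
      a \<le> c (Suc k) \<longleftrightarrow> emeasure m ({real k * h<..real (Suc k) * h} \<times> {0..<a}) = 0"
    and single: "\<And>k. k < n \<Longrightarrow> emeasure m ({real k * h<..real (Suc k) * h} \<times> {0..K}) \<le> 1"
    and clear: "\<And>k. k < n \<Longrightarrow> \<not> (walk h c k + h / 2 - (real (flips h c k) + 2) * h \<le> c (Suc k)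
      \<and> c (Suc k) < walk h c k + h / 2 + (real (flips h c k) + 2) * h)"
    and kn: "k \<le> n"
  shows "\<bar>x (real k * h) * v (real k * h) - walk h c k\<bar> \<le> real (flips h c k) * h \<and>
    finite (switches v 0 (real k * h)) \<and> card (switches v 0 (real k * h)) = flips h c k \<and>
    (\<forall>t\<in>switches v 0 (real k * h). x t \<noteq> 0 \<and>
      (\<exists>j<k. real j * h < t \<and> t \<le> real (Suc j) * h \<and> c (Suc j) < walk h c j + h / 2))"
proof -
  define Q where "Q k t \<longleftrightarrow> (\<exists>j<k. real j * h < t \<and> t \<le> real (Suc j) * h
    \<and> c (Suc j) < walk h c j + h / 2)" for k t
  have Q_Suc: "Q (Suc k) t" if "Q k t" for k t
    using that less_SucI unfolding Q_def by blast
  show ?thesis using kn unfolding Q_def[symmetric]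
  proof (induction k)
    case 0
    have "switches v 0 0 = {}" by (auto simp: switches_def)
    then show ?case using c0 by simp
  next
    case (Suc k)
    define a where "a = real k * h"
    define b where "b = real (Suc k) * h"
    have kn: "k < n" using Suc.prems by simp
    have a0: "0 \<le> a" using h by (simp add: a_def)
    have b: "b = a + h" by (simp add: a_def b_def algebra_simps)
    have bn: "b \<le> real n * h" unfolding b_def by (rule mult_right_mono) (use kn h in auto)
    have xK: "\<bar>x u\<bar> \<le> K" if "a \<le> u" "u \<le> b" for u
      using x_lipschitz[of 0 u] that a0 bn K by auto
    define y where "y = x a * v a"
    define X where "X = walk h c k"
    define J where "J = real (flips h c k)"
    have J0: "0 \<le> J" by (simp add: J_def)
    note IH = Suc.IH[OF less_imp_le[OF kn], folded a_def, folded y_def X_def J_def]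
    have IH1: "\<bar>y - X\<bar> \<le> J * h"
      and IH2: "finite (switches v 0 a)" "card (switches v 0 a) = flips h c k"
      and IH3: "\<And>t. t \<in> switches v 0 a \<Longrightarrow> x t \<noteq> 0 \<and> Q (Suc k) t"
      using IH Q_Suc by blast+
    have sp: "switches v 0 b = switches v 0 a \<union> switches v a b" "switches v 0 a \<inter> switches v a b = {}"
      using switches_split[of 0 a b v] a0 b h by auto
    have va: "v a \<in> {-1, 1}" using v_pm a0 by simp
    have clear': "c (Suc k) < X + h / 2 - (J + 2) * h \<or> X + h / 2 + (J + 2) * h \<le> c (Suc k)"
      using clear[OF kn] unfolding X_def J_def by auto
    have height': "q \<le> c (Suc k) \<longleftrightarrow> emeasure m ({a<..b} \<times> {0..<q}) = 0" for q
      using height[OF kn] unfolding a_def b_def by simp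
    have single': "emeasure m ({a<..b} \<times> {0..K}) \<le> 1"
      using single[OF kn] unfolding a_def b_def .
    have ab: "a \<le> b" using b h by simp
    show ?case
    proof (cases "c (Suc k) < X + h / 2")
      case True
      then have lo: "c (Suc k) < X + h / 2 - (J + 2) * h" using clear' J0 h by (smt (verit) mult_nonneg_nonneg)
      then have lt: "c (Suc k) < y" and hy: "0 < y"
      proof -
        have "(J + 2) * h = J * h + 2 * h" by (simp add: algebra_simps)
        then show "c (Suc k) < y" using lo IH1 h by linarith
        have "0 \<le> c (Suc k)" using height'[of 0] by simp
        then show "0 < y" using \<open>c (Suc k) < y\<close> by simp
      qed
      have "emeasure m ({a<..b} \<times> {0..<y}) \<noteq> 0" using height'[of y] lt by simp
      then obtain \<tau> where \<tau>: "a < \<tau>" "\<tau> \<le> b" "x \<tau> * v a = y + (\<tau> - a)"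
        "\<And>u. a \<le> u \<Longrightarrow> u < \<tau> \<Longrightarrow> v u = v a" "\<And>u. \<tau> \<le> u \<Longrightarrow> u \<le> b \<Longrightarrow> v u = - v a"
        using one_switch_if_point_exposed[OF a0 _ _ _ single' xK, of y] ab y_def
        by (metis order_refl)
      have sw: "switches v a b = {\<tau>}"
        by (rule switches_single[OF a0 \<tau>(1,2) _ \<tau>(4,5)]) (use va in auto)
      have "x b = x \<tau> + (- v a) * (b - \<tau>)"
        by (rule x_const_velocity[OF _ _ \<tau>(5)]) (use \<tau>(1,2) a0 in auto)
      then have "x b * v b = - (x \<tau> * v a) + (b - \<tau>)"
        using \<tau>(2) \<tau>(5)[of b] va by (auto simp: algebra_simps)
      then have xb: "x b * v b = - y + (b + a - 2 * \<tau>)" using \<tau>(3) by simp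
      have fl: "flips h c (Suc k) = flips h c k + 1" "walk h c (Suc k) = - X"
        using True unfolding X_def by auto
      have "\<bar>x b * v b - walk h c (Suc k)\<bar> \<le> real (Suc (flips h c k)) * h"
        using xb IH1 \<tau>(1,2) b unfolding fl(2) J_def by (simp add: algebra_simps abs_le_iff)
      moreover have "x \<tau> \<noteq> 0" using \<tau>(1,3) hy by auto
      moreover have "\<tau> \<notin> switches v 0 a" using \<tau>(1) by (auto simp: switches_def)
      moreover have "Q (Suc k) \<tau>"
        using \<tau>(1,2) True unfolding a_def b_def X_def Q_def by blast
      ultimately show ?thesis
        unfolding b_def[symmetric] sp(1) sw fl(1) using IH2 IH3
        by (intro conjI ballI) (auto simp: J_def simp del: walk.simps of_nat_Suc)
    next
      case False
      then have "X + h / 2 + (J + 2) * h \<le> c (Suc k)" using clear' J0 h by (smt (verit) mult_nonneg_nonneg)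
      moreover have "(J + 2) * h = J * h + 2 * h" by (simp add: algebra_simps)
      ultimately have below: "x a * v a + (b - a) < c (Suc k)" using IH1 h b unfolding y_def by linarith
      have const: "v u = v a" if "a \<le> u" "u \<le> b" for u
        using height'[of "c (Suc k)"] by (intro no_switch_if_no_point_exposed[OF a0 _ below that]) simp
      have sw: "switches v a b = {}" by (rule switches_const[OF a0 const])
      have "x b = x a + v a * (b - a)"
        by (rule x_const_velocity[OF a0 _ const]) (use b h in auto)
      then have xb: "x b * v b = y + h"
        using const[of b] va b h unfolding y_def by (auto simp: algebra_simps)
      have fl: "flips h c (Suc k) = flips h c k" "walk h c (Suc k) = X + h"
        using False unfolding X_def by auto
      have "\<bar>x b * v b - walk h c (Suc k)\<bar> \<le> J * h" using xb IH1 unfolding fl(2) by simp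
      then show ?thesis
        unfolding b_def[symmetric] sp(1) sw fl(1) using IH2 IH3
        by (intro conjI ballI) (auto simp: J_def simp del: walk.simps of_nat_Suc)
    qed
  qed
qed

end

section \<open>Stationarity of the guided walk\<close>

abbreviation std_normal :: "real measure" where
  "std_normal \<equiv> density lborel (\<lambda>x. ennreal (std_normal_density x))"

lemma walk_cong: "(\<And>j. j \<le> k \<Longrightarrow> c j = c' j) \<Longrightarrow> walk h c k = walk h c' k"
  by (induction k) auto

lemma flips_cong: "(\<And>j. j \<le> k \<Longrightarrow> c j = c' j) \<Longrightarrow> flips h c k = flips h c' k"
proof (induction k)
  case (Suc k)
  then have "walk h c k = walk h c' k" by (intro walk_cong) auto
  with Suc show ?case by auto
qed simp

lemma measurable_walk:
  "{..k} \<subseteq> A \<Longrightarrow> (\<lambda>c. walk h c k) \<in> borel_measurable (PiM A (\<lambda>_. borel))"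
proof (induction k)
  case 0
  then show ?case by (simp add: measurable_component_singleton)
next
  case (Suc k)
  then have "{..k} \<subseteq> A" by auto
  with Suc have [measurable]: "(\<lambda>c. walk h c k) \<in> borel_measurable (PiM A (\<lambda>_. borel))"
    "(\<lambda>c. c (Suc k)) \<in> borel_measurable (PiM A (\<lambda>_. borel))"
    by (auto intro!: measurable_component_singleton)
  show ?case unfolding walk.simps by measurable
qed

lemma measurable_flips:
  "{..k} \<subseteq> A \<Longrightarrow> (\<lambda>c. flips h c k) \<in> measurable (PiM A (\<lambda>_. borel)) (count_space UNIV)"
proof (induction k)
  case (Suc k)
  then have "{..k} \<subseteq> A" by auto
  with Suc have [measurable]: "(\<lambda>c. flips h c k) \<in> measurable (PiM A (\<lambda>_. borel)) (count_space UNIV)"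
    "(\<lambda>c. walk h c k) \<in> borel_measurable (PiM A (\<lambda>_. borel))"
    "(\<lambda>c. c (Suc k)) \<in> borel_measurable (PiM A (\<lambda>_. borel))"
    by (auto intro!: measurable_component_singleton measurable_walk)
  show ?case unfolding flips.simps by measurable
qed simp

lemma walk_bound: "0 \<le> h \<Longrightarrow> \<bar>walk h c k\<bar> \<le> \<bar>c 0\<bar> + real k * h"
  by (induction k) (auto simp: algebra_simps)

lemma flips_mono: "j \<le> k \<Longrightarrow> flips h c j \<le> flips h c k"
  by (induction k) (auto simp: le_Suc_eq)

lemma flips_eq_sum: "real (flips h c n) = (\<Sum>k<n. of_bool (c (Suc k) < walk h c k + h / 2))"
  by (induction n) auto

lemma one_minus_exp_le: "1 - exp (- y) \<le> (y::real)"
  using exp_ge_add_one_self[of "- y"] by simp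

text \<open>Multiply by \<open>exp y \<ge> 1 + y + y\<^sup>2 / 2\<close>; the product of the two quadratics is \<open>1 + y\<^sup>4 / 4\<close>.\<close>

lemma one_minus_exp_ge:
  assumes "0 \<le> (y::real)" shows "y - y\<^sup>2 / 2 \<le> 1 - exp (- y)"
proof -
  have "1 \<le> (1 - y + y\<^sup>2 / 2) * (1 + y + y\<^sup>2 / 2)"
    using zero_le_power_eq_numeral[of y "num.Bit0 (num.Bit0 num.One)"] by (simp add: algebra_simps power2_eq_square power4_eq_xxxx)
  also have "\<dots> \<le> (1 - y + y\<^sup>2 / 2) * exp y"
  proof (rule mult_left_mono)
    show "1 + y + y\<^sup>2 / 2 \<le> exp y" using exp_lower_Taylor_quadratic[OF assms] by simp
    have "0 \<le> (y - 1)\<^sup>2 + 1" by simp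
    then show "0 \<le> 1 - y + y\<^sup>2 / 2" by (simp add: power2_eq_square algebra_simps)
  qed
  finally show ?thesis by (simp add: exp_minus field_simps)
qed

text \<open>Both sides are the smaller of the two densities at \<open>x - h\<close> and at \<open>x\<close>, which change
  order where the midpoint \<open>x - h / 2\<close> of the move passes through \<open>0\<close>; this is why the threshold is taken at the
  midpoint.\<close>

lemma std_normal_detailed_balance:
  "std_normal_density (x - h) * exp (- (h * max (x - h / 2) 0))
    = std_normal_density x * exp (- (h * max (h / 2 - x) 0))"
proof -
  have "- (x - h)\<^sup>2 / 2 - h * max (x - h / 2) 0 = - x\<^sup>2 / 2 - h * max (h / 2 - x) 0"
    by (cases "x \<le> h / 2") (auto simp: max_def power2_eq_square field_simps)
  then show ?thesis unfolding std_normal_density_def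
    by (simp add: exp_add[symmetric] mult.assoc)
qed

text \<open>Mass arrives at \<open>x\<close> by an accepted move from \<open>x - h\<close> or by a flip from \<open>- x\<close>. By detailed balance the first part
  is \<open>\<phi> x\<close> times the acceptance probability at \<open>- x\<close>, and the second is \<open>\<phi> x\<close> times the rejection probability
  at \<open>- x\<close>.\<close>

lemma guided_walk_invariant:
  fixes A :: "real set"
  assumes A[measurable]: "A \<in> sets borel" and h: "0 \<le> h"
  shows "(\<integral>\<^sup>+x. indicator A (x + h) * ennreal (exp (- (h * max (x + h / 2) 0)))
      + indicator A (- x) * ennreal (1 - exp (- (h * max (x + h / 2) 0))) \<partial>std_normal)
    = emeasure std_normal A"
proof -
  let ?s = std_normal_density
  let ?e = "\<lambda>x. exp (- (h * max (x + h / 2) 0))"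
  have e1: "0 \<le> 1 - ?e x" for x using h by simp
  have "(\<integral>\<^sup>+x. indicator A (x + h) * ennreal (?e x) + indicator A (- x) * ennreal (1 - ?e x) \<partial>std_normal)
     = (\<integral>\<^sup>+x. ennreal (?s x) * (indicator A (x + h) * ennreal (?e x)) +
            ennreal (?s x) * (indicator A (- x) * ennreal (1 - ?e x)) \<partial>lborel)"
    by (subst nn_integral_density) (auto simp: distrib_left)
  also have "\<dots> = (\<integral>\<^sup>+x. ennreal (?s x) * (indicator A (x + h) * ennreal (?e x)) \<partial>lborel)
      + (\<integral>\<^sup>+x. ennreal (?s x) * (indicator A (- x) * ennreal (1 - ?e x)) \<partial>lborel)"
    by (rule nn_integral_add) auto
  also have "(\<integral>\<^sup>+x. ennreal (?s x) * (indicator A (x + h) * ennreal (?e x)) \<partial>lborel)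
     = (\<integral>\<^sup>+x. ennreal (?s (x - h)) * (indicator A x * ennreal (?e (x - h))) \<partial>lborel)"
    by (subst nn_integral_real_affine[where c=1 and t="- h"]) (auto simp: algebra_simps)
  also have "(\<integral>\<^sup>+x. ennreal (?s x) * (indicator A (- x) * ennreal (1 - ?e x)) \<partial>lborel)
     = (\<integral>\<^sup>+x. ennreal (?s (- x)) * (indicator A x * ennreal (1 - ?e (- x))) \<partial>lborel)"
    by (subst nn_integral_real_affine[where c="-1" and t=0]) auto
  also have "(\<integral>\<^sup>+x. ennreal (?s (x - h)) * (indicator A x * ennreal (?e (x - h))) \<partial>lborel)
      + (\<integral>\<^sup>+x. ennreal (?s (- x)) * (indicator A x * ennreal (1 - ?e (- x))) \<partial>lborel)
    = (\<integral>\<^sup>+x. ennreal (?s (x - h)) * (indicator A x * ennreal (?e (x - h))) +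
        ennreal (?s (- x)) * (indicator A x * ennreal (1 - ?e (- x))) \<partial>lborel)"
    by (rule nn_integral_add[symmetric]) auto
  also have "\<dots> = (\<integral>\<^sup>+x. ennreal (?s x) * indicator A x \<partial>lborel)"
  proof (rule nn_integral_cong)
    fix x
    have "?s (x - h) * ?e (x - h) + ?s (- x) * (1 - ?e (- x)) = ?s x"
    proof -
      have "?e (- x) = exp (- (h * max (h / 2 - x) 0))" "?e (x - h) = exp (- (h * max (x - h / 2) 0))"
        by (simp_all add: algebra_simps)
      moreover have "?s (- x) = ?s x" by (simp add: std_normal_density_def)
      ultimately show ?thesis using std_normal_detailed_balance[of x h] by (simp add: algebra_simps)
    qed
    then have "ennreal (?s (x - h)) * ennreal (?e (x - h)) + ennreal (?s (- x)) * ennreal (1 - ?e (- x)) = ennreal (?s x)"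
      using e1[of "- x"] by (simp add: ennreal_mult[symmetric] ennreal_plus[symmetric] del: ennreal_plus)
    then show "ennreal (?s (x - h)) * (indicator A x * ennreal (?e (x - h))) +
        ennreal (?s (- x)) * (indicator A x * ennreal (1 - ?e (- x))) = ennreal (?s x) * indicator A x"
      by (simp add: indicator_def)
  qed
  also have "\<dots> = emeasure std_normal A"
    by (simp add: emeasure_density)
  finally show ?thesis .
qed

text \<open>The heights are exponential with rate \<open>h\<close>; half-lines closed on the left are the events that
  become void probabilities of the Poisson measure.\<close>

locale walk_driver = prob_space M for M :: "'w measure" +
  fixes U :: "nat \<Rightarrow> 'w \<Rightarrow> real" and h :: real and n :: nat
  assumes h_pos: "0 < h"
    and indep_U: "indep_vars (\<lambda>_. borel) U {..n}"
    and U_0: "distr M borel (U 0) = std_normal"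
    and U_Suc: "k < n \<Longrightarrow> prob {\<omega> \<in> space M. a \<le> U (Suc k) \<omega>} = exp (- (h * max a 0))"
begin

definition past :: "nat \<Rightarrow> 'w \<Rightarrow> nat \<Rightarrow> real" where
  "past k \<omega> = restrict (\<lambda>i. U i \<omega>) {..k}"

abbreviation "X k \<omega> \<equiv> walk h (\<lambda>i. U i \<omega>) k"
abbreviation "J k \<omega> \<equiv> flips h (\<lambda>i. U i \<omega>) k"

lemma U_measurable: "k \<le> n \<Longrightarrow> U k \<in> borel_measurable M"
  using indep_U unfolding indep_vars_def by auto

lemma past_measurable[measurable]: "k \<le> n \<Longrightarrow> past k \<in> measurable M (PiM {..k} (\<lambda>_. borel))"
  unfolding past_def by (intro measurable_restrict U_measurable) auto

lemma walk_past: "j \<le> k \<Longrightarrow> walk h (past k \<omega>) j = X j \<omega>"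
  unfolding past_def by (rule walk_cong) auto

lemma flips_past: "j \<le> k \<Longrightarrow> flips h (past k \<omega>) j = J j \<omega>"
  unfolding past_def by (rule flips_cong) auto

lemma X_measurable: assumes "k \<le> n" shows "(\<lambda>\<omega>. X k \<omega>) \<in> borel_measurable M"
  using measurable_compose[OF past_measurable[OF assms] measurable_walk[of k "{..k}" h]]
  by (simp add: walk_past)

lemma J_measurable: assumes "k \<le> n" shows "(\<lambda>\<omega>. J k \<omega>) \<in> measurable M (count_space UNIV)"
  using measurable_compose[OF past_measurable[OF assms] measurable_flips[of k "{..k}" h]]
  by (simp add: flips_past)

lemma emeasure_height_ge:
  assumes "k < n" shows "emeasure (distr M borel (U (Suc k))) {a..} = ennreal (exp (- (h * max a 0)))"
proof -
  have "U (Suc k) -` {a..} \<inter> space M = {\<omega> \<in> space M. a \<le> U (Suc k) \<omega>}" by auto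
  then show ?thesis
    using U_Suc[OF assms, of a] U_measurable[of "Suc k"] assms
    by (simp add: emeasure_distr emeasure_eq_measure)
qed

lemma prob_height_less:
  assumes "k < n" shows "prob {\<omega> \<in> space M. U (Suc k) \<omega> < a} = 1 - exp (- (h * max a 0))"
proof -
  have [measurable]: "U (Suc k) \<in> borel_measurable M" using U_measurable assms by simp
  have "{\<omega> \<in> space M. U (Suc k) \<omega> < a} = space M - {\<omega> \<in> space M. a \<le> U (Suc k) \<omega>}" by auto
  then show ?thesis using U_Suc[OF assms, of a] by (simp add: prob_compl)
qed

lemma emeasure_height_less:
  assumes "k < n" shows "emeasure (distr M borel (U (Suc k))) {..<a} = ennreal (1 - exp (- (h * max a 0)))"
proof -
  have "U (Suc k) -` {..<a} \<inter> space M = {\<omega> \<in> space M. U (Suc k) \<omega> < a}" by auto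
  then show ?thesis
    using prob_height_less[OF assms, of a] U_measurable[of "Suc k"] assms
    by (simp add: emeasure_distr emeasure_eq_measure)
qed

lemma emeasure_height_strip:
  assumes k: "k < n" and ab: "a \<le> b"
  shows "emeasure (distr M borel (U (Suc k))) {a..<b} \<le> ennreal (h * (b - a))"
proof -
  let ?D = "distr M borel (U (Suc k))"
  interpret D: prob_space ?D by (rule prob_space_distr) (use U_measurable k in simp)
  have "D.prob {a..<b} = D.prob {..<b} - D.prob {..<a}"
    using D.finite_measure_Diff[of "{..<b}" "{..<a}"] ab by (simp add: lessThan_minus_lessThan lessThan_subset_iff)
  also have "D.prob {..<b} = 1 - exp (- (h * max b 0))" 
    using emeasure_height_less[OF k, of b] h_pos by (simp add: measure_def)
  also have "D.prob {..<a} = 1 - exp (- (h * max a 0))" 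
    using emeasure_height_less[OF k, of a] h_pos by (simp add: measure_def)
  finally have "D.prob {a..<b} = exp (- (h * max a 0)) * (1 - exp (- (h * (max b 0 - max a 0))))"
    by (simp add: algebra_simps exp_add[symmetric])
  also have "\<dots> \<le> 1 * (1 - exp (- (h * (max b 0 - max a 0))))"
    by (rule mult_right_mono) (use ab h_pos in auto)
  also have "\<dots> \<le> h * (max b 0 - max a 0)"
    using one_minus_exp_le by simp
  also have "\<dots> \<le> h * (b - a)" by (rule mult_left_mono) (use ab h_pos in auto)
  finally show ?thesis by (simp add: D.emeasure_eq_measure ennreal_leI)
qed

text \<open>Fubini for the next height, which is independent of everything that determines the walk
  so far. All expectations below are computed by integrating out one height with it.\<close>

lemma nn_integral_past_height:
  assumes k: "k < n" and f[measurable]: "f \<in> borel_measurable (PiM {..k} (\<lambda>_. borel) \<Otimes>\<^sub>M borel)"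
  shows "(\<integral>\<^sup>+\<omega>. f (past k \<omega>, U (Suc k) \<omega>) \<partial>M)
    = (\<integral>\<^sup>+\<omega>. (\<integral>\<^sup>+y. f (past k \<omega>, y) \<partial>distr M borel (U (Suc k))) \<partial>M)"
proof -
  let ?P = "PiM {..k} (\<lambda>_. borel) :: (nat \<Rightarrow> real) measure"
  have [measurable]: "U (Suc k) \<in> borel_measurable M" "past k \<in> measurable M ?P"
    using U_measurable past_measurable k by auto
  let ?Q = "PiM {Suc k} (\<lambda>_. borel) :: (nat \<Rightarrow> real) measure"
  let ?W = "\<lambda>\<omega>. restrict (\<lambda>i. U i \<omega>) {Suc k}"
  have [measurable]: "?W \<in> measurable M ?Q"
    by (intro measurable_restrict) simp
  have "indep_var ?P (past k) ?Q ?W"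
    unfolding past_def[abs_def] by (rule indep_var_restrict[OF indep_U]) (use k in auto)
  then have eq: "distr M (?P \<Otimes>\<^sub>M ?Q) (\<lambda>\<omega>. (past k \<omega>, ?W \<omega>)) = distr M ?P (past k) \<Otimes>\<^sub>M distr M ?Q ?W"
    unfolding indep_var_distribution_eq by simp
  interpret D: prob_space "distr M ?Q ?W" by (rule prob_space_distr) simp
  have [measurable]: "(\<lambda>p. f (fst p, snd p (Suc k))) \<in> borel_measurable (?P \<Otimes>\<^sub>M ?Q)"
    by measurable
  have "(\<integral>\<^sup>+\<omega>. f (past k \<omega>, U (Suc k) \<omega>) \<partial>M)
      = (\<integral>\<^sup>+p. f (fst p, snd p (Suc k)) \<partial>(distr M ?P (past k) \<Otimes>\<^sub>M distr M ?Q ?W))"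
    unfolding eq[symmetric] by (subst nn_integral_distr) auto
  also have "\<dots> = (\<integral>\<^sup>+c. (\<integral>\<^sup>+d. f (c, d (Suc k)) \<partial>distr M ?Q ?W) \<partial>distr M ?P (past k))"
    by (subst D.nn_integral_fst[symmetric]) auto
  finally have fub: "(\<integral>\<^sup>+\<omega>. f (past k \<omega>, U (Suc k) \<omega>) \<partial>M)
      = (\<integral>\<^sup>+c. (\<integral>\<^sup>+d. f (c, d (Suc k)) \<partial>distr M ?Q ?W) \<partial>distr M ?P (past k))" .
  interpret E: prob_space "distr M borel (U (Suc k))" by (rule prob_space_distr) simp
  have [measurable]: "(\<lambda>c. \<integral>\<^sup>+y. f (c, y) \<partial>distr M borel (U (Suc k))) \<in> borel_measurable ?P"
    by (rule E.borel_measurable_nn_integral_fst) simp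
  note fub
  also have "(\<integral>\<^sup>+c. (\<integral>\<^sup>+d. f (c, d (Suc k)) \<partial>distr M ?Q ?W) \<partial>distr M ?P (past k))
      = (\<integral>\<^sup>+c. (\<integral>\<^sup>+y. f (c, y) \<partial>distr M borel (U (Suc k))) \<partial>distr M ?P (past k))"
    by (rule nn_integral_cong) (simp add: nn_integral_distr)
  also have "\<dots> = (\<integral>\<^sup>+\<omega>. (\<integral>\<^sup>+y. f (past k \<omega>, y) \<partial>distr M borel (U (Suc k))) \<partial>M)"
    by (subst nn_integral_distr) auto
  finally show ?thesis .
qed

lemma distr_walk: "k \<le> n \<Longrightarrow> distr M borel (\<lambda>\<omega>. X k \<omega>) = std_normal"
proof (induction k)
  case 0
  then show ?case using U_0 by simp
next
  case (Suc k)
  then have k: "k < n" by simp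
  let ?P = "PiM {..k} (\<lambda>_. borel) :: (nat \<Rightarrow> real) measure"
  let ?D = "distr M borel (U (Suc k))"
  have [measurable]: "(\<lambda>c. walk h c k) \<in> borel_measurable ?P" by (rule measurable_walk) simp
  have [measurable]: "(\<lambda>\<omega>. X k \<omega>) \<in> borel_measurable M" "(\<lambda>\<omega>. X (Suc k) \<omega>) \<in> borel_measurable M"
    using X_measurable[of k] X_measurable[of "Suc k"] Suc.prems by (simp_all del: walk.simps)
  show ?case
  proof (rule measure_eqI)
    fix A assume "A \<in> sets (distr M borel (\<lambda>\<omega>. X (Suc k) \<omega>))"
    then have A[measurable]: "A \<in> sets borel" by simp
    define f where "f = (\<lambda>(c, y). indicator A (walk h c k + h) * indicator {walk h c k + h / 2..} y
        + indicator A (- walk h c k) * indicator {..<walk h c k + h / 2} y :: ennreal)"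
    have fm: "f \<in> borel_measurable (?P \<Otimes>\<^sub>M borel)"
    proof -
      have "f = (\<lambda>p. indicator A (walk h (fst p) k + h) * (if walk h (fst p) k + h / 2 \<le> snd p then 1 else 0)
        + indicator A (- walk h (fst p) k) * (if snd p < walk h (fst p) k + h / 2 then 1 else 0) :: ennreal)"
        by (auto simp: f_def fun_eq_iff indicator_def)
      moreover have "\<dots> \<in> borel_measurable (?P \<Otimes>\<^sub>M borel)" by measurable
      ultimately show ?thesis by simp
    qed
    have "emeasure (distr M borel (\<lambda>\<omega>. X (Suc k) \<omega>)) A = (\<integral>\<^sup>+\<omega>. indicator A (X (Suc k) \<omega>) \<partial>M)"
      by (subst nn_integral_indicator[symmetric]) (auto simp: nn_integral_distr simp del: walk.simps nn_integral_indicator)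
    also have "\<dots> = (\<integral>\<^sup>+\<omega>. f (past k \<omega>, U (Suc k) \<omega>) \<partial>M)"
      by (rule nn_integral_cong) (auto simp: f_def walk_past indicator_def)
    also have "\<dots> = (\<integral>\<^sup>+\<omega>. (\<integral>\<^sup>+y. f (past k \<omega>, y) \<partial>?D) \<partial>M)"
      by (rule nn_integral_past_height[OF k fm])
    also have "\<dots> = (\<integral>\<^sup>+\<omega>. indicator A (X k \<omega> + h) * ennreal (exp (- (h * max (X k \<omega> + h / 2) 0)))
      + indicator A (- X k \<omega>) * ennreal (1 - exp (- (h * max (X k \<omega> + h / 2) 0))) \<partial>M)"
      unfolding f_def
      by (rule nn_integral_cong)
         (simp add: nn_integral_add nn_integral_cmult emeasure_height_ge[OF k] emeasure_height_less[OF k] walk_past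
           del: emeasure_distr)
    also have "\<dots> = (\<integral>\<^sup>+x. indicator A (x + h) * ennreal (exp (- (h * max (x + h / 2) 0)))
      + indicator A (- x) * ennreal (1 - exp (- (h * max (x + h / 2) 0))) \<partial>distr M borel (\<lambda>\<omega>. X k \<omega>))"
      by (subst nn_integral_distr) auto
    also have "\<dots> = emeasure std_normal A"
      unfolding Suc.IH[OF less_imp_le[OF k]] by (rule guided_walk_invariant[OF A]) (use h_pos in simp)
    finally show "emeasure (distr M borel (\<lambda>\<omega>. X (Suc k) \<omega>)) A = emeasure std_normal A" .
  qed simp
qed

end

section \<open>Mean and second moment of the number of flips\<close>

lemma prob_space_std_normal: "prob_space std_normal"
  by (rule prob_space_normal_density) simp

lemma integrable_std_normal_abs_power: "integrable std_normal (\<lambda>x. \<bar>x\<bar> ^ k)"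
proof (subst integrable_real_density)
  show "integrable lborel (\<lambda>x. std_normal_density x * \<bar>x\<bar> ^ k)"
    by (rule integrable_std_normal_moment_abs)
qed auto

lemma expectation_std_normal_pos_part: "(\<integral>x. max x 0 \<partial>std_normal) = 1 / sqrt (2 * pi)"
proof -
  have 1: "has_bochner_integral lborel (\<lambda>x. std_normal_density x * \<bar>x\<bar>) (sqrt (2 / pi))"
    using std_normal_moment_abs_odd[of 0] by simp
  have 2: "has_bochner_integral lborel (\<lambda>x. std_normal_density x * x) 0"
    using std_normal_moment_odd[of 0] by simp
  have "has_bochner_integral lborel (\<lambda>x. (std_normal_density x * \<bar>x\<bar> + std_normal_density x * x) / 2) ((sqrt (2 / pi) + 0) / 2)"
    using has_bochner_integral_add[OF 1 2] by (rule has_bochner_integral_divide_zero)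
  moreover have "(std_normal_density x * \<bar>x\<bar> + std_normal_density x * x) / 2 = std_normal_density x * max x 0" for x
    by (auto simp: max_def)
  ultimately have "(\<integral>x. std_normal_density x * max x 0 \<partial>lborel) = sqrt (2 / pi) / 2"
    by (simp add: has_bochner_integral_integral_eq)
  also have "\<dots> = 1 / sqrt (2 * pi)"
    by (simp add: real_sqrt_divide real_sqrt_mult field_simps)
  finally show ?thesis
    by (subst integral_real_density) auto
qed

definition flip_prob :: "real \<Rightarrow> real" where
  "flip_prob h = (\<integral>x. 1 - exp (- (h * max (x + h / 2) 0)) \<partial>std_normal)"

text \<open>With \<open>y = h u\<close> in \<open>y - y\<^sup>2 / 2 \<le> 1 - exp (- y) \<le> y\<close>, the integrand of \<open>n flip_prob (T / n)\<close> tends to \<open>T max x 0\<close>;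
  it is dominated by \<open>T (\<bar>x\<bar> + T)\<close>.\<close>

lemma flip_prob_limit:
  assumes T: "0 < T"
  shows "(\<lambda>n. real n * flip_prob (T / real n)) \<longlonglongrightarrow> T / sqrt (2 * pi)"
proof -
  interpret prob_space std_normal by (rule prob_space_std_normal)
  define s where "s n x = real n * (1 - exp (- (T / real n * max (x + T / real n / 2) 0)))" for n x
  have bounds: "T * u n x - (T * u n x)\<^sup>2 / 2 / real n \<le> s n x \<and> s n x \<le> T * u n x \<and> 0 \<le> s n x"
    if n: "0 < n" and u: "u n x = max (x + T / real n / 2) 0" for n x and u :: "nat \<Rightarrow> real \<Rightarrow> real"
  proof -
    define y where "y = T / real n * u n x"
    have y0: "0 \<le> y" using T u by (simp add: y_def)
    have s: "s n x = real n * (1 - exp (- y))" by (simp add: s_def y_def u)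
    have ny: "real n * y = T * u n x" using n by (simp add: y_def)
    have "real n * (y - y\<^sup>2 / 2) = T * u n x - (T * u n x)\<^sup>2 / 2 / real n"
      using n by (simp add: y_def power2_eq_square field_simps)
    moreover have "real n * (y - y\<^sup>2 / 2) \<le> s n x" unfolding s
      by (rule mult_left_mono[OF one_minus_exp_ge[OF y0]]) simp
    moreover have "s n x \<le> real n * y" unfolding s
      by (rule mult_left_mono[OF one_minus_exp_le]) simp
    moreover have "0 \<le> s n x" unfolding s using y0 by simp
    ultimately show ?thesis using ny by simp
  qed
  have "(\<lambda>n. \<integral>x. s n x \<partial>std_normal) \<longlonglongrightarrow> (\<integral>x. T * max x 0 \<partial>std_normal)"
  proof (rule integral_dominated_convergence)
    show "integrable std_normal (\<lambda>x. T * (\<bar>x\<bar> + T))"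
      using integrable_std_normal_abs_power[of 1] by (auto intro!: integrable_mult_right Bochner_Integration.integrable_add)
    show "AE x in std_normal. (\<lambda>n. s n x) \<longlonglongrightarrow> T * max x 0"
    proof (rule AE_I2)
      fix x
      define u where "u n x = max (x + T / real n / 2) 0" for n x
      have "(\<lambda>n. T * inverse (real n)) \<longlonglongrightarrow> T * 0"
        by (intro tendsto_intros tendsto_inverse_0_at_top filterlim_real_sequentially)
      then have "(\<lambda>n. T / real n) \<longlonglongrightarrow> 0" by (simp add: divide_inverse)
      then have "(\<lambda>n. max (x + T / real n / 2) 0) \<longlonglongrightarrow> max (x + 0 / 2) 0"
        by (intro tendsto_intros) simp_all
      then have ulim: "(\<lambda>n. u n x) \<longlonglongrightarrow> max x 0" by (simp add: u_def)
      have "(\<lambda>n. T * u n x - (T * u n x)\<^sup>2 / 2 * inverse (real n)) \<longlonglongrightarrow> T * max x 0 - (T * max x 0)\<^sup>2 / 2 * 0"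
        by (intro tendsto_intros ulim tendsto_inverse_0_at_top filterlim_real_sequentially) simp
      then have lo: "(\<lambda>n. T * u n x - (T * u n x)\<^sup>2 / 2 / real n) \<longlonglongrightarrow> T * max x 0"
        unfolding divide_inverse[of _ "real _"] mult_zero_right diff_zero .
      have hi: "(\<lambda>n. T * u n x) \<longlonglongrightarrow> T * max x 0" by (intro tendsto_intros ulim)
      show "(\<lambda>n. s n x) \<longlonglongrightarrow> T * max x 0"
      proof (rule tendsto_sandwich[OF _ _ lo hi])
        show "\<forall>\<^sub>F n in sequentially. T * u n x - (T * u n x)\<^sup>2 / 2 / real n \<le> s n x"
          using eventually_gt_at_top[of 0] by eventually_elim (use bounds[of _ u x] in \<open>simp add: u_def\<close>)
        show "\<forall>\<^sub>F n in sequentially. s n x \<le> T * u n x"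
          using eventually_gt_at_top[of 0] by eventually_elim (use bounds[of _ u x] in \<open>simp add: u_def\<close>)
      qed
    qed
    fix n
    show "AE x in std_normal. norm (s n x) \<le> T * (\<bar>x\<bar> + T)"
    proof (rule AE_I2)
      fix x
      show "norm (s n x) \<le> T * (\<bar>x\<bar> + T)"
      proof (cases "n = 0")
        case False
        have "T / real n \<le> T / 1" using False T by (intro divide_left_mono) auto
        then have "max (x + T / real n / 2) 0 \<le> \<bar>x\<bar> + T" using T by auto
        then have "T * max (x + T / real n / 2) 0 \<le> T * (\<bar>x\<bar> + T)" by (rule mult_left_mono) (use T in simp)
        then show ?thesis using bounds[of n "\<lambda>n x. max (x + T / real n / 2) 0" x] False by simp
      qed (use T in \<open>simp add: s_def\<close>)
    qed
  qed (simp_all add: s_def)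
  then have lim: "(\<lambda>n. \<integral>x. s n x \<partial>std_normal) \<longlonglongrightarrow> T * (1 / sqrt (2 * pi))"
    by (simp add: expectation_std_normal_pos_part)
  have "(\<integral>x. s n x \<partial>std_normal) = real n * flip_prob (T / real n)" for n
    unfolding s_def flip_prob_def by (rule integral_mult_right_zero)
  then show ?thesis using lim by simp
qed

text \<open>The second moment of a Poisson variable with random mean \<open>T W\<close>, where \<open>W = \<bar>x\<bar> + 2 T\<close> bounds
  every threshold that a walk started from \<open>x\<close> can meet up to time \<open>T\<close>.\<close>

definition flips_moment_bound :: "real \<Rightarrow> real" where
  "flips_moment_bound T = T * (\<integral>x. \<bar>x\<bar> + 2 * T \<partial>std_normal) + T\<^sup>2 * (\<integral>x. (\<bar>x\<bar> + 2 * T)\<^sup>2 \<partial>std_normal)"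

lemma flips_moment_bound_nonneg: "0 \<le> T \<Longrightarrow> 0 \<le> flips_moment_bound T"
  unfolding flips_moment_bound_def
  by (intro add_nonneg_nonneg mult_nonneg_nonneg Bochner_Integration.integral_nonneg) auto

context walk_driver begin

lemma nn_integral_height_in_le:
  assumes k: "k < n"
    and [measurable]: "g \<in> borel_measurable (PiM {..k} (\<lambda>_. borel))"
      "(\<lambda>p. indicator (S (fst p)) (snd p) :: ennreal) \<in> borel_measurable (PiM {..k} (\<lambda>_. borel) \<Otimes>\<^sub>M borel)"
    and S: "\<And>c. S c \<in> sets borel" "\<And>c. emeasure (distr M borel (U (Suc k))) (S c) \<le> b c"
  shows "(\<integral>\<^sup>+\<omega>. g (past k \<omega>) * indicator (S (past k \<omega>)) (U (Suc k) \<omega>) \<partial>M) \<le> (\<integral>\<^sup>+\<omega>. g (past k \<omega>) * b (past k \<omega>) \<partial>M)"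
proof -
  let ?f = "\<lambda>p. g (fst p) * indicator (S (fst p)) (snd p) :: ennreal"
  have "(\<integral>\<^sup>+\<omega>. g (past k \<omega>) * indicator (S (past k \<omega>)) (U (Suc k) \<omega>) \<partial>M)
      = (\<integral>\<^sup>+\<omega>. ?f (past k \<omega>, U (Suc k) \<omega>) \<partial>M)" by simp
  also have "\<dots> = (\<integral>\<^sup>+\<omega>. (\<integral>\<^sup>+y. ?f (past k \<omega>, y) \<partial>distr M borel (U (Suc k))) \<partial>M)"
    by (rule nn_integral_past_height[OF k]) measurable
  also have "\<dots> = (\<integral>\<^sup>+\<omega>. g (past k \<omega>) * emeasure (distr M borel (U (Suc k))) (S (past k \<omega>)) \<partial>M)"
    by (rule nn_integral_cong) (simp add: nn_integral_cmult_indicator S(1) del: emeasure_distr)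
  also have "\<dots> \<le> (\<integral>\<^sup>+\<omega>. g (past k \<omega>) * b (past k \<omega>) \<partial>M)"
    by (intro nn_integral_mono mult_left_mono S(2)) simp
  finally show ?thesis .
qed

text \<open>Stationarity makes the probability the same in every step.\<close>

lemma prob_flip:
  assumes k: "k < n"
  shows "prob {\<omega> \<in> space M. U (Suc k) \<omega> < X k \<omega> + h / 2} = flip_prob h"
proof -
  have [measurable]: "(\<lambda>c. walk h c k) \<in> borel_measurable (PiM {..k} (\<lambda>_. borel))" by (rule measurable_walk) simp
  have [measurable]: "(\<lambda>\<omega>. X k \<omega>) \<in> borel_measurable M" "U (Suc k) \<in> borel_measurable M"
    using X_measurable U_measurable k by auto
  interpret N: prob_space std_normal by (rule prob_space_std_normal)
  let ?f = "\<lambda>p. indicator {..<walk h (fst p) k + h / 2} (snd p) :: ennreal"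
  let ?p = "\<lambda>x. 1 - exp (- (h * max (x + h / 2) 0))"
  have p: "0 \<le> ?p x" "?p x \<le> 1" for x using h_pos by auto
  have "?f = (\<lambda>p. if snd p < walk h (fst p) k + h / 2 then 1 else 0)" by (auto simp: indicator_def)
  moreover have "\<dots> \<in> borel_measurable (PiM {..k} (\<lambda>_. borel) \<Otimes>\<^sub>M borel)" by measurable
  ultimately have fm: "?f \<in> borel_measurable (PiM {..k} (\<lambda>_. borel) \<Otimes>\<^sub>M borel)" by simp
  have "emeasure M {\<omega> \<in> space M. U (Suc k) \<omega> < X k \<omega> + h / 2} = (\<integral>\<^sup>+\<omega>. ?f (past k \<omega>, U (Suc k) \<omega>) \<partial>M)"
    by (subst nn_integral_indicator[symmetric])
       (auto intro!: nn_integral_cong simp: walk_past indicator_def simp del: nn_integral_indicator)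
  also have "\<dots> = (\<integral>\<^sup>+\<omega>. (\<integral>\<^sup>+y. ?f (past k \<omega>, y) \<partial>distr M borel (U (Suc k))) \<partial>M)"
    by (rule nn_integral_past_height[OF k fm])
  also have "\<dots> = (\<integral>\<^sup>+\<omega>. ennreal (?p (X k \<omega>)) \<partial>M)"
    by (rule nn_integral_cong) (simp add: emeasure_height_less[OF k] walk_past del: emeasure_distr)
  also have "\<dots> = (\<integral>\<^sup>+x. ennreal (?p x) \<partial>distr M borel (\<lambda>\<omega>. X k \<omega>))"
    by (subst nn_integral_distr) auto
  also have "\<dots> = (\<integral>\<^sup>+x. ennreal (?p x) \<partial>std_normal)" using distr_walk[of k] k by simp
  also have "\<dots> = ennreal (flip_prob h)" unfolding flip_prob_def
    by (rule nn_integral_eq_integral) (use p in \<open>auto intro!: N.integrable_const_bound[where B=1]\<close>)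
  finally show ?thesis
    unfolding emeasure_eq_measure flip_prob_def using p by (subst (asm) ennreal_inj) auto
qed

lemma flips_le: "flips h c k \<le> k"
  by (induction k) auto

lemma expectation_J: "expectation (\<lambda>\<omega>. real (J n \<omega>)) = real n * flip_prob h"
proof -
  have m: "{\<omega> \<in> space M. U (Suc k) \<omega> < X k \<omega> + h / 2} \<in> events" if "k < n" for k
  proof -
    have [measurable]: "(\<lambda>\<omega>. X k \<omega>) \<in> borel_measurable M" "U (Suc k) \<in> borel_measurable M"
      using X_measurable U_measurable that by auto
    show ?thesis by measurable
  qed
  have "expectation (\<lambda>\<omega>. real (J n \<omega>))
      = expectation (\<lambda>\<omega>. \<Sum>k<n. indicator {\<omega> \<in> space M. U (Suc k) \<omega> < X k \<omega> + h / 2} \<omega>)"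
    by (rule Bochner_Integration.integral_cong) (auto simp: flips_eq_sum indicator_def intro!: sum.cong)
  also have "\<dots> = (\<Sum>k<n. prob {\<omega> \<in> space M. U (Suc k) \<omega> < X k \<omega> + h / 2})"
    by (subst Bochner_Integration.integral_sum) (use m in \<open>auto simp: integrable_indicator_iff emeasure_eq_measure\<close>)
  also have "\<dots> = real n * flip_prob h" by (simp add: prob_flip)
  finally show ?thesis .
qed

text \<open>A flip in step \<open>k\<close> forces height \<open>k\<close> below \<open>W = \<bar>U 0\<bar> + 2 T\<close>, which depends on the initial
  value only. Given that value these events are independent with probability at most \<open>h W\<close>, so
  the diagonal of the double sum contributes at most \<open>T E W\<close> and the rest at most \<open>T\<^sup>2 E W\<^sup>2\<close>.\<close>

lemma nn_integral_J_square:
  assumes n: "1 \<le> n"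
  shows "(\<integral>\<^sup>+\<omega>. ennreal ((real (J n \<omega>))\<^sup>2) \<partial>M) \<le> ennreal (flips_moment_bound (real n * h))"
proof -
  interpret N: prob_space std_normal by (rule prob_space_std_normal)
  define T where "T = real n * h"
  have T: "0 < T" using n h_pos by (simp add: T_def)
  define w where "w c = \<bar>c 0\<bar> + 2 * T" for c :: "nat \<Rightarrow> real"
  have w0: "0 \<le> w c" for c using T by (simp add: w_def)
  have wm[measurable]: "w \<in> borel_measurable (PiM {..k} (\<lambda>_. borel))" for k
    unfolding w_def by measurable
  define W where "W \<omega> = \<bar>U 0 \<omega>\<bar> + 2 * T" for \<omega>
  have [measurable]: "U 0 \<in> borel_measurable M" using U_measurable by simp
  have [measurable]: "W \<in> borel_measurable M" unfolding W_def by measurable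
  have wW: "w (past k \<omega>) = W \<omega>" for k \<omega> by (simp add: w_def W_def past_def)
  define m1 where "m1 = (\<integral>x. \<bar>x\<bar> + 2 * T \<partial>std_normal)"
  define m2 where "m2 = (\<integral>x. (\<bar>x\<bar> + 2 * T)\<^sup>2 \<partial>std_normal)"
  have W_int: "(\<integral>\<^sup>+\<omega>. ennreal (f (W \<omega>)) \<partial>M) = ennreal (\<integral>x. f (\<bar>x\<bar> + 2 * T) \<partial>std_normal)"
    if [measurable]: "f \<in> borel_measurable borel" and f: "\<And>x. 0 \<le> x \<Longrightarrow> 0 \<le> f x"
      "integrable std_normal (\<lambda>x. f (\<bar>x\<bar> + 2 * T))" for f
  proof -
    have "(\<integral>\<^sup>+\<omega>. ennreal (f (W \<omega>)) \<partial>M) = (\<integral>\<^sup>+x. ennreal (f (\<bar>x\<bar> + 2 * T)) \<partial>distr M borel (U 0))"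
      unfolding W_def by (subst nn_integral_distr) auto
    also have "\<dots> = ennreal (\<integral>x. f (\<bar>x\<bar> + 2 * T) \<partial>std_normal)"
      unfolding U_0 by (rule nn_integral_eq_integral) (use f T in auto)
    finally show ?thesis .
  qed
  have int1: "integrable std_normal (\<lambda>x. \<bar>x\<bar> + 2 * T)"
    using integrable_std_normal_abs_power[of 1] by (auto intro!: Bochner_Integration.integrable_add)
  have "(\<lambda>x. (\<bar>x\<bar> + 2 * T)\<^sup>2) = (\<lambda>x. \<bar>x\<bar> ^ 2 + 4 * T * \<bar>x\<bar> ^ 1 + (2 * T)\<^sup>2)"
    by (simp add: power2_eq_square algebra_simps)
  moreover have "integrable std_normal (\<lambda>x. \<bar>x\<bar> ^ 2 + 4 * T * \<bar>x\<bar> ^ 1 + (2 * T)\<^sup>2)"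
    by (intro Bochner_Integration.integrable_add integrable_mult_right integrable_std_normal_abs_power) simp
  ultimately have int2: "integrable std_normal (\<lambda>x. (\<bar>x\<bar> + 2 * T)\<^sup>2)" by simp
  have m1: "(\<integral>\<^sup>+\<omega>. ennreal (h * W \<omega>) \<partial>M) = ennreal (h * m1)"
    unfolding m1_def using W_int[of "\<lambda>x. h * x"] int1 h_pos by simp
  have m2: "(\<integral>\<^sup>+\<omega>. ennreal (h * W \<omega>) * ennreal (h * W \<omega>) \<partial>M) = ennreal (h\<^sup>2 * m2)"
  proof -
    have "(\<integral>\<^sup>+\<omega>. ennreal (h * W \<omega>) * ennreal (h * W \<omega>) \<partial>M) = (\<integral>\<^sup>+\<omega>. ennreal (h\<^sup>2 * (W \<omega>)\<^sup>2) \<partial>M)"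
    proof (rule nn_integral_cong)
      fix \<omega>
      have "0 \<le> h * W \<omega>" using h_pos T by (simp add: W_def)
      then have "ennreal (h * W \<omega>) * ennreal (h * W \<omega>) = ennreal ((h * W \<omega>)\<^sup>2)"
        unfolding power2_eq_square by (simp only: ennreal_mult)
      then show "ennreal (h * W \<omega>) * ennreal (h * W \<omega>) = ennreal (h\<^sup>2 * (W \<omega>)\<^sup>2)"
        by (simp only: power_mult_distrib)
    qed
    then show ?thesis unfolding m2_def using W_int[of "\<lambda>x. h\<^sup>2 * x\<^sup>2"] int2 by simp
  qed
  have below: "emeasure (distr M borel (U (Suc k))) {..<w c} \<le> ennreal (h * w c)" if "k < n" for k c
    using emeasure_height_less[OF that, of "w c"] w0[of c] one_minus_exp_le[of "h * w c"]
    by (simp add: ennreal_leI del: emeasure_distr)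
  \<comment> \<open>\<open>C k\<close> dominates the indicator of a flip in step \<open>k\<close>.\<close>
  define C where "C k \<omega> = (indicator {..<W \<omega>} (U (Suc k) \<omega>) :: ennreal)" for k \<omega>
  have ind: "(\<lambda>p. indicator {..<w (fst p)} (snd p) :: ennreal) \<in> borel_measurable (PiM {..k} (\<lambda>_. borel) \<Otimes>\<^sub>M borel)" for k
  proof -
    have "(\<lambda>p. indicator {..<w (fst p)} (snd p) :: ennreal) = (\<lambda>p. if snd p < w (fst p) then 1 else 0)"
      by (auto simp: indicator_def)
    moreover have "\<dots> \<in> borel_measurable (PiM {..k} (\<lambda>_. borel) \<Otimes>\<^sub>M borel)" by measurable
    ultimately show ?thesis by simp
  qed
  have Cm: "C k \<in> borel_measurable M" if "k < n" for k
  proof -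
    have [measurable]: "U (Suc k) \<in> borel_measurable M" using U_measurable that by simp
    have "C k = (\<lambda>\<omega>. if U (Suc k) \<omega> < W \<omega> then 1 else 0)" by (auto simp: C_def indicator_def)
    moreover have "\<dots> \<in> borel_measurable M" by measurable
    ultimately show ?thesis by simp
  qed
  have C1: "(\<integral>\<^sup>+\<omega>. C k \<omega> \<partial>M) \<le> ennreal (h * m1)" if k: "k < n" for k
    using nn_integral_height_in_le[OF k, of "\<lambda>_. 1" "\<lambda>c. {..<w c}" "\<lambda>c. ennreal (h * w c)"] ind below[OF k]
    unfolding wW C_def m1[symmetric] by simp
  have C2: "(\<integral>\<^sup>+\<omega>. C j \<omega> * C k \<omega> \<partial>M) \<le> ennreal (h\<^sup>2 * m2)" if jk: "j < k" "k < n" for j k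
  proof -
    let ?g = "\<lambda>c. indicator {..<w c} (c (Suc j)) :: ennreal"
    have comp[measurable]: "(\<lambda>c. c (Suc j)) \<in> borel_measurable (PiM {..k} (\<lambda>_. borel))"
      by (rule measurable_component_singleton) (use jk in auto)
    have "?g = (\<lambda>c. if c (Suc j) < w c then 1 else 0)" by (auto simp: indicator_def)
    moreover have "\<dots> \<in> borel_measurable (PiM {..k} (\<lambda>_. borel))" by measurable
    ultimately have gm: "?g \<in> borel_measurable (PiM {..k} (\<lambda>_. borel))" by simp
    have "(\<integral>\<^sup>+\<omega>. C j \<omega> * C k \<omega> \<partial>M) \<le> (\<integral>\<^sup>+\<omega>. C j \<omega> * ennreal (h * W \<omega>) \<partial>M)"
      using nn_integral_height_in_le[OF jk(2) gm, of "\<lambda>c. {..<w c}" "\<lambda>c. ennreal (h * w c)"] ind below[OF jk(2)] jk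
      unfolding wW C_def by (simp add: past_def)
    also have "\<dots> = (\<integral>\<^sup>+\<omega>. ennreal (h * W \<omega>) * C j \<omega> \<partial>M)" by (simp add: mult.commute)
    also have "\<dots> \<le> (\<integral>\<^sup>+\<omega>. ennreal (h * W \<omega>) * ennreal (h * W \<omega>) \<partial>M)"
      using nn_integral_height_in_le[of j "\<lambda>c. ennreal (h * w c)" "\<lambda>c. {..<w c}" "\<lambda>c. ennreal (h * w c)"] ind below jk
      unfolding wW C_def by simp
    finally show ?thesis using m2 by simp
  qed
  have m_nonneg: "0 \<le> m1" "0 \<le> m2"
    unfolding m1_def m2_def using T by (auto intro!: Bochner_Integration.integral_nonneg)
  have CC: "(\<integral>\<^sup>+\<omega>. C j \<omega> * C k \<omega> \<partial>M) \<le> (if j = k then ennreal (h * m1) else 0) + ennreal (h\<^sup>2 * m2)"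
    if jk: "j < n" "k < n" for j k
  proof (cases j k rule: linorder_cases)
    case equal
    have "(\<integral>\<^sup>+\<omega>. C j \<omega> * C k \<omega> \<partial>M) = (\<integral>\<^sup>+\<omega>. C k \<omega> \<partial>M)"
      unfolding equal C_def by (rule nn_integral_cong) (simp add: indicator_def)
    then show ?thesis using C1[OF jk(2)] equal by (simp add: add_increasing2)
  next
    case less
    then show ?thesis using C2[OF less jk(2)] by simp
  next
    case greater
    then show ?thesis using C2[OF greater jk(1)] by (simp add: mult.commute)
  qed
  have "(\<integral>\<^sup>+\<omega>. ennreal ((real (J n \<omega>))\<^sup>2) \<partial>M) \<le> (\<integral>\<^sup>+\<omega>. (\<Sum>j<n. \<Sum>k<n. C j \<omega> * C k \<omega>) \<partial>M)"
  proof (rule nn_integral_mono)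
    fix \<omega>
    let ?c = "\<lambda>i. U i \<omega>"
    have "ennreal (real (J n \<omega>)) = (\<Sum>k<n. ennreal (of_bool (U (Suc k) \<omega> < X k \<omega> + h / 2)))"
      unfolding flips_eq_sum by (subst sum_ennreal) auto
    also have "\<dots> \<le> (\<Sum>k<n. C k \<omega>)"
    proof (rule sum_mono)
      fix k assume "k \<in> {..<n}"
      then have k: "Suc k \<le> n" by simp
      have "real k * h + h \<le> T"
        using mult_right_mono[of "real (Suc k)" "real n" h] k h_pos by (simp add: T_def algebra_simps)
      then have "X k \<omega> + h / 2 \<le> W \<omega>"
        using walk_bound[of h ?c k] h_pos T unfolding W_def by simp
      then show "ennreal (of_bool (U (Suc k) \<omega> < X k \<omega> + h / 2)) \<le> C k \<omega>"
        by (auto simp: C_def indicator_def)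
    qed
    finally have le: "ennreal (real (J n \<omega>)) \<le> (\<Sum>k<n. C k \<omega>)" .
    have "ennreal ((real (J n \<omega>))\<^sup>2) = ennreal (real (J n \<omega>)) * ennreal (real (J n \<omega>))"
      by (simp add: power2_eq_square ennreal_mult)
    also have "\<dots> \<le> (\<Sum>k<n. C k \<omega>) * (\<Sum>k<n. C k \<omega>)" by (intro mult_mono le) auto
    also have "\<dots> = (\<Sum>j<n. \<Sum>k<n. C j \<omega> * C k \<omega>)" by (rule sum_product)
    finally show "ennreal ((real (J n \<omega>))\<^sup>2) \<le> (\<Sum>j<n. \<Sum>k<n. C j \<omega> * C k \<omega>)" .
  qed
  also have "\<dots> = (\<Sum>j<n. \<integral>\<^sup>+\<omega>. (\<Sum>k<n. C j \<omega> * C k \<omega>) \<partial>M)"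
    by (rule nn_integral_sum) (auto intro!: borel_measurable_sum borel_measurable_times_ennreal Cm)
  also have "\<dots> = (\<Sum>j<n. \<Sum>k<n. \<integral>\<^sup>+\<omega>. C j \<omega> * C k \<omega> \<partial>M)"
    by (rule sum.cong[OF refl], rule nn_integral_sum) (auto intro!: borel_measurable_times_ennreal Cm)
  also have "\<dots> \<le> (\<Sum>j<n. \<Sum>k<n. (if j = k then ennreal (h * m1) else 0) + ennreal (h\<^sup>2 * m2))"
    by (intro sum_mono CC) auto
  also have "\<dots> = of_nat n * ennreal (h * m1) + of_nat n * (of_nat n * ennreal (h\<^sup>2 * m2))"
    by (simp add: sum.distrib distrib_left)
  also have "\<dots> = ennreal (real n * (h * m1) + real n * (real n * (h\<^sup>2 * m2)))"
    using m_nonneg h_pos by (simp add: ennreal_of_nat_eq_real_of_nat ennreal_mult[symmetric] ennreal_plus[symmetric] del: ennreal_plus)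
  also have "real n * (h * m1) + real n * (real n * (h\<^sup>2 * m2)) = flips_moment_bound T"
    unfolding flips_moment_bound_def m1_def m2_def T_def by (simp add: power2_eq_square algebra_simps)
  finally show ?thesis by (simp add: T_def)
qed

text \<open>The heights about which the walk and the path may disagree; compare \<open>walk_tracks_path\<close>.\<close>

definition near_miss :: "nat \<Rightarrow> 'w set" where
  "near_miss k = {\<omega> \<in> space M. X k \<omega> + h / 2 - (real (J k \<omega>) + 2) * h \<le> U (Suc k) \<omega>
      \<and> U (Suc k) \<omega> < X k \<omega> + h / 2 + (real (J k \<omega>) + 2) * h}"

lemma near_miss_sets: assumes "k < n" shows "near_miss k \<in> events"
proof -
  have [measurable]: "(\<lambda>\<omega>. X k \<omega>) \<in> borel_measurable M" "U (Suc k) \<in> borel_measurable M"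
    "(\<lambda>\<omega>. J k \<omega>) \<in> measurable M (count_space UNIV)"
    using X_measurable U_measurable J_measurable assms by auto
  show ?thesis unfolding near_miss_def by measurable
qed

text \<open>The strip is determined by the past and an exponential law of rate \<open>h\<close> has density at most \<open>h\<close>,
  so the probability is at most \<open>h\<close> times the expected width. That width is of order \<open>h\<close> because the number of
  flips has bounded mean, which \<open>j \<le> j\<^sup>2\<close> reduces to the second moment.\<close>

lemma prob_near_miss:
  assumes k: "k < n"
  shows "prob (near_miss k) \<le> 2 * h\<^sup>2 * (flips_moment_bound (real n * h) + 2)"
proof -
  let ?B = "flips_moment_bound (real n * h)"
  have B0: "0 \<le> ?B" using flips_moment_bound_nonneg h_pos by simp
  define l where "l c = walk h c k + h / 2 - (real (flips h c k) + 2) * h" for c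
  define r where "r c = walk h c k + h / 2 + (real (flips h c k) + 2) * h" for c
  have [measurable]: "(\<lambda>c. walk h c k) \<in> borel_measurable (PiM {..k} (\<lambda>_. borel))"
    "(\<lambda>c. flips h c k) \<in> measurable (PiM {..k} (\<lambda>_. borel)) (count_space UNIV)"
    by (rule measurable_walk measurable_flips; simp)+
  have [measurable]: "l \<in> borel_measurable (PiM {..k} (\<lambda>_. borel))" "r \<in> borel_measurable (PiM {..k} (\<lambda>_. borel))"
    unfolding l_def r_def by measurable
  have "(\<lambda>p. indicator {l (fst p)..<r (fst p)} (snd p) :: ennreal) = (\<lambda>p. if l (fst p) \<le> snd p \<and> snd p < r (fst p) then 1 else 0)"
    by (auto simp: indicator_def)
  moreover have "\<dots> \<in> borel_measurable (PiM {..k} (\<lambda>_. borel) \<Otimes>\<^sub>M borel)" by measurable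
  ultimately have m: "(\<lambda>p. indicator {l (fst p)..<r (fst p)} (snd p) :: ennreal)
      \<in> borel_measurable (PiM {..k} (\<lambda>_. borel) \<Otimes>\<^sub>M borel)" by simp
  have width: "r c - l c = 2 * (real (flips h c k) + 2) * h" "l c \<le> r c" for c
    using h_pos by (auto simp: l_def r_def)
  have eq: "near_miss k = {\<omega> \<in> space M. U (Suc k) \<omega> \<in> {l (past k \<omega>)..<r (past k \<omega>)}}"
    unfolding near_miss_def l_def r_def by (auto simp: walk_past flips_past)
  have "emeasure M (near_miss k) = (\<integral>\<^sup>+\<omega>. 1 * indicator {l (past k \<omega>)..<r (past k \<omega>)} (U (Suc k) \<omega>) \<partial>M)"
    using near_miss_sets[OF k] unfolding eq
    by (subst nn_integral_indicator[symmetric]) (auto intro!: nn_integral_cong simp: indicator_def simp del: nn_integral_indicator)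
  also have "\<dots> \<le> (\<integral>\<^sup>+\<omega>. 1 * ennreal (h * (r (past k \<omega>) - l (past k \<omega>))) \<partial>M)"
    by (rule nn_integral_height_in_le[OF k _ m]) (use emeasure_height_strip[OF k width(2)] in auto)
  also have "\<dots> \<le> (\<integral>\<^sup>+\<omega>. ennreal (2 * h\<^sup>2) * ennreal ((real (J n \<omega>))\<^sup>2) + ennreal (4 * h\<^sup>2) \<partial>M)"
  proof (rule nn_integral_mono)
    fix \<omega>
    have "J k \<omega> \<le> J n \<omega>" by (rule flips_mono) (use k in simp)
    also have "\<dots> \<le> (J n \<omega>)\<^sup>2" by (simp add: power2_eq_square)
    finally have "real (J k \<omega>) \<le> (real (J n \<omega>))\<^sup>2" by (simp only: of_nat_power[symmetric] of_nat_le_iff)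
    then have "2 * h\<^sup>2 * real (J k \<omega>) \<le> 2 * h\<^sup>2 * (real (J n \<omega>))\<^sup>2" by (rule mult_left_mono) simp
    then have "h * (r (past k \<omega>) - l (past k \<omega>)) \<le> 2 * h\<^sup>2 * (real (J n \<omega>))\<^sup>2 + 4 * h\<^sup>2"
      unfolding width by (simp add: flips_past power2_eq_square algebra_simps)
    then show "1 * ennreal (h * (r (past k \<omega>) - l (past k \<omega>))) \<le> ennreal (2 * h\<^sup>2) * ennreal ((real (J n \<omega>))\<^sup>2) + ennreal (4 * h\<^sup>2)"
      by (simp add: ennreal_mult[symmetric] ennreal_plus[symmetric] ennreal_leI del: ennreal_plus)
  qed
  also have "\<dots> = ennreal (2 * h\<^sup>2) * (\<integral>\<^sup>+\<omega>. ennreal ((real (J n \<omega>))\<^sup>2) \<partial>M) + ennreal (4 * h\<^sup>2)"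
  proof -
    have "(\<lambda>\<omega>. ennreal ((real (J n \<omega>))\<^sup>2)) \<in> borel_measurable M"
      using measurable_compose[OF J_measurable[OF order_refl], of "\<lambda>j. ennreal ((real j)\<^sup>2)" borel] by simp
    then show ?thesis by (simp add: nn_integral_add nn_integral_cmult emeasure_space_1)
  qed
  also have "\<dots> \<le> ennreal (2 * h\<^sup>2) * ennreal ?B + ennreal (4 * h\<^sup>2)"
    using nn_integral_J_square k by (intro add_mono mult_left_mono) auto
  also have "\<dots> = ennreal (2 * h\<^sup>2 * (?B + 2))"
    using B0 by (simp add: ennreal_mult[symmetric] ennreal_plus[symmetric] algebra_simps del: ennreal_plus)
  finally show ?thesis using B0 by (simp add: emeasure_eq_measure)
qed

end

section \<open>Lowest points of the Poisson noise\<close>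

text \<open>The value \<open>0\<close> for a strip without points is arbitrary; Poisson noise almost surely has points above
  every cell.\<close>

definition lowest_point :: "(real \<times> real) measure \<Rightarrow> real \<Rightarrow> real \<Rightarrow> real" where
  "lowest_point m a b = (if emeasure m ({a<..b} \<times> {0..}) = 0 then 0
    else Inf {c. 0 \<le> c \<and> emeasure m ({a<..b} \<times> {0..<c}) \<noteq> 0})"

lemma rect_in_quadrant:
  "I \<in> sets borel \<Longrightarrow> J \<in> sets borel \<Longrightarrow> I \<subseteq> {0..} \<Longrightarrow> J \<subseteq> {0..} \<Longrightarrow> I \<times> J \<in> sets quadrant"
  by (auto simp: sets_restrict_space_iff borel_closed closed_Times intro: borel_Times)

lemma emeasure_quadrant_rect:
  assumes "I \<in> sets borel" "J \<in> sets borel" "I \<subseteq> {0..}" "J \<subseteq> {0..}"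
  shows "emeasure quadrant (I \<times> J) = emeasure lborel I * emeasure lborel J"
proof -
  have "emeasure quadrant (I \<times> J) = emeasure lborel (I \<times> J)"
    by (rule emeasure_restrict_space) (use assms in \<open>auto simp: borel_closed closed_Times\<close>)
  also have "\<dots> = emeasure (lborel \<Otimes>\<^sub>M lborel) (I \<times> J)" by (simp only: lborel_prod)
  also have "\<dots> = emeasure lborel I * emeasure lborel J"
    by (rule lborel.emeasure_pair_measure_Times) (use assms in auto)
  finally show ?thesis .
qed

lemma emeasure_lborel_Ici: "emeasure lborel {a::real..} = \<infinity>"
proof (rule ccontr)
  assume "emeasure lborel {a..} \<noteq> \<infinity>"
  then obtain r where r: "0 \<le> r" "emeasure lborel {a..} = ennreal r"
    by (cases "emeasure lborel {a..}") auto
  have "emeasure lborel {a..a + (r + 1)} \<le> emeasure lborel {a..}" by (rule emeasure_mono) auto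
  then show False using r by simp
qed

text \<open>The half-open strip \<open>[0, c)\<close> makes this exact: it is the increasing union of strips below smaller heights, so
  it charges mass only if one of these does.\<close>

lemma le_lowest_point_iff:
  assumes m: "sets m = sets quadrant" and a: "0 \<le> a" and pts: "emeasure m ({a<..b} \<times> {0..}) \<noteq> 0"
  shows "c \<le> lowest_point m a b \<longleftrightarrow> emeasure m ({a<..b} \<times> {0..<c}) = 0"
proof -
  define S where "S = {c. 0 \<le> c \<and> emeasure m ({a<..b} \<times> {0..<c}) \<noteq> 0}"
  have R: "{a<..b} \<times> J \<in> sets m" if "J \<in> sets borel" "J \<subseteq> {0..}" for J
    unfolding m by (rule rect_in_quadrant) (use a that in auto)
  have lp: "lowest_point m a b = Inf S" using pts by (simp add: lowest_point_def S_def)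
  have bdd: "bdd_below S" by (auto simp: S_def intro: bdd_belowI[of _ 0])
  have ne: "S \<noteq> {}"
  proof
    assume "S = {}"
    then have "emeasure m ({a<..b} \<times> {0..<real k}) = 0" for k by (auto simp: S_def)
    then have "{a<..b} \<times> {0..<real k} \<in> null_sets m" for k by (intro null_setsI R) auto
    then have "(\<Union>k. {a<..b} \<times> {0..<real k}) \<in> null_sets m" by (rule null_sets_UN)
    moreover have "(\<Union>k. {a<..b} \<times> {0..<real k}) = {a<..b} \<times> {0..}"
      using reals_Archimedean2 by (auto; blast)
    ultimately show False using pts by (auto simp: null_sets_def)
  qed
  show ?thesis
  proof
    assume le: "c \<le> lowest_point m a b"
    have "emeasure m ({a<..b} \<times> {0..<c - inverse (real (Suc k))}) = 0" for k
    proof (rule ccontr)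
      let ?e = "c - inverse (real (Suc k))"
      assume *: "\<not> ?thesis"
      have "0 < ?e"
      proof (rule ccontr)
        assume "\<not> 0 < ?e"
        then have "{0..<?e} = {}" by auto
        then show False using * by simp
      qed
      then have "?e \<in> S" using * by (auto simp: S_def)
      then have "Inf S \<le> ?e" using bdd by (rule cInf_lower)
      moreover have "0 < inverse (real (Suc k))" by simp
      ultimately show False using le lp by linarith
    qed
    then have "(\<Union>k. {a<..b} \<times> {0..<c - inverse (real (Suc k))}) \<in> null_sets m"
      by (intro null_sets_UN null_setsI R) auto
    moreover have "(\<Union>k. {a<..b} \<times> {0..<c - inverse (real (Suc k))}) = {a<..b} \<times> {0..<c}"
    proof (intro set_eqI iffI)
      fix p assume "p \<in> {a<..b} \<times> {0..<c}"
      moreover obtain k where "inverse (real (Suc k)) < c - snd p"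
        using reals_Archimedean[of "c - snd p"] calculation by auto
      ultimately show "p \<in> (\<Union>k. {a<..b} \<times> {0..<c - inverse (real (Suc k))})"
        by (auto simp: algebra_simps)
    next
      fix p assume "p \<in> (\<Union>k. {a<..b} \<times> {0..<c - inverse (real (Suc k))})"
      then obtain k where p: "p \<in> {a<..b} \<times> {0..<c - inverse (real (Suc k))}" by blast
      then have "snd p < c - inverse (real (Suc k))" by auto
      moreover have "0 < inverse (real (Suc k))" by simp
      ultimately have "snd p < c" by linarith
      then show "p \<in> {a<..b} \<times> {0..<c}" using p by auto
    qed
    ultimately show "emeasure m ({a<..b} \<times> {0..<c}) = 0" by (auto simp: null_sets_def)
  next
    assume z: "emeasure m ({a<..b} \<times> {0..<c}) = 0"
    show "c \<le> lowest_point m a b" unfolding lp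
    proof (rule cInf_greatest[OF ne])
      fix e assume e: "e \<in> S"
      show "c \<le> e"
      proof (rule ccontr)
        assume "\<not> c \<le> e"
        then have "emeasure m ({a<..b} \<times> {0..<e}) \<le> emeasure m ({a<..b} \<times> {0..<c})"
          by (intro emeasure_mono R) auto
        then show False using z e by (simp add: S_def)
      qed
    qed
  qed
qed

lemma lowest_point_nonneg:
  assumes "sets m = sets quadrant" "0 \<le> a" shows "0 \<le> lowest_point m a b"
  using le_lowest_point_iff[OF assms, of b 0] by (cases "emeasure m ({a<..b} \<times> {0..}) = 0") (auto simp: lowest_point_def)

text \<open>Passes from the family of all driving variables, indexed by pairs, to those of one coordinate.\<close>

lemma (in prob_space) indep_vars_reindex:
  assumes inj: "inj_on f I" and ind: "indep_vars M' X (f ` I)"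
  shows "indep_vars (\<lambda>i. M' (f i)) (\<lambda>i. X (f i)) I"
proof -
  have "indep_sets (\<lambda>i. {X (f i) -` A \<inter> space M |A. A \<in> sets (M' (f i))}) I"
  proof (rule indep_setsI)
    fix A J assume J: "J \<noteq> {}" "J \<subseteq> I" "finite J"
      and A: "\<forall>j\<in>J. A j \<in> {X (f j) -` A \<inter> space M |A. A \<in> sets (M' (f j))}"
    have injJ: "inj_on f J" using inj J(2) by (rule inj_on_subset)
    define A' where "A' = A \<circ> the_inv_into J f"
    have A': "A' (f j) = A j" if "j \<in> J" for j using the_inv_into_f_f[OF injJ that] by (simp add: A'_def)
    have "prob (\<Inter>i\<in>f ` J. A' i) = (\<Prod>i\<in>f ` J. prob (A' i))"
      using ind J A A' unfolding indep_vars_def2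
      by (intro indep_setsD[where F="\<lambda>i. {X i -` A \<inter> space M |A. A \<in> sets (M' i)}" and I="f ` I"]) auto
    then show "prob (\<Inter>j\<in>J. A j) = (\<Prod>j\<in>J. prob (A j))"
      using A' injJ by (simp add: prod.reindex)
  qed (use ind in \<open>auto simp: indep_vars_def2\<close>)
  then show ?thesis using ind by (auto simp: indep_vars_def2)
qed

text \<open>The process together with a grid of mesh \<open>h\<close> on \<open>(0, n h]\<close>.\<close>

locale driven_zigzag = stationary_zigzag M d N \<xi> v
  for M :: "'w measure" and d N and \<xi> v :: "nat \<Rightarrow> real \<Rightarrow> 'w \<Rightarrow> real" +
  fixes h :: real and n :: nat
  assumes h_pos: "0 < h" and n_pos: "1 \<le> n" and d_pos: "1 \<le> d"
begin

lemma index_nonempty: "{..<n} \<noteq> {}" "{..<d} \<noteq> {}"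
  using n_pos d_pos by (auto simp: lessThan_empty_iff)

definition cell :: "nat \<Rightarrow> real set" where
  "cell k = {real k * h<..real (Suc k) * h}"

text \<open>The input of the guided walk of coordinate \<open>i\<close>, in the layout that \<open>walk\<close> expects.\<close>

fun drive :: "nat \<times> nat \<Rightarrow> 'w \<Rightarrow> real" where
  "drive (i, 0) \<omega> = \<xi> i 0 \<omega> * v i 0 \<omega>"
| "drive (i, Suc k) \<omega> = lowest_point (N i \<omega>) (real k * h) (real (Suc k) * h)"

lemma cell_sets[measurable]: "cell k \<in> sets borel" by (simp add: cell_def)

lemma cell_nonneg: "cell k \<subseteq> {0..}"
proof
  fix t assume "t \<in> cell k"
  then have "real k * h < t" by (simp add: cell_def)
  moreover have "0 \<le> real k * h" using h_pos by simp
  ultimately show "t \<in> {0..}" by simp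
qed

lemma disjoint_cells: "disjoint_family cell"
proof -
  have "cell j \<inter> cell k = {}" if "j < k" for j k
  proof -
    have "real (Suc j) * h \<le> real k * h" by (rule mult_right_mono) (use that h_pos in auto)
    then show ?thesis by (auto simp: cell_def)
  qed
  then show ?thesis unfolding disjoint_family_on_def by (metis Int_commute linorder_neqE_nat)
qed

lemma emeasure_lborel_cell: "emeasure lborel (cell k) = ennreal h"
proof -
  have "real (Suc k) * h - real k * h = h" by (simp add: algebra_simps)
  moreover have "real k * h \<le> real (Suc k) * h" using h_pos by (simp add: algebra_simps)
  ultimately show ?thesis unfolding cell_def by simp
qed

lemma poisson_noise:
  assumes "i < d"
  shows sets_noise: "\<omega> \<in> space M \<Longrightarrow> sets (N i \<omega>) = sets quadrant"
    and noise_measurable: "A \<in> sets quadrant \<Longrightarrow> (\<lambda>\<omega>. emeasure (N i \<omega>) A) \<in> borel_measurable M"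
    and noise_prob: "A \<in> sets quadrant \<Longrightarrow> emeasure quadrant A < \<infinity> \<Longrightarrow>
      prob {\<omega>\<in>space M. emeasure (N i \<omega>) A = of_nat k}
        = exp (- measure quadrant A) * measure quadrant A ^ k / fact k"
    and noise_infinite: "A \<in> sets quadrant \<Longrightarrow> emeasure quadrant A = \<infinity> \<Longrightarrow> AE \<omega> in M. emeasure (N i \<omega>) A = \<infinity>"
    and noise_indep: "(\<And>k. k < (l::nat) \<Longrightarrow> F k \<in> sets quadrant) \<Longrightarrow> disjoint_family_on F {..<l} \<Longrightarrow>
      indep_vars (\<lambda>_. borel) (\<lambda>k \<omega>. emeasure (N i \<omega>) (F k)) {..<l}"
  using noise[OF assms] unfolding poisson_random_measure_def by blast+

lemma cell_rect: "J \<in> sets borel \<Longrightarrow> J \<subseteq> {0..} \<Longrightarrow> cell k \<times> J \<in> sets quadrant"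
  by (rule rect_in_quadrant) (use cell_nonneg in auto)

lemma emeasure_cell_rect: "J \<in> sets borel \<Longrightarrow> J \<subseteq> {0..} \<Longrightarrow>
    emeasure quadrant (cell k \<times> J) = ennreal h * emeasure lborel J"
  by (subst emeasure_quadrant_rect) (use cell_nonneg in \<open>auto simp: emeasure_lborel_cell\<close>)

lemma measure_cell_Ico: "measure quadrant (cell k \<times> {0..<c}) = h * max c 0"
  and emeasure_cell_Ico: "emeasure quadrant (cell k \<times> {0..<c}) < \<infinity>"
proof -
  have "emeasure quadrant (cell k \<times> {0..<c}) = ennreal (h * max c 0)"
    using h_pos by (subst emeasure_cell_rect) (auto simp: ennreal_mult[symmetric] max_def)
  then show "measure quadrant (cell k \<times> {0..<c}) = h * max c 0" "emeasure quadrant (cell k \<times> {0..<c}) < \<infinity>"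
    using h_pos by (auto simp: measure_def)
qed

lemma prob_no_point:
  assumes "i < d"
  shows "prob {\<omega>\<in>space M. emeasure (N i \<omega>) (cell k \<times> {0..<c}) = 0} = exp (- (h * max c 0))"
proof -
  have "cell k \<times> {0..<c} \<in> sets quadrant" by (rule cell_rect) auto
  from noise_prob[OF assms this emeasure_cell_Ico, of 0] show ?thesis
    by (simp add: measure_cell_Ico)
qed

lemma AE_cells_inhabited: "AE \<omega> in M. \<forall>i<d. \<forall>k. emeasure (N i \<omega>) (cell k \<times> {0..}) \<noteq> 0"
proof -
  have "AE \<omega> in M. i < d \<longrightarrow> emeasure (N i \<omega>) (cell k \<times> {0..}) \<noteq> 0" for i k
  proof (cases "i < d")
    case True
    have "emeasure quadrant (cell k \<times> {0..}) = \<infinity>"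
      using h_pos by (subst emeasure_cell_rect) (auto simp: emeasure_lborel_Ici ennreal_mult_top)
    then have "AE \<omega> in M. emeasure (N i \<omega>) (cell k \<times> {0..}) = \<infinity>"
      by (intro noise_infinite[OF True] cell_rect) auto
    then show ?thesis by eventually_elim simp
  qed simp
  then have "AE \<omega> in M. \<forall>i k. i < d \<longrightarrow> emeasure (N i \<omega>) (cell k \<times> {0..}) \<noteq> 0"
    by (simp add: AE_all_countable)
  then show ?thesis by eventually_elim blast
qed

text \<open>Heights are thereby expressed through void events, whose probabilities and independence are part of the
  definition of a Poisson random measure.\<close>

lemma le_drive_iff:
  assumes "i < d" "\<omega> \<in> space M" "emeasure (N i \<omega>) (cell k \<times> {0..}) \<noteq> 0"
  shows "c \<le> drive (i, Suc k) \<omega> \<longleftrightarrow> emeasure (N i \<omega>) (cell k \<times> {0..<c}) = 0"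
  using le_lowest_point_iff[OF sets_noise[OF assms(1,2)], of "real k * h" "real (Suc k) * h" c] assms(3) h_pos
  unfolding drive.simps cell_def by simp

lemma drive_Suc_nonneg: "i < d \<Longrightarrow> \<omega> \<in> space M \<Longrightarrow> 0 \<le> drive (i, Suc k) \<omega>"
  using h_pos unfolding drive.simps by (intro lowest_point_nonneg sets_noise) auto

lemma velocity_sign: "i < d \<Longrightarrow> \<omega> \<in> space M \<Longrightarrow> 0 \<le> t \<Longrightarrow> v i t \<omega> \<in> {-1, 1}"
  using measurable_space[OF velocity_measurable] by simp

lemma velocity_borel: assumes "i < d" "0 \<le> t" shows "v i t \<in> borel_measurable M"
  using measurable_compose[OF velocity_measurable[OF assms], of "\<lambda>x. x" borel] by simp

lemma drive_measurable:
  assumes i: "i < d" shows "drive (i, k) \<in> borel_measurable M"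
proof (cases k)
  case 0
  have [measurable]: "\<xi> i 0 \<in> borel_measurable M" "v i 0 \<in> borel_measurable M"
    using position_measurable velocity_borel i by auto
  show ?thesis unfolding 0 drive.simps[abs_def] by measurable
next
  case (Suc j)
  have "{\<omega> \<in> space M. c \<le> drive (i, Suc j) \<omega>} \<in> events" for c
  proof -
    have [measurable]: "(\<lambda>\<omega>. emeasure (N i \<omega>) (cell j \<times> {0..})) \<in> borel_measurable M"
      "(\<lambda>\<omega>. emeasure (N i \<omega>) (cell j \<times> {0..<c})) \<in> borel_measurable M"
      by (auto intro!: noise_measurable[OF i] cell_rect)
    have "{\<omega> \<in> space M. c \<le> drive (i, Suc j) \<omega>} = {\<omega> \<in> space M.
        if emeasure (N i \<omega>) (cell j \<times> {0..}) = 0 then c \<le> 0 else emeasure (N i \<omega>) (cell j \<times> {0..<c}) = 0}"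
      using le_drive_iff[OF i, of _ j c] by (auto simp: lowest_point_def cell_def simp del: of_nat_Suc split: if_splits)
    also have "\<dots> \<in> events" by measurable
    finally show ?thesis .
  qed
  then show ?thesis unfolding Suc by (subst borel_measurable_iff_ge) blast
qed

lemma std_normal_symmetric:
  assumes [measurable]: "B \<in> sets borel" and s: "s \<in> {-1, 1::real}"
  shows "{x. x * s \<in> B} \<in> sets borel" "measure std_normal {x. x * s \<in> B} = measure std_normal B"
proof -
  show m[measurable]: "{x. x * s \<in> B} \<in> sets borel" by measurable
  show "measure std_normal {x. x * s \<in> B} = measure std_normal B"
  proof (cases "s = 1")
    case False
    then have s: "s = -1" using s by simp
    have "emeasure std_normal {x. x * s \<in> B} = (\<integral>\<^sup>+x. ennreal (std_normal_density x) * indicator {x. x * s \<in> B} x \<partial>lborel)"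
      by (rule emeasure_density) (use m in auto)
    also have "\<dots> = (\<integral>\<^sup>+x. ennreal (std_normal_density (- x)) * indicator {x. x * s \<in> B} (- x) \<partial>lborel)"
      by (subst nn_integral_real_affine[where c="-1" and t=0]) auto
    also have "\<dots> = (\<integral>\<^sup>+x. ennreal (std_normal_density x) * indicator B x \<partial>lborel)"
      by (rule nn_integral_cong) (simp add: s std_normal_density_def indicator_def)
    also have "\<dots> = emeasure std_normal B" by (rule emeasure_density[symmetric]) auto
    finally show ?thesis by (simp add: measure_def)
  qed simp
qed

end

section \<open>Joint law of the driving variables\<close>

lemma measure_std_normal_UNIV: "measure std_normal UNIV = 1"
  using prob_space.prob_space[OF prob_space_std_normal] by simp

context driven_zigzag begin

definition no_point :: "(nat \<Rightarrow> nat \<Rightarrow> real) \<Rightarrow> nat \<Rightarrow> 'w set" where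
  "no_point c i = {\<omega>\<in>space M. \<forall>k<n. emeasure (N i \<omega>) (cell k \<times> {0..<c i k}) = 0}"

lemma no_point_eq: "no_point c i = (\<Inter>k\<in>{..<n}. (\<lambda>\<omega>. emeasure (N i \<omega>) (cell k \<times> {0..<c i k})) -` {0} \<inter> space M)"
  using index_nonempty by (auto simp: no_point_def)

text \<open>Membership in the generated \<open>\<sigma>\<close>-algebra is what gives access to the independence of the sources.\<close>

lemma no_point_noise_sets: "no_point c i \<in> random_measure_sets (space M) quadrant (N i)"
proof -
  let ?G = "{(\<lambda>\<omega>. emeasure (N i \<omega>) A) -` B \<inter> space M | A B. A \<in> sets quadrant \<and> B \<in> sets borel}"
  interpret sigma_algebra "space M" "sigma_sets (space M) ?G"
    by (rule sigma_algebra_sigma_sets) auto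
  have "(\<lambda>\<omega>. emeasure (N i \<omega>) (cell k \<times> {0..<c i k})) -` {0} \<inter> space M \<in> sigma_sets (space M) ?G" for k
  proof (rule sigma_sets.Basic)
    have "cell k \<times> {0..<c i k} \<in> sets quadrant" by (rule cell_rect) auto
    moreover have "{0::ennreal} \<in> sets borel" by simp
    ultimately show "(\<lambda>\<omega>. emeasure (N i \<omega>) (cell k \<times> {0..<c i k})) -` {0} \<inter> space M \<in> ?G" by blast
  qed
  then show ?thesis unfolding no_point_eq random_measure_sets_def
    by (intro finite_INT finite_lessThan index_nonempty)
qed

lemma prob_no_points:
  assumes i: "i < d"
  shows "prob (no_point c i) = (\<Prod>k<n. exp (- (h * max (c i k) 0)))"
proof -
  have "indep_vars (\<lambda>_. borel) (\<lambda>k \<omega>. emeasure (N i \<omega>) (cell k \<times> {0..<c i k})) {..<n}"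
    using disjoint_cells by (intro noise_indep[OF i] cell_rect) (auto simp: disjoint_family_on_def)
  then have "prob (\<Inter>k\<in>{..<n}. (\<lambda>\<omega>. emeasure (N i \<omega>) (cell k \<times> {0..<c i k})) -` {0} \<inter> space M)
      = (\<Prod>k<n. prob ((\<lambda>\<omega>. emeasure (N i \<omega>) (cell k \<times> {0..<c i k})) -` {0} \<inter> space M))"
    by (rule indep_varsD) (use index_nonempty in auto)
  also have "\<dots> = (\<Prod>k<n. exp (- (h * max (c i k) 0)))"
  proof (rule prod.cong[OF refl])
    fix k
    have "(\<lambda>\<omega>. emeasure (N i \<omega>) (cell k \<times> {0..<c i k})) -` {0} \<inter> space M
        = {\<omega>\<in>space M. emeasure (N i \<omega>) (cell k \<times> {0..<c i k}) = 0}" by auto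
    then show "prob ((\<lambda>\<omega>. emeasure (N i \<omega>) (cell k \<times> {0..<c i k})) -` {0} \<inter> space M) = exp (- (h * max (c i k) 0))"
      using prob_no_point[OF i] by simp
  qed
  finally show ?thesis by (simp add: no_point_eq)
qed

lemma no_point_events: "i < d \<Longrightarrow> no_point c i \<in> events"
proof -
  assume i: "i < d"
  have "(\<lambda>\<omega>. emeasure (N i \<omega>) (cell k \<times> {0..<c i k})) \<in> borel_measurable M" for k
    by (intro noise_measurable[OF i] cell_rect) auto
  then show ?thesis unfolding no_point_eq
    by (intro sets.finite_INT measurable_sets) (use index_nonempty in auto)
qed

text \<open>On \<open>velocity_is s\<close> the event that all \<open>\<xi>\<^sub>i v\<^sub>i\<close> lie in \<open>B i\<close> becomes \<open>init_in B s\<close>, which concerns the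
  positions alone.\<close>

definition init_in :: "(nat \<Rightarrow> real set) \<Rightarrow> (nat \<Rightarrow> real) \<Rightarrow> 'w set" where
  "init_in B s = {\<omega> \<in> space M. \<forall>i<d. \<xi> i 0 \<omega> * s i \<in> B i}"

definition velocity_is :: "(nat \<Rightarrow> real) \<Rightarrow> 'w set" where
  "velocity_is s = {\<omega> \<in> space M. \<forall>i<d. v i 0 \<omega> = s i}"

lemma init_in_vimage:
  "init_in B s = (\<lambda>\<omega>. \<lambda>i\<in>{..<d}. \<xi> i 0 \<omega>) -` (\<Pi>\<^sub>E i\<in>{..<d}. {x. x * s i \<in> B i}) \<inter> space M"
  unfolding init_in_def by (simp add: vimage_def restrict_PiE_iff Int_def conj_commute Ball_def Pi_def)

lemma velocity_is_vimage:
  assumes "s \<in> {..<d} \<rightarrow>\<^sub>E {-1, 1}"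
  shows "velocity_is s = (\<lambda>\<omega>. \<lambda>i\<in>{..<d}. v i 0 \<omega>) -` {s} \<inter> space M"
proof -
  have "s i = undefined" if "\<not> i < d" for i using PiE_arb[OF assms] that by simp
  then have "(\<lambda>i\<in>{..<d}. v i 0 \<omega>) = s \<longleftrightarrow> (\<forall>i<d. v i 0 \<omega> = s i)" for \<omega>
    unfolding fun_eq_iff by (metis lessThan_iff restrict_apply)
  then show ?thesis unfolding velocity_is_def by (simp add: vimage_def Int_def conj_commute)
qed

lemma finite_signs: "finite ({..<d} \<rightarrow>\<^sub>E {-1, 1::real})" "{..<d} \<rightarrow>\<^sub>E {-1, 1::real} \<noteq> {}"
  by (auto intro!: finite_PiE simp: PiE_eq_empty_iff)

lemma initial_velocity_sign:
  "\<omega> \<in> space M \<Longrightarrow> (\<lambda>i\<in>{..<d}. v i 0 \<omega>) \<in> {..<d} \<rightarrow>\<^sub>E {-1, 1}"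
  unfolding restrict_PiE_iff using velocity_sign[OF _ _ order_refl] by simp

lemma velocity_vector_measurable:
  "(\<lambda>\<omega>. \<lambda>i\<in>{..<d}. v i 0 \<omega>) \<in> measurable M (count_space ({..<d} \<rightarrow>\<^sub>E {-1, 1}))"
proof (subst measurable_count_space_eq2[OF finite_signs(1)], intro conjI ballI)
  show "(\<lambda>\<omega>. \<lambda>i\<in>{..<d}. v i 0 \<omega>) \<in> space M \<rightarrow> ({..<d} \<rightarrow>\<^sub>E {-1, 1})"
  proof
    fix \<omega> assume "\<omega> \<in> space M"
    then show "(\<lambda>i\<in>{..<d}. v i 0 \<omega>) \<in> {..<d} \<rightarrow>\<^sub>E {-1, 1}" by (rule initial_velocity_sign)
  qed
  fix s :: "nat \<Rightarrow> real" assume s: "s \<in> {..<d} \<rightarrow>\<^sub>E {-1, 1}"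
  have [measurable]: "v i 0 \<in> borel_measurable M" if "i \<in> {..<d}" for i
    using velocity_borel that by auto
  have "{\<omega> \<in> space M. \<forall>i\<in>{..<d}. v i 0 \<omega> = s i} \<in> events"
    by measurable
  then show "(\<lambda>\<omega>. \<lambda>i\<in>{..<d}. v i 0 \<omega>) -` {s} \<inter> space M \<in> events"
    unfolding velocity_is_vimage[OF s, symmetric] velocity_is_def by simp
qed

lemma prob_velocity_is:
  assumes s: "s \<in> {..<d} \<rightarrow>\<^sub>E {-1, 1}"
  shows "prob (velocity_is s) = 1 / card ({..<d} \<rightarrow>\<^sub>E {-1, 1::real})"
proof -
  have "prob (velocity_is s) = measure (distr M (count_space ({..<d} \<rightarrow>\<^sub>E {-1, 1})) (\<lambda>\<omega>. \<lambda>i\<in>{..<d}. v i 0 \<omega>)) {s}"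
    unfolding velocity_is_vimage[OF s]
    by (rule measure_distr[symmetric, OF velocity_vector_measurable]) (use s in auto)
  also have "\<dots> = 1 / card ({..<d} \<rightarrow>\<^sub>E {-1, 1::real})"
    unfolding velocity_init using s by (subst measure_uniform_count_measure[OF finite_signs(1)]) auto
  finally show ?thesis .
qed

lemma prob_init_in:
  assumes B: "\<And>i. i < d \<Longrightarrow> B i \<in> sets borel" and s: "s \<in> {..<d} \<rightarrow>\<^sub>E {-1, 1}"
  shows "prob (init_in B s) = (\<Prod>i<d. measure std_normal (B i))"
    and "(\<Pi>\<^sub>E i\<in>{..<d}. {x. x * s i \<in> B i}) \<in> sets (PiM {..<d} (\<lambda>_. borel))"
proof -
  interpret SN: prob_space std_normal by (rule prob_space_std_normal)
  interpret SP: finite_product_prob_space "\<lambda>_. std_normal" "{..<d}"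
    by unfold_locales auto
  have si: "s i \<in> {-1, 1}" if "i < d" for i using s that by auto
  show m: "(\<Pi>\<^sub>E i\<in>{..<d}. {x. x * s i \<in> B i}) \<in> sets (PiM {..<d} (\<lambda>_. borel))"
    by (rule sets_PiM_I_finite) (use std_normal_symmetric(1)[OF B si] in auto)
  have "(\<lambda>\<omega>. \<lambda>i\<in>{..<d}. \<xi> i 0 \<omega>) \<in> measurable M (PiM {..<d} (\<lambda>_. borel))"
    by (rule measurable_restrict) (use position_measurable in auto)
  then have "prob (init_in B s) = measure (distr M (PiM {..<d} (\<lambda>_. borel)) (\<lambda>\<omega>. \<lambda>i\<in>{..<d}. \<xi> i 0 \<omega>))
      (\<Pi>\<^sub>E i\<in>{..<d}. {x. x * s i \<in> B i})"
    unfolding init_in_vimage by (rule measure_distr[symmetric]) (rule m)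
  also have "\<dots> = (\<Prod>i<d. measure std_normal {x. x * s i \<in> B i})"
    unfolding position_init
    by (rule SP.prob_times) (use std_normal_symmetric(1)[OF B si] in auto)
  also have "\<dots> = (\<Prod>i<d. measure std_normal (B i))"
    by (rule prod.cong) (use std_normal_symmetric(2)[OF B si] in auto)
  finally show "prob (init_in B s) = (\<Prod>i<d. measure std_normal (B i))" .
qed

lemma prob_init_velocity_noise:
  assumes B: "\<And>i. i < d \<Longrightarrow> B i \<in> sets borel" and s: "s \<in> {..<d} \<rightarrow>\<^sub>E {-1, 1}"
  shows "prob (init_in B s \<inter> velocity_is s \<inter> (\<Inter>i\<in>{..<d}. no_point c i))
    = prob (init_in B s) * prob (velocity_is s) * (\<Prod>i<d. prob (no_point c i))"
    and "init_in B s \<inter> velocity_is s \<inter> (\<Inter>i\<in>{..<d}. no_point c i) \<in> events"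
proof -
  let ?I = "{Position, Velocity} \<union> Noise ` {..<d}"
  let ?A = "\<lambda>j. case j of Position \<Rightarrow> init_in B s | Velocity \<Rightarrow> velocity_is s | Noise i \<Rightarrow> no_point c i"
  have "prob (\<Inter>j\<in>?I. ?A j) = (\<Prod>j\<in>?I. prob (?A j))"
  proof (rule indep_setsD[OF independent])
    show "\<forall>j\<in>?I. ?A j \<in> (case j of
            Position \<Rightarrow> sets (vimage_algebra (space M) (\<lambda>\<omega>. \<lambda>i\<in>{..<d}. \<xi> i 0 \<omega>) (PiM {..<d} (\<lambda>_. borel)))
          | Velocity \<Rightarrow> sets (vimage_algebra (space M) (\<lambda>\<omega>. \<lambda>i\<in>{..<d}. v i 0 \<omega>) (count_space ({..<d} \<rightarrow>\<^sub>E {-1, 1})))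
          | Noise i \<Rightarrow> random_measure_sets (space M) quadrant (N i))"
    proof
      fix j assume "j \<in> ?I"
      have "init_in B s \<in> sets (vimage_algebra (space M) (\<lambda>\<omega>. \<lambda>i\<in>{..<d}. \<xi> i 0 \<omega>) (PiM {..<d} (\<lambda>_. borel)))"
        unfolding init_in_vimage by (rule in_vimage_algebra[OF prob_init_in(2)[OF B s]])
      moreover have "velocity_is s \<in> sets (vimage_algebra (space M) (\<lambda>\<omega>. \<lambda>i\<in>{..<d}. v i 0 \<omega>) (count_space ({..<d} \<rightarrow>\<^sub>E {-1, 1})))"
        unfolding velocity_is_vimage[OF s] by (rule in_vimage_algebra) (use s in auto)
      ultimately show "?A j \<in> (case j of
            Position \<Rightarrow> sets (vimage_algebra (space M) (\<lambda>\<omega>. \<lambda>i\<in>{..<d}. \<xi> i 0 \<omega>) (PiM {..<d} (\<lambda>_. borel)))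
          | Velocity \<Rightarrow> sets (vimage_algebra (space M) (\<lambda>\<omega>. \<lambda>i\<in>{..<d}. v i 0 \<omega>) (count_space ({..<d} \<rightarrow>\<^sub>E {-1, 1})))
          | Noise i \<Rightarrow> random_measure_sets (space M) quadrant (N i))"
        by (cases j) (auto simp: no_point_noise_sets)
    qed
  qed auto
  also have "(\<Inter>j\<in>?I. ?A j) = init_in B s \<inter> velocity_is s \<inter> (\<Inter>i\<in>{..<d}. no_point c i)"
    by auto
  also have "(\<Prod>j\<in>?I. prob (?A j)) = prob (init_in B s) * prob (velocity_is s) * (\<Prod>i<d. prob (no_point c i))"
  proof -
    have "(\<Prod>j\<in>Noise ` {..<d}. prob (?A j)) = (\<Prod>i<d. prob (no_point c i))"
      by (subst prod.reindex) (auto simp: inj_on_def)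
    moreover have "(\<Prod>j\<in>?I. prob (?A j)) = (\<Prod>j\<in>{Position, Velocity}. prob (?A j)) * (\<Prod>j\<in>Noise ` {..<d}. prob (?A j))"
      by (rule prod.union_disjoint) auto
    ultimately show ?thesis by simp
  qed
  finally show "prob (init_in B s \<inter> velocity_is s \<inter> (\<Inter>i\<in>{..<d}. no_point c i))
    = prob (init_in B s) * prob (velocity_is s) * (\<Prod>i<d. prob (no_point c i))" .
  have "init_in B s \<in> events" unfolding init_in_vimage
    by (rule measurable_sets[OF measurable_restrict prob_init_in(2)[OF B s]]) (use position_measurable in auto)
  moreover have "velocity_is s \<in> events" unfolding velocity_is_vimage[OF s]
    by (rule measurable_sets[OF velocity_vector_measurable]) (use s in auto)
  ultimately show "init_in B s \<inter> velocity_is s \<inter> (\<Inter>i\<in>{..<d}. no_point c i) \<in> events"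
    using index_nonempty by (intro sets.Int sets.finite_INT no_point_events) auto
qed

text \<open>Condition on the vector of initial velocities. Given its value \<open>s\<close>, the initial values are \<open>s\<^sub>i \<xi>\<^sub>i\<close>, which by
  symmetry of the normal law have the same joint law for every \<open>s\<close>; the noise is independent of both. The
  weights \<open>1 / 2\<^sup>d\<close> add up to \<open>1\<close>.\<close>

lemma prob_drive_box:
  assumes B: "\<And>i. i < d \<Longrightarrow> B i \<in> sets borel"
  shows "prob {\<omega> \<in> space M. \<forall>i<d. drive (i, 0) \<omega> \<in> B i \<and> (\<forall>k<n. c i k \<le> drive (i, Suc k) \<omega>)}
    = (\<Prod>i<d. measure std_normal (B i) * (\<Prod>k<n. exp (- (h * max (c i k) 0))))"
    (is "prob ?L = ?R")
proof -
  let ?S = "{..<d} \<rightarrow>\<^sub>E {-1, 1::real}"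
  let ?E = "\<lambda>s. init_in B s \<inter> velocity_is s \<inter> (\<Inter>i\<in>{..<d}. no_point c i)"
  let ?U = "\<Union>s\<in>?S. ?E s"
  have ev: "?E s \<in> events" if "s \<in> ?S" for s by (rule prob_init_velocity_noise(2)[OF B that])
  have U_eq: "\<omega> \<in> ?U \<longleftrightarrow> (\<forall>i<d. drive (i, 0) \<omega> \<in> B i) \<and> (\<forall>i<d. \<omega> \<in> no_point c i)" if "\<omega> \<in> space M" for \<omega>
  proof
    assume "\<omega> \<in> ?U"
    then show "(\<forall>i<d. drive (i, 0) \<omega> \<in> B i) \<and> (\<forall>i<d. \<omega> \<in> no_point c i)"
      by (auto simp: init_in_def velocity_is_def)
  next
    assume *: "(\<forall>i<d. drive (i, 0) \<omega> \<in> B i) \<and> (\<forall>i<d. \<omega> \<in> no_point c i)"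
    let ?s = "\<lambda>i\<in>{..<d}. v i 0 \<omega>"
    have "?s \<in> ?S" using that by (rule initial_velocity_sign)
    moreover have "\<omega> \<in> ?E ?s" using * that by (auto simp: init_in_def velocity_is_def)
    ultimately show "\<omega> \<in> ?U" by blast
  qed
  have L_ev: "?L \<in> events"
  proof -
    have [measurable]: "drive (i, k) \<in> borel_measurable M" if "i \<in> {..<d}" for i k
      using drive_measurable that by auto
    have [measurable]: "B i \<in> sets borel" if "i \<in> {..<d}" for i using B that by auto
    have "{\<omega> \<in> space M. \<forall>i\<in>{..<d}. drive (i, 0) \<omega> \<in> B i \<and> (\<forall>k\<in>{..<n}. c i k \<le> drive (i, Suc k) \<omega>)} \<in> events"
      by measurable
    then show ?thesis by (simp add: Ball_def del: drive.simps)
  qed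
  have U_ev: "?U \<in> events" using ev finite_signs(1) by (intro sets.finite_UN) auto
  have "prob ?L = prob ?U"
  proof (rule measure_eq_AE[OF _ L_ev U_ev])
    show "AE \<omega> in M. \<omega> \<in> ?L \<longleftrightarrow> \<omega> \<in> ?U"
      using AE_cells_inhabited AE_space
    proof eventually_elim
      case (elim \<omega>)
      have "(\<forall>k<n. c i k \<le> drive (i, Suc k) \<omega>) \<longleftrightarrow> \<omega> \<in> no_point c i" if "i < d" for i
        unfolding no_point_def using le_drive_iff[OF that elim(2)] elim that by auto
      then show ?case unfolding U_eq[OF elim(2)] using elim(2) by blast
    qed
  qed
  also have "\<dots> = (\<Sum>s\<in>?S. prob (?E s))"
  proof (rule finite_measure_finite_Union[OF finite_signs(1)])
    show "disjoint_family_on ?E ?S"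
    proof -
      have disj: "velocity_is s \<inter> velocity_is t = {}" if "s \<in> ?S" "t \<in> ?S" "s \<noteq> t" for s t
      proof (rule ccontr)
        assume "velocity_is s \<inter> velocity_is t \<noteq> {}"
        then obtain \<omega> where "\<omega> \<in> velocity_is s" "\<omega> \<in> velocity_is t" by blast
        then have "s i = t i" for i
          using PiE_arb[OF that(1), of i] PiE_arb[OF that(2), of i] unfolding velocity_is_def
          by (cases "i < d") auto
        then show False using that(3) by blast
      qed
      show ?thesis unfolding disjoint_family_on_def
      proof (intro ballI impI)
        fix s t assume "s \<in> ?S" "t \<in> ?S" "s \<noteq> t"
        then have "velocity_is s \<inter> velocity_is t = {}" by (rule disj)
        moreover have "?E s \<inter> ?E t \<subseteq> velocity_is s \<inter> velocity_is t" by auto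
        ultimately show "?E s \<inter> ?E t = {}" by simp
      qed
    qed
    show "?E ` ?S \<subseteq> events" using ev by blast
  qed
  also have "\<dots> = (\<Sum>s\<in>?S. 1 / card ?S * ?R)"
  proof (rule sum.cong[OF refl])
    fix s assume s: "s \<in> ?S"
    have "(\<Prod>i<d. prob (no_point c i)) = (\<Prod>i<d. \<Prod>k<n. exp (- (h * max (c i k) 0)))"
      by (rule prod.cong[OF refl], rule prob_no_points) simp
    moreover have "prob (?E s) = prob (init_in B s) * prob (velocity_is s) * (\<Prod>i<d. prob (no_point c i))"
      by (rule prob_init_velocity_noise(1)[OF B s])
    moreover have "prob (init_in B s) = (\<Prod>i<d. measure std_normal (B i))"
      by (rule prob_init_in(1)[OF B s])
    ultimately show "prob (?E s) = 1 / card ?S * ?R"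
      unfolding prob_velocity_is[OF s] prod.distrib by simp
  qed
  also have "\<dots> = ?R" using finite_signs by (simp add: card_gt_0_iff)
  finally show ?thesis .
qed

lemma prob_initial_in:
  assumes i: "i < d" and B: "B \<in> sets borel"
  shows "prob (drive (i, 0) -` B \<inter> space M) = measure std_normal B"
proof -
  let ?B = "\<lambda>j. if j = i then B else UNIV"
  have eq: "drive (i, 0) -` B \<inter> space M
      = {\<omega> \<in> space M. \<forall>j<d. drive (j, 0) \<omega> \<in> ?B j \<and> (\<forall>k<n. 0 \<le> drive (j, Suc k) \<omega>)}"
  proof (intro set_eqI iffI)
    fix \<omega> assume "\<omega> \<in> drive (i, 0) -` B \<inter> space M"
    then show "\<omega> \<in> {\<omega> \<in> space M. \<forall>j<d. drive (j, 0) \<omega> \<in> ?B j \<and> (\<forall>k<n. 0 \<le> drive (j, Suc k) \<omega>)}"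
      by (simp add: drive_Suc_nonneg del: drive.simps)
  next
    fix \<omega> assume "\<omega> \<in> {\<omega> \<in> space M. \<forall>j<d. drive (j, 0) \<omega> \<in> ?B j \<and> (\<forall>k<n. 0 \<le> drive (j, Suc k) \<omega>)}"
    then have "\<omega> \<in> space M" "drive (i, 0) \<omega> \<in> ?B i" using i by blast+
    then show "\<omega> \<in> drive (i, 0) -` B \<inter> space M" by (simp del: drive.simps)
  qed
  have "prob (drive (i, 0) -` B \<inter> space M) = (\<Prod>j<d. measure std_normal (?B j) * (\<Prod>k<n. exp (- (h * max 0 0))))"
    unfolding eq by (rule prob_drive_box) (use B in auto)
  also have "\<dots> = (\<Prod>j<d. if j = i then measure std_normal B else 1)"
  proof (rule prod.cong[OF refl])
    fix j
    have "(\<Prod>k<n. exp (- (h * max 0 0))) = 1" by simp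
    then show "measure std_normal (?B j) * (\<Prod>k<n. exp (- (h * max 0 0))) = (if j = i then measure std_normal B else 1)"
      by (cases "j = i") (simp_all only: simp_thms if_True if_False measure_std_normal_UNIV mult_1_right)
  qed
  also have "\<dots> = measure std_normal B" using i by simp
  finally show ?thesis .
qed

lemma prob_height_ge:
  assumes i: "i < d" and k: "k < n"
  shows "prob {\<omega> \<in> space M. a \<le> drive (i, Suc k) \<omega>} = exp (- (h * max a 0))"
proof -
  let ?c = "\<lambda>j l. if j = i \<and> l = k then a else 0"
  have eq: "{\<omega> \<in> space M. a \<le> drive (i, Suc k) \<omega>}
      = {\<omega> \<in> space M. \<forall>j<d. drive (j, 0) \<omega> \<in> UNIV \<and> (\<forall>l<n. ?c j l \<le> drive (j, Suc l) \<omega>)}"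
  proof (intro set_eqI iffI)
    fix \<omega> assume "\<omega> \<in> {\<omega> \<in> space M. a \<le> drive (i, Suc k) \<omega>}"
    then show "\<omega> \<in> {\<omega> \<in> space M. \<forall>j<d. drive (j, 0) \<omega> \<in> UNIV \<and> (\<forall>l<n. ?c j l \<le> drive (j, Suc l) \<omega>)}"
      by (simp add: drive_Suc_nonneg del: drive.simps)
  next
    fix \<omega> assume "\<omega> \<in> {\<omega> \<in> space M. \<forall>j<d. drive (j, 0) \<omega> \<in> UNIV \<and> (\<forall>l<n. ?c j l \<le> drive (j, Suc l) \<omega>)}"
    then have "\<omega> \<in> space M" "?c i k \<le> drive (i, Suc k) \<omega>" using i k by blast+
    then show "\<omega> \<in> {\<omega> \<in> space M. a \<le> drive (i, Suc k) \<omega>}" by (simp del: drive.simps)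
  qed
  have "prob {\<omega> \<in> space M. a \<le> drive (i, Suc k) \<omega>} = (\<Prod>j<d. measure std_normal UNIV * (\<Prod>l<n. exp (- (h * max (?c j l) 0))))"
    unfolding eq by (rule prob_drive_box) auto
  also have "\<dots> = (\<Prod>j<d. if j = i then exp (- (h * max a 0)) else 1)"
  proof (rule prod.cong[OF refl])
    fix j
    have "(\<Prod>l<n. exp (- (h * max (?c j l) 0))) = (\<Prod>l<n. if l = k then (if j = i then exp (- (h * max a 0)) else 1) else 1)"
    proof (rule prod.cong[OF refl])
      fix l
      show "exp (- (h * max (?c j l) 0)) = (if l = k then (if j = i then exp (- (h * max a 0)) else 1) else 1)"
        by (cases "j = i"; cases "l = k")
           (simp_all only: simp_thms if_True if_False max.idem mult_zero_right minus_zero exp_zero)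
    qed
    also have "\<dots> = (if j = i then exp (- (h * max a 0)) else 1)" using k by simp
    finally show "measure std_normal UNIV * (\<Prod>l<n. exp (- (h * max (?c j l) 0))) = (if j = i then exp (- (h * max a 0)) else 1)"
      by (simp only: measure_std_normal_UNIV mult_1_left)
  qed
  also have "\<dots> = exp (- (h * max a 0))" using i by simp
  finally show ?thesis .
qed

text \<open>Boxes with arbitrary Borel sides for the initial values and half-lines for the heights form an
  intersection-stable generator, on which \<open>prob_drive_box\<close> is the product formula. Adding the whole line
  to the half-lines costs nothing, because heights are nonnegative.\<close>

theorem indep_vars_drive: "indep_vars (\<lambda>_. borel) drive ({..<d} \<times> {..n})"
proof -
  let ?I = "{..<d} \<times> {..n}"
  let ?G = "\<lambda>p. if snd p = 0 then sets borel else insert UNIV (range (\<lambda>a::real. {a..}))"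
  have Ici: "sets (borel :: real measure) = sigma_sets UNIV (insert UNIV (range (\<lambda>a::real. {a..})))" (is "_ = ?R")
  proof -
    have eq: "sets (borel :: real measure) = sigma_sets UNIV (range (\<lambda>a::real. {a..}))"
      by (subst borel_Ici) (rule sets_measure_of, simp)
    show ?thesis
    proof
      show "sets borel \<subseteq> ?R" unfolding eq by (rule sigma_sets_mono') auto
      have "insert UNIV (range (\<lambda>a::real. {a..})) \<subseteq> sets borel" by auto
      from sets.sigma_sets_subset[OF this] show "?R \<subseteq> sets borel" by simp
    qed
  qed
  show ?thesis
  proof (subst indep_vars_finite[where E = ?G])
    have "(0, 0) \<in> ?I" using d_pos by simp
    then show "?I \<noteq> {}" by blast
    fix p assume "p \<in> ?I"
    show "sets borel = sigma_sets (space borel) (?G p)"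
      using Ici sets.sigma_sets_eq[of "borel :: real measure"] by simp
    show "drive p \<in> borel_measurable M" using drive_measurable \<open>p \<in> ?I\<close> by (cases p) auto
    show "Int_stable (?G p)"
    proof (cases "snd p = 0")
      case False
      have "{a..} \<inter> {b..} = {max a b..}" for a b :: real by auto
      then show ?thesis using False by (auto simp: Int_stable_def)
    qed (auto simp: Int_stable_def)
  next
    show "\<forall>A\<in>\<Pi> p\<in>?I. ?G p. prob (\<Inter>p\<in>?I. drive p -` A p \<inter> space M) = (\<Prod>p\<in>?I. prob (drive p -` A p \<inter> space M))"
    proof
      fix A assume A: "A \<in> (\<Pi> p\<in>?I. ?G p)"
      have A0: "A (i, 0) \<in> sets borel" if "i < d" for i
        using Pi_mem[OF A, of "(i, 0)"] that by simp
      define c where "c i k = (if A (i, Suc k) = UNIV then 0 else SOME a. A (i, Suc k) = {a..})" for i k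
      have c: "A (i, Suc k) = {c i k..} \<or> A (i, Suc k) = UNIV \<and> c i k = 0" if "i < d" "k < n" for i k
      proof (cases "A (i, Suc k) = UNIV")
        case False
        have "A (i, Suc k) \<in> ?G (i, Suc k)" using that by (intro Pi_mem[OF A]) simp
        then have "\<exists>a. A (i, Suc k) = {a..}" using False by auto
        then have "A (i, Suc k) = {(SOME a. A (i, Suc k) = {a..})..}" by (rule someI_ex)
        moreover have "c i k = (SOME a. A (i, Suc k) = {a..})" using False by (simp add: c_def)
        ultimately show ?thesis by (intro disjI1) (simp only:)
      qed (simp add: c_def)
      have mem: "drive (i, Suc k) \<omega> \<in> A (i, Suc k) \<longleftrightarrow> c i k \<le> drive (i, Suc k) \<omega>"
        if "i < d" "k < n" "\<omega> \<in> space M" for i k \<omega>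
        using c[OF that(1,2)] drive_Suc_nonneg[OF that(1,3), of k]
        by (elim disjE conjE) (simp_all only: atLeast_iff UNIV_I)
      have "(\<Inter>p\<in>?I. drive p -` A p \<inter> space M)
          = {\<omega> \<in> space M. \<forall>i<d. drive (i, 0) \<omega> \<in> A (i, 0) \<and> (\<forall>k<n. c i k \<le> drive (i, Suc k) \<omega>)}"
      proof (intro set_eqI iffI)
        fix \<omega> assume \<omega>: "\<omega> \<in> (\<Inter>p\<in>?I. drive p -` A p \<inter> space M)"
        have "(0, 0) \<in> ?I" using d_pos by simp
        then have sp: "\<omega> \<in> space M" using INT_D[OF \<omega>] by blast
        have in_A: "drive p \<omega> \<in> A p" if "p \<in> ?I" for p using INT_D[OF \<omega> that] by blast
        have "drive (i, 0) \<omega> \<in> A (i, 0) \<and> (\<forall>k<n. c i k \<le> drive (i, Suc k) \<omega>)" if i: "i < d" for i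
        proof (intro conjI allI impI)
          show "drive (i, 0) \<omega> \<in> A (i, 0)" by (rule in_A) (use i in simp)
          fix k assume k: "k < n"
          then have "drive (i, Suc k) \<omega> \<in> A (i, Suc k)" by (intro in_A) (use i in simp)
          then show "c i k \<le> drive (i, Suc k) \<omega>" using mem[OF i k sp] by blast
        qed
        then show "\<omega> \<in> {\<omega> \<in> space M. \<forall>i<d. drive (i, 0) \<omega> \<in> A (i, 0) \<and> (\<forall>k<n. c i k \<le> drive (i, Suc k) \<omega>)}"
          using sp by blast
      next
        fix \<omega> assume "\<omega> \<in> {\<omega> \<in> space M. \<forall>i<d. drive (i, 0) \<omega> \<in> A (i, 0) \<and> (\<forall>k<n. c i k \<le> drive (i, Suc k) \<omega>)}"
        then have \<omega>: "\<omega> \<in> space M" "\<And>i. i < d \<Longrightarrow> drive (i, 0) \<omega> \<in> A (i, 0)"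
          "\<And>i k. i < d \<Longrightarrow> k < n \<Longrightarrow> c i k \<le> drive (i, Suc k) \<omega>" by blast+
        have "drive (i, k) \<omega> \<in> A (i, k)" if "i < d" "k \<le> n" for i k
        proof (cases k)
          case 0
          then show ?thesis using \<omega>(2)[OF that(1)] by (simp del: drive.simps)
        next
          case (Suc l)
          then show ?thesis using \<omega>(3)[OF that(1), of l] mem[OF that(1) _ \<omega>(1), of l] that(2) by (simp del: drive.simps)
        qed
        then show "\<omega> \<in> (\<Inter>p\<in>?I. drive p -` A p \<inter> space M)" using \<omega>(1) by auto
      qed
      then have "prob (\<Inter>p\<in>?I. drive p -` A p \<inter> space M)
          = (\<Prod>i<d. measure std_normal (A (i, 0)) * (\<Prod>k<n. exp (- (h * max (c i k) 0))))"
        using prob_drive_box[of "\<lambda>i. A (i, 0)" c] A0 by simp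
      also have "\<dots> = (\<Prod>i<d. \<Prod>k\<le>n. prob (drive (i, k) -` A (i, k) \<inter> space M))"
      proof (rule prod.cong[OF refl])
        fix i assume "i \<in> {..<d}"
        then have i: "i < d" by simp
        have "prob (drive (i, Suc k) -` A (i, Suc k) \<inter> space M) = exp (- (h * max (c i k) 0))" if k: "k < n" for k
        proof -
          have "drive (i, Suc k) -` A (i, Suc k) \<inter> space M = {\<omega> \<in> space M. c i k \<le> drive (i, Suc k) \<omega>}"
            using mem[OF i k] by blast
          then show ?thesis using prob_height_ge[OF i k] by simp
        qed
        then have "(\<Prod>k<n. prob (drive (i, Suc k) -` A (i, Suc k) \<inter> space M)) = (\<Prod>k<n. exp (- (h * max (c i k) 0)))"
          by (intro prod.cong) auto
        then show "measure std_normal (A (i, 0)) * (\<Prod>k<n. exp (- (h * max (c i k) 0)))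
            = (\<Prod>k\<le>n. prob (drive (i, k) -` A (i, k) \<inter> space M))"
          unfolding prod.atMost_shift using prob_initial_in[OF i A0[OF i]] by (simp del: drive.simps)
      qed
      also have "\<dots> = (\<Prod>p\<in>?I. prob (drive p -` A p \<inter> space M))"
        by (simp add: prod.cartesian_product split_def del: drive.simps)
      finally show "prob (\<Inter>p\<in>?I. drive p -` A p \<inter> space M) = (\<Prod>p\<in>?I. prob (drive p -` A p \<inter> space M))" .
    qed
  qed auto
qed

lemma walk_driver_coordinate:
  assumes i: "i < d"
  shows "walk_driver M (\<lambda>k. drive (i, k)) h n"
proof
  show "0 < h" by (rule h_pos)
  have "indep_vars (\<lambda>_. borel) drive ((\<lambda>k. (i, k)) ` {..n})"
    by (rule indep_vars_subset[OF indep_vars_drive]) (use i in auto)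
  then show "indep_vars (\<lambda>_. borel) (\<lambda>k. drive (i, k)) {..n}"
    by (rule indep_vars_reindex[rotated]) (simp add: inj_on_def)
  show "distr M borel (drive (i, 0)) = std_normal"
  proof (rule measure_eqI)
    interpret SN: prob_space std_normal by (rule prob_space_std_normal)
    fix B assume "B \<in> sets (distr M borel (drive (i, 0)))"
    then have B: "B \<in> sets borel" by simp
    show "emeasure (distr M borel (drive (i, 0))) B = emeasure std_normal B"
      using prob_initial_in[OF i B] B
      by (simp add: emeasure_distr[OF drive_measurable[OF i]] emeasure_eq_measure SN.emeasure_eq_measure)
  qed simp
  show "prob {\<omega> \<in> space M. a \<le> drive (i, Suc k) \<omega>} = exp (- (h * max a 0))" if "k < n" for k a
    by (rule prob_height_ge[OF i that])
qed

end

section \<open>Weak law, completion, and counting jumps\<close>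

text \<open>Chebyshev's inequality; the mixed terms of the squared sum of deviations vanish by independence.\<close>

lemma (in prob_space) weak_law_bound:
  fixes X :: "nat \<Rightarrow> 'a \<Rightarrow> real"
  assumes ind: "indep_vars (\<lambda>_. borel) X {..<d}" and d: "1 \<le> d" and \<epsilon>: "0 < \<epsilon>"
    and sq: "\<And>i. i < d \<Longrightarrow> integrable M (\<lambda>\<omega>. (X i \<omega>)\<^sup>2)"
    and mean: "\<And>i. i < d \<Longrightarrow> expectation (X i) = \<mu>"
    and bound: "\<And>i. i < d \<Longrightarrow> expectation (\<lambda>\<omega>. (X i \<omega>)\<^sup>2) \<le> B"
  shows "prob {\<omega>\<in>space M. \<epsilon> \<le> \<bar>(\<Sum>i<d. X i \<omega>) / real d - \<mu>\<bar>} \<le> B / (real d * \<epsilon>\<^sup>2)"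
proof -
  have m: "X i \<in> borel_measurable M" if "i < d" for i
    using ind that unfolding indep_vars_def by auto
  have X_int: "integrable M (X i)" if "i < d" for i
    by (rule square_integrable_imp_integrable[OF m[OF that] sq[OF that]])
  define D where "D i \<omega> = X i \<omega> - \<mu>" for i \<omega>
  have D_int: "integrable M (D i)" and D_mean: "expectation (D i) = 0" if "i < d" for i
    using X_int[OF that] mean[OF that] by (simp_all add: D_def[abs_def] prob_space)
  have D_ind: "indep_vars (\<lambda>_. borel) D {..<d}"
    unfolding D_def[abs_def] by (rule indep_vars_compose2[OF ind]) auto
  have DD: "integrable M (\<lambda>\<omega>. D i \<omega> * D j \<omega>) \<and> expectation (\<lambda>\<omega>. D i \<omega> * D j \<omega>) \<le> (if i = j then B else 0)"
    if ij: "i < d" "j < d" for i j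
  proof (cases "i = j")
    case True
    have eq: "(\<lambda>\<omega>. D i \<omega> * D i \<omega>) = (\<lambda>\<omega>. (X i \<omega>)\<^sup>2 - 2 * \<mu> * X i \<omega> + \<mu>\<^sup>2)"
      by (simp add: D_def power2_eq_square algebra_simps)
    have "integrable M (\<lambda>\<omega>. D i \<omega> * D i \<omega>)"
      unfolding eq using sq[OF ij(1)] X_int[OF ij(1)] by simp
    moreover have "expectation (\<lambda>\<omega>. D i \<omega> * D i \<omega>) = expectation (\<lambda>\<omega>. (X i \<omega>)\<^sup>2) - \<mu>\<^sup>2"
      unfolding eq using sq[OF ij(1)] X_int[OF ij(1)] mean[OF ij(1)]
      by (simp add: prob_space power2_eq_square)
    moreover have "expectation (\<lambda>\<omega>. (X i \<omega>)\<^sup>2) - \<mu>\<^sup>2 \<le> B"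
      using bound[OF ij(1)] zero_le_power2[of \<mu>] by linarith
    ultimately show ?thesis unfolding True[symmetric] by (simp only: if_True refl simp_thms)
  next
    case False
    have ind2: "indep_vars (\<lambda>_. borel) D {i, j}"
      by (rule indep_vars_subset[OF D_ind]) (use ij in auto)
    have "integrable M (\<lambda>\<omega>. \<Prod>l\<in>{i, j}. D l \<omega>)"
      by (rule indep_vars_integrable[OF _ ind2]) (use D_int ij in auto)
    moreover have "expectation (\<lambda>\<omega>. \<Prod>l\<in>{i, j}. D l \<omega>) = (\<Prod>l\<in>{i, j}. expectation (D l))"
      by (rule indep_vars_lebesgue_integral[OF _ ind2]) (use D_int ij in auto)
    ultimately show ?thesis using False D_mean[OF ij(1)] by simp
  qed
  let ?S = "\<lambda>\<omega>. \<Sum>i<d. D i \<omega>"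
  have S_sq: "(\<lambda>\<omega>. (?S \<omega>)\<^sup>2) = (\<lambda>\<omega>. \<Sum>i<d. \<Sum>j<d. D i \<omega> * D j \<omega>)"
    by (simp add: power2_eq_square sum_product)
  have S_int: "integrable M (\<lambda>\<omega>. (?S \<omega>)\<^sup>2)"
    unfolding S_sq using DD by (intro Bochner_Integration.integrable_sum) auto
  have "expectation (\<lambda>\<omega>. (?S \<omega>)\<^sup>2) = (\<Sum>i<d. expectation (\<lambda>\<omega>. \<Sum>j<d. D i \<omega> * D j \<omega>))"
    unfolding S_sq using DD
    by (intro Bochner_Integration.integral_sum Bochner_Integration.integrable_sum) auto
  also have "\<dots> = (\<Sum>i<d. \<Sum>j<d. expectation (\<lambda>\<omega>. D i \<omega> * D j \<omega>))"
    using DD by (intro sum.cong refl Bochner_Integration.integral_sum) auto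
  also have "\<dots> \<le> (\<Sum>i<d. \<Sum>j<d. if i = j then B else 0)"
    using DD by (intro sum_mono) auto
  also have "\<dots> = real d * B" by simp
  finally have S_le: "expectation (\<lambda>\<omega>. (?S \<omega>)\<^sup>2) \<le> real d * B" .
  have [measurable]: "D i \<in> borel_measurable M" if "i \<in> {..<d}" for i
    using D_int that by auto
  have S_m: "?S \<in> borel_measurable M" by measurable
  have S_mean: "expectation ?S = 0"
    using D_int D_mean by (subst Bochner_Integration.integral_sum) auto
  have dev: "(\<Sum>i<d. X i \<omega>) / real d - \<mu> = ?S \<omega> / real d" for \<omega>
    using d by (simp add: D_def sum_subtractf field_simps)
  have eq: "{\<omega>\<in>space M. \<epsilon> \<le> \<bar>(\<Sum>i<d. X i \<omega>) / real d - \<mu>\<bar>} = {\<omega>\<in>space M. real d * \<epsilon> \<le> \<bar>?S \<omega> - expectation ?S\<bar>}"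
    unfolding dev S_mean using d by (auto simp: field_simps abs_divide)
  have "prob {\<omega>\<in>space M. \<epsilon> \<le> \<bar>(\<Sum>i<d. X i \<omega>) / real d - \<mu>\<bar>} \<le> variance ?S / (real d * \<epsilon>)\<^sup>2"
    unfolding eq by (rule Chebyshev_inequality[OF S_m S_int]) (use d \<epsilon> in simp)
  also have "\<dots> = expectation (\<lambda>\<omega>. (?S \<omega>)\<^sup>2) / (real d * \<epsilon>)\<^sup>2" by (simp add: S_mean)
  also have "\<dots> \<le> real d * B / (real d * \<epsilon>)\<^sup>2" by (rule divide_right_mono[OF S_le]) simp
  also have "\<dots> = B / (real d * \<epsilon>\<^sup>2)" using d by (simp add: power2_eq_square)
  finally show ?thesis .
qed

text \<open>A preimage under \<open>f\<close> contains the set where some approximation off its exceptional set certifies membership,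
  and exceeds it only inside the intersection of all exceptional sets, which is null.\<close>

lemma (in prob_space) borel_measurable_completion_approx:
  fixes f :: "'a \<Rightarrow> 'b::topological_space"
  assumes approx: "\<And>\<delta>. 0 < \<delta> \<Longrightarrow> \<exists>g\<in>borel_measurable M. \<exists>E\<in>events. prob E < \<delta> \<and> (\<forall>\<omega>\<in>space M - E. f \<omega> = g \<omega>)"
  shows "f \<in> borel_measurable (completion M)"
proof (rule measurableI)
  fix A :: "'b set" assume A: "A \<in> sets borel"
  have "\<exists>g E. g \<in> borel_measurable M \<and> E \<in> events \<and> prob E < inverse (real (Suc m)) \<and> (\<forall>\<omega>\<in>space M - E. f \<omega> = g \<omega>)" for m
    using approx[of "inverse (real (Suc m))"] by auto
  then obtain g E where g: "\<And>m. g m \<in> borel_measurable M" and E: "\<And>m. E m \<in> events"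
    and PE: "\<And>m. prob (E m) < inverse (real (Suc m))"
    and fg: "\<And>m \<omega>. \<omega> \<in> space M - E m \<Longrightarrow> f \<omega> = g m \<omega>"
    by metis
  define G where "G m = g m -` A \<inter> space M" for m
  have G: "G m \<in> events" for m unfolding G_def by (rule measurable_sets[OF g A])
  let ?F = "f -` A \<inter> space M"
  define L where "L = (\<Union>m. G m - E m)"
  define R where "R = (\<Inter>m. E m)"
  have L: "L \<in> events" unfolding L_def using G E by auto
  have R: "R \<in> events" unfolding R_def using E by auto
  have "L \<subseteq> ?F"
  proof
    fix \<omega> assume "\<omega> \<in> L"
    then obtain m where "\<omega> \<in> G m" "\<omega> \<notin> E m" unfolding L_def by blast
    then show "\<omega> \<in> ?F" using fg[of \<omega> m] by (auto simp: G_def)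
  qed
  moreover have "?F - L \<subseteq> R"
  proof
    fix \<omega> assume \<omega>: "\<omega> \<in> ?F - L"
    have "\<omega> \<in> E m" for m
    proof (rule ccontr)
      assume "\<omega> \<notin> E m"
      then have "\<omega> \<in> G m" using \<omega> fg[of \<omega> m] by (auto simp: G_def)
      then show False using \<omega> \<open>\<omega> \<notin> E m\<close> by (auto simp: L_def)
    qed
    then show "\<omega> \<in> R" by (simp add: R_def)
  qed
  moreover have "prob R = 0"
  proof (rule ccontr)
    assume "prob R \<noteq> 0"
    then have "0 < prob R" using measure_nonneg[of M R] by linarith
    then obtain m where "inverse (real (Suc m)) < prob R" using reals_Archimedean by blast
    moreover have "prob R \<le> prob (E m)" by (rule finite_measure_mono) (auto simp: R_def E)
    ultimately show False using PE[of m] by simp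
  qed
  then have "R \<in> null_sets M" using R by (simp add: null_sets_def emeasure_eq_measure)
  ultimately have "?F - L \<in> null_sets (completion M)"
    using null_sets_completion_subset null_sets_completionI by blast
  then have "L \<union> (?F - L) \<in> sets (completion M)"
    using L by (intro sets.Un) auto
  moreover have "L \<union> (?F - L) = ?F" using \<open>L \<subseteq> ?F\<close> by blast
  ultimately show "f -` A \<inter> space (completion M) \<in> sets (completion M)" by simp
qed simp

lemma num_jumps_finite:
  assumes fin: "finite S" and S: "S \<subseteq> {0..T}" and jmp: "\<And>t. 0 \<le> t \<Longrightarrow> t \<le> T \<Longrightarrow> jump f t \<noteq> 0 \<longleftrightarrow> t \<in> S"
  shows "num_jumps T f = ereal (real (card S))"
proof -
  have "num_jumps T f = infsum (\<lambda>_. 1) S"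
    unfolding num_jumps_def by (rule infsum_cong_neutral) (use S jmp in auto)
  also have "\<dots> = (\<Sum>t\<in>S. 1)" by (rule infsum_finite[OF fin])
  also have "\<dots> = ereal (real (card S))" using sum_ereal[of "\<lambda>_. 1" S] by (simp add: one_ereal_def)
  finally show ?thesis .
qed

text \<open>Positions are continuous, so the jump of the sum at \<open>t\<close> is the sum of \<open>x\<^sub>i t\<close> times the jump of \<open>v\<^sub>i\<close>. With no common
  switching times at most one term is present, and it does not vanish.\<close>

lemma num_jumps_angular_momentum:
  fixes m :: "nat \<Rightarrow> (real \<times> real) measure" and x v :: "nat \<Rightarrow> real \<Rightarrow> real"
  assumes path: "\<And>i. i < d \<Longrightarrow> switching_path (m i) (x i) (v i)" and d: "1 \<le> d"
    and fin: "\<And>i. i < d \<Longrightarrow> finite (switches (v i) 0 T)"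
    and nz: "\<And>i t. i < d \<Longrightarrow> t \<in> switches (v i) 0 T \<Longrightarrow> x i t \<noteq> 0"
    and disj: "\<And>i j. i < d \<Longrightarrow> j < d \<Longrightarrow> i \<noteq> j \<Longrightarrow> switches (v i) 0 T \<inter> switches (v j) 0 T = {}"
  shows "num_jumps T (\<lambda>t. (\<Sum>i<d. x i t * v i t) / sqrt (real d)) = ereal (real (\<Sum>i<d. card (switches (v i) 0 T)))"
proof -
  let ?f = "\<lambda>t. (\<Sum>i<d. x i t * v i t) / sqrt (real d)"
  let ?S = "\<Union>i<d. switches (v i) 0 T"
  have jump_f: "jump ?f t = (\<Sum>i<d. x i t * (v i t - left_lim (v i) t)) / sqrt (real d)" if t: "0 < t" for t
  proof -
    have lim: "(?f \<longlongrightarrow> (\<Sum>i<d. x i t * left_lim (v i) t) / sqrt (real d)) (at_left t)"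
    proof (intro tendsto_divide tendsto_sum tendsto_mult tendsto_const)
      fix i assume "i \<in> {..<d}"
      then have "switching_path (m i) (x i) (v i)" using path by simp
      then show "(x i \<longlongrightarrow> x i t) (at_left t)" "(v i \<longlongrightarrow> left_lim (v i) t) (at_left t)"
        using t by (auto intro: switching_path.x_left_lim switching_path.v_left_lim(1))
    qed (use d in simp)
    have "left_lim ?f t = (\<Sum>i<d. x i t * left_lim (v i) t) / sqrt (real d)"
      by (rule left_lim_eqI[OF t lim])
    then show ?thesis unfolding jump_def
      by (simp add: diff_divide_distrib[symmetric] sum_subtractf[symmetric] right_diff_distrib)
  qed
  have "num_jumps T ?f = ereal (real (card ?S))"
  proof (rule num_jumps_finite)
    show "finite ?S" using fin by auto
    show "?S \<subseteq> {0..T}" by (auto simp: switches_def)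
    fix t assume t: "0 \<le> t" "t \<le> T"
    show "jump ?f t \<noteq> 0 \<longleftrightarrow> t \<in> ?S"
    proof (cases "t = 0")
      case True
      then show ?thesis by (simp add: jump_def left_lim_def switches_def)
    next
      case False
      then have t0: "0 < t" using t by simp
      have sw: "t \<in> switches (v i) 0 T \<longleftrightarrow> v i t \<noteq> left_lim (v i) t" for i
        using t0 t by (simp add: switches_def)
      show ?thesis
      proof
        assume "t \<in> ?S"
        then obtain j where j: "j < d" "t \<in> switches (v j) 0 T" by blast
        have "v i t - left_lim (v i) t = 0" if "i < d" "i \<noteq> j" for i
          using disj[OF that(1) j(1) that(2)] j(2) sw[of i] by auto
        then have "(\<Sum>i<d. x i t * (v i t - left_lim (v i) t)) = (\<Sum>i<d. if i = j then x j t * (v j t - left_lim (v j) t) else 0)"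
          by (intro sum.cong) auto
        also have "\<dots> = x j t * (v j t - left_lim (v j) t)" using j(1) by simp
        also have "\<dots> \<noteq> 0" using nz[OF j] j(2) sw[of j] by simp
        finally show "jump ?f t \<noteq> 0" unfolding jump_f[OF t0] using d by simp
      next
        assume "jump ?f t \<noteq> 0"
        then obtain i where "i < d" "x i t * (v i t - left_lim (v i) t) \<noteq> 0"
          unfolding jump_f[OF t0] by (metis (no_types, lifting) div_0 lessThan_iff sum.neutral)
        then show "t \<in> ?S" using sw[of i] by auto
      qed
    qed
  qed
  also have "card ?S = (\<Sum>i<d. card (switches (v i) 0 T))"
    by (rule card_UN_disjoint) (use fin disj in auto)
  finally show ?thesis .
qed

section \<open>Discretisation errors are improbable\<close>

context driven_zigzag begin

lemma AE_axis_empty: "AE \<omega> in M. \<forall>i<d. emeasure (N i \<omega>) ({0..} \<times> {0}) = 0"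
proof -
  have "AE \<omega> in M. i < d \<longrightarrow> emeasure (N i \<omega>) ({0..} \<times> {0}) = 0" for i
  proof (cases "i < d")
    case True
    have A: "{0::real..} \<times> {0::real} \<in> sets quadrant" by (rule rect_in_quadrant) auto
    have z: "emeasure quadrant ({0..} \<times> {0}) = 0" by (subst emeasure_quadrant_rect) auto
    have "prob {\<omega>\<in>space M. emeasure (N i \<omega>) ({0..} \<times> {0}) = of_nat 0} = 1"
      using noise_prob[OF True A, of 0] z by (simp add: measure_def)
    then have "AE \<omega> in M. \<omega> \<in> {\<omega>\<in>space M. emeasure (N i \<omega>) ({0..} \<times> {0}) = of_nat 0}" by (rule AE_prob_1)
    then show ?thesis by eventually_elim simp
  qed simp
  then have "AE \<omega> in M. \<forall>i. i < d \<longrightarrow> emeasure (N i \<omega>) ({0..} \<times> {0}) = 0" by (simp add: AE_all_countable)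
  then show ?thesis by eventually_elim blast
qed

lemma AE_switching_path:
  "AE \<omega> in M. \<forall>i<d. switching_path (N i \<omega>) (\<lambda>t. \<xi> i t \<omega>) (\<lambda>t. v i t \<omega>)"
  using velocity_cadlag position_eq velocity_integrable velocity_eq AE_axis_empty AE_space
proof eventually_elim
  case (elim \<omega>)
  show ?case
  proof (intro allI impI)
    fix i assume i: "i < d"
    show "switching_path (N i \<omega>) (\<lambda>t. \<xi> i t \<omega>) (\<lambda>t. v i t \<omega>)"
    proof
      show "sets (N i \<omega>) = sets quadrant" by (rule sets_noise[OF i elim(6)])
      show "cadlag (\<lambda>t. v i t \<omega>)" using elim(1) i by blast
      show "emeasure (N i \<omega>) ({0..} \<times> {0}) = 0" using elim(5) i by blast
      fix t :: real assume t: "0 \<le> t"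
      show "v i t \<omega> \<in> {-1, 1}" by (rule velocity_sign[OF i elim(6) t])
      show "\<xi> i t \<omega> = \<xi> i 0 \<omega> + (LBINT s:{0..t}. v i s \<omega>)" using elim(2) i t by blast
      show "set_integrable (N i \<omega>) ({0<..t} \<times> {0..})
        (\<lambda>(s, z). left_lim (\<lambda>u. v i u \<omega>) s *
          (if z \<le> max (left_lim (\<lambda>u. \<xi> i u \<omega>) s * left_lim (\<lambda>u. v i u \<omega>) s) 0 then 1 else 0))"
        using elim(3) i t by blast
      show "v i t \<omega> = v i 0 \<omega> - 2 * (LINT (s, z):{0<..t} \<times> {0..}|N i \<omega>.
        left_lim (\<lambda>u. v i u \<omega>) s *
          (if z \<le> max (left_lim (\<lambda>u. \<xi> i u \<omega>) s * left_lim (\<lambda>u. v i u \<omega>) s) 0 then 1 else 0))"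
        using elim(4) i t by blast
    qed
  qed
qed

text \<open>Outside of this event the cell has at most one point up to height \<open>K\<close>, so a switch in it
  exhausts what could cause a second one.\<close>

definition crowded :: "real \<Rightarrow> nat \<Rightarrow> nat \<Rightarrow> 'w set" where
  "crowded K i k = space M - {\<omega>\<in>space M. emeasure (N i \<omega>) (cell k \<times> {0..K}) = of_nat 0}
    - {\<omega>\<in>space M. emeasure (N i \<omega>) (cell k \<times> {0..K}) = of_nat 1}"

text \<open>For a Poisson variable of mean \<open>l\<close>, at least two points have probability
  \<open>1 - exp (- l) (1 + l) \<le> 1 - (1 - l) (1 + l) = l\<^sup>2\<close>.\<close>

lemma prob_crowded:
  assumes i: "i < d" and K: "0 \<le> K"
  shows "crowded K i k \<in> events" "prob (crowded K i k) \<le> (h * K)\<^sup>2"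
proof -
  let ?A = "cell k \<times> {0..K}"
  let ?E = "\<lambda>l. {\<omega>\<in>space M. emeasure (N i \<omega>) ?A = of_nat l}"
  have A: "?A \<in> sets quadrant" by (rule cell_rect) auto
  have [measurable]: "(\<lambda>\<omega>. emeasure (N i \<omega>) ?A) \<in> borel_measurable M" by (rule noise_measurable[OF i A])
  have ev: "?E l \<in> events" for l by measurable
  have em: "emeasure quadrant ?A = ennreal (h * K)"
    using h_pos K by (subst emeasure_cell_rect) (auto simp: ennreal_mult[symmetric])
  then have m: "measure quadrant ?A = h * K" using h_pos K by (simp add: measure_def)
  have P: "prob (?E l) = exp (- (h * K)) * (h * K) ^ l / fact l" for l
    using noise_prob[OF i A, of l] em m by simp
  have disj: "?E 0 \<inter> ?E 1 = {}" by auto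
  have eq: "crowded K i k = space M - (?E 0 \<union> ?E 1)" unfolding crowded_def by blast
  show "crowded K i k \<in> events" unfolding eq using ev by blast
  have "prob (crowded K i k) = 1 - prob (?E 0 \<union> ?E 1)" unfolding eq by (rule prob_compl) (use ev in blast)
  also have "\<dots> = 1 - (prob (?E 0) + prob (?E 1))" using finite_measure_Union[OF ev ev disj] by simp
  also have "\<dots> = 1 - exp (- (h * K)) * (1 + h * K)" unfolding P by (simp add: algebra_simps)
  also have "\<dots> \<le> 1 - (1 - h * K) * (1 + h * K)"
  proof -
    have "(1 - h * K) * (1 + h * K) \<le> exp (- (h * K)) * (1 + h * K)"
      using one_minus_exp_le[of "h * K"] h_pos K by (intro mult_right_mono) auto
    then show ?thesis by simp
  qed
  also have "\<dots> = (h * K)\<^sup>2" by (simp add: power2_eq_square algebra_simps)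
  finally show "prob (crowded K i k) \<le> (h * K)\<^sup>2" .
qed

definition far :: "real \<Rightarrow> nat \<Rightarrow> 'w set" where
  "far r i = {\<omega>\<in>space M. r \<le> \<bar>drive (i, 0) \<omega>\<bar>}"

lemma prob_far:
  assumes i: "i < d" and r: "0 < r"
  shows "far r i \<in> events" "prob (far r i) \<le> (\<integral>x. \<bar>x\<bar> \<partial>std_normal) / r"
proof -
  have [measurable]: "drive (i, 0) \<in> borel_measurable M" by (rule drive_measurable[OF i])
  show "far r i \<in> events" unfolding far_def by measurable
  have eq: "far r i = drive (i, 0) -` {x. r \<le> \<bar>x\<bar>} \<inter> space M" by (auto simp: far_def)
  have "prob (far r i) = measure std_normal {x. r \<le> \<bar>x\<bar>}"
    unfolding eq by (rule prob_initial_in[OF i]) measurable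
  also have "\<dots> = measure std_normal {x\<in>space std_normal. \<bar>x\<bar> \<ge> r}" by simp
  also have "\<dots> \<le> (\<integral>x. \<bar>x\<bar> \<partial>std_normal) / r"
    by (rule integral_Markov_inequality_measure[where A="{}"])
       (use integrable_std_normal_abs_power[of 1] r in auto)
  finally show "prob (far r i) \<le> (\<integral>x. \<bar>x\<bar> \<partial>std_normal) / r" .
qed

text \<open>Off this event, coordinates \<open>i\<close> and \<open>j\<close> cannot both switch in cell \<open>k\<close> as long as \<open>K\<close> exceeds all thresholds;
  in particular they do not switch at the same time.\<close>

definition collision :: "real \<Rightarrow> nat \<Rightarrow> nat \<Rightarrow> nat \<Rightarrow> 'w set" where
  "collision K i j k = {\<omega>\<in>space M. drive (i, Suc k) \<omega> < K \<and> drive (j, Suc k) \<omega> < K}"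

lemma prob_collision:
  assumes ij: "i < d" "j < d" "i \<noteq> j" and k: "k < n" and K: "0 \<le> K"
  shows "collision K i j k \<in> events" "prob (collision K i j k) \<le> (h * K)\<^sup>2"
proof -
  have [measurable]: "drive (i, Suc k) \<in> borel_measurable M" "drive (j, Suc k) \<in> borel_measurable M"
    using drive_measurable ij by blast+
  show "collision K i j k \<in> events" unfolding collision_def by measurable
  have low: "prob (drive (l, Suc k) -` {..<K} \<inter> space M) \<le> h * K" and low0: "0 \<le> prob (drive (l, Suc k) -` {..<K} \<inter> space M)" if "l < d" for l
  proof -
    interpret W: walk_driver M "\<lambda>k. drive (l, k)" h n by (rule walk_driver_coordinate[OF that])
    have "drive (l, Suc k) -` {..<K} \<inter> space M = {\<omega> \<in> space M. drive (l, Suc k) \<omega> < K}" by blast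
    then show "prob (drive (l, Suc k) -` {..<K} \<inter> space M) \<le> h * K"
      using W.prob_height_less[OF k, of K] one_minus_exp_le[of "h * K"] K by simp
  qed (rule measure_nonneg)
  let ?I = "{(i, Suc k), (j, Suc k)}"
  have "prob (\<Inter>p\<in>?I. drive p -` {..<K} \<inter> space M) = (\<Prod>p\<in>?I. prob (drive p -` {..<K} \<inter> space M))"
    by (rule indep_varsD[OF indep_vars_drive]) (use ij k in auto)
  moreover have "(\<Inter>p\<in>?I. drive p -` {..<K} \<inter> space M) = collision K i j k"
    unfolding collision_def by blast
  moreover have "(\<Prod>p\<in>?I. prob (drive p -` {..<K} \<inter> space M))
      = prob (drive (i, Suc k) -` {..<K} \<inter> space M) * prob (drive (j, Suc k) -` {..<K} \<inter> space M)"
    using ij(3) by simp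
  ultimately have "prob (collision K i j k)
      = prob (drive (i, Suc k) -` {..<K} \<inter> space M) * prob (drive (j, Suc k) -` {..<K} \<inter> space M)"
    by (simp only:)
  also have "\<dots> \<le> (h * K) * (h * K)"
    using low low0 ij h_pos K by (intro mult_mono) auto
  finally show "prob (collision K i j k) \<le> (h * K)\<^sup>2" by (simp add: power2_eq_square)
qed

definition coord_near_miss :: "nat \<Rightarrow> nat \<Rightarrow> 'w set" where
  "coord_near_miss i k = walk_driver.near_miss M (\<lambda>k. drive (i, k)) h k"

lemma coord_near_miss_eq:
  assumes i: "i < d"
  shows "coord_near_miss i k = {\<omega> \<in> space M.
      walk h (\<lambda>l. drive (i, l) \<omega>) k + h / 2 - (real (flips h (\<lambda>l. drive (i, l) \<omega>) k) + 2) * h \<le> drive (i, Suc k) \<omega>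
      \<and> drive (i, Suc k) \<omega> < walk h (\<lambda>l. drive (i, l) \<omega>) k + h / 2 + (real (flips h (\<lambda>l. drive (i, l) \<omega>) k) + 2) * h}"
  unfolding coord_near_miss_def by (rule walk_driver.near_miss_def[OF walk_driver_coordinate[OF i]])

lemma prob_coord_near_miss:
  assumes "i < d" "k < n"
  shows "coord_near_miss i k \<in> events"
    "prob (coord_near_miss i k) \<le> 2 * h\<^sup>2 * (flips_moment_bound (real n * h) + 2)"
  using walk_driver.near_miss_sets[OF walk_driver_coordinate[OF assms(1)] assms(2)]
    walk_driver.prob_near_miss[OF walk_driver_coordinate[OF assms(1)] assms(2)]
  unfolding coord_near_miss_def by auto

abbreviation total_flips :: "'w \<Rightarrow> real" where
  "total_flips \<omega> \<equiv> (\<Sum>i<d. real (flips h (\<lambda>l. drive (i, l) \<omega>) n))"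

text \<open>Here \<open>K\<close> bounds every position up to time \<open>T\<close>, as positions move at unit speed. By \<open>walk_tracks_path\<close> each
  coordinate switches as often as its walk flips; a switch in a cell requires a height below \<open>K\<close>, so
  common switching times would be collisions.\<close>

lemma num_jumps_eq_total_flips:
  assumes sp: "\<omega> \<in> space M" and inh: "\<forall>i<d. \<forall>k. emeasure (N i \<omega>) (cell k \<times> {0..}) \<noteq> 0"
    and path: "\<forall>i<d. switching_path (N i \<omega>) (\<lambda>t. \<xi> i t \<omega>) (\<lambda>t. v i t \<omega>)"
    and T: "real n * h = T"
    and near: "\<And>i k. i < d \<Longrightarrow> k < n \<Longrightarrow> \<omega> \<notin> coord_near_miss i k"
    and crowd: "\<And>i k. i < d \<Longrightarrow> k < n \<Longrightarrow> \<omega> \<notin> crowded K i k"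
    and close: "\<And>i. i < d \<Longrightarrow> \<omega> \<notin> far (K - T) i"
    and coll: "\<And>i j k. i < d \<Longrightarrow> j < d \<Longrightarrow> i \<noteq> j \<Longrightarrow> k < n \<Longrightarrow> \<omega> \<notin> collision K i j k"
  shows "num_jumps T (\<lambda>t. angular_momentum d \<xi> v t \<omega>) = ereal (total_flips \<omega>)"
proof -
  let ?c = "\<lambda>i k. drive (i, k) \<omega>"
  let ?sw = "\<lambda>i. switches (\<lambda>t. v i t \<omega>) 0 T"
  have start: "\<bar>?c i 0\<bar> + T \<le> K" if "i < d" for i
    using close[OF that] sp by (simp add: far_def del: drive.simps)
  have track: "finite (?sw i) \<and> card (?sw i) = flips h (?c i) n \<and> (\<forall>t\<in>?sw i. \<xi> i t \<omega> \<noteq> 0 \<and>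
      (\<exists>k<n. real k * h < t \<and> t \<le> real (Suc k) * h \<and> ?c i (Suc k) < walk h (?c i) k + h / 2))"
    if i: "i < d" for i
  proof -
    interpret P: switching_path "N i \<omega>" "\<lambda>t. \<xi> i t \<omega>" "\<lambda>t. v i t \<omega>" using path i by blast
    have v0: "v i 0 \<omega> \<in> {-1, 1}" by (rule velocity_sign[OF i sp order_refl])
    have K: "\<bar>\<xi> i 0 \<omega>\<bar> + real n * h \<le> K"
    proof -
      have "\<bar>?c i 0\<bar> = \<bar>\<xi> i 0 \<omega>\<bar>" using v0 by (auto simp: abs_mult)
      then show ?thesis using start[OF i] T by simp
    qed
    have single: "emeasure (N i \<omega>) ({real k * h<..real (Suc k) * h} \<times> {0..K}) \<le> 1" if "k < n" for k
      using crowd[OF i that] sp unfolding crowded_def cell_def[symmetric] by auto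
    have height: "a \<le> ?c i (Suc k) \<longleftrightarrow> emeasure (N i \<omega>) ({real k * h<..real (Suc k) * h} \<times> {0..<a}) = 0" for k a
      using le_drive_iff[OF i sp, of k a] inh i unfolding cell_def[symmetric] by blast
    have clear: "\<not> (walk h (?c i) k + h / 2 - (real (flips h (?c i) k) + 2) * h \<le> ?c i (Suc k)
      \<and> ?c i (Suc k) < walk h (?c i) k + h / 2 + (real (flips h (?c i) k) + 2) * h)" if "k < n" for k
      using near[OF i that] sp unfolding coord_near_miss_eq[OF i] by blast
    have c0: "?c i 0 = \<xi> i 0 \<omega> * v i 0 \<omega>" by simp
    from P.walk_tracks_path[OF h_pos c0 K height single clear order_refl]
    show ?thesis unfolding T by blast
  qed
  have low: "?c i (Suc k) < K" if i: "i < d" and k: "k < n" and lt: "?c i (Suc k) < walk h (?c i) k + h / 2" for i k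
  proof -
    have "real k * h + h \<le> T"
      using mult_right_mono[of "real (Suc k)" "real n" h] k h_pos T by (simp add: algebra_simps)
    then show ?thesis using walk_bound[of h "?c i" k] start[OF i] lt h_pos by linarith
  qed
  have disj: "?sw i \<inter> ?sw j = {}" if ij: "i < d" "j < d" "i \<noteq> j" for i j
  proof (rule ccontr)
    assume "?sw i \<inter> ?sw j \<noteq> {}"
    then obtain t where t: "t \<in> ?sw i" "t \<in> ?sw j" by blast
    obtain k where k: "k < n" "t \<in> cell k" "?c i (Suc k) < walk h (?c i) k + h / 2"
      using track[OF ij(1)] t(1) unfolding cell_def greaterThanAtMost_iff by blast
    obtain l where l: "l < n" "t \<in> cell l" "?c j (Suc l) < walk h (?c j) l + h / 2"
      using track[OF ij(2)] t(2) unfolding cell_def greaterThanAtMost_iff by blast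
    have "k = l" using disjoint_cells k(2) l(2) unfolding disjoint_family_on_def by blast
    then have "\<omega> \<in> collision K i j k"
      using low[OF ij(1) k(1,3)] low[OF ij(2) l(1,3)] sp unfolding collision_def by blast
    then show False using coll[OF ij k(1)] by blast
  qed
  have "num_jumps T (\<lambda>t. (\<Sum>i<d. \<xi> i t \<omega> * v i t \<omega>) / sqrt (real d)) = ereal (real (\<Sum>i<d. card (?sw i)))"
    by (rule num_jumps_angular_momentum[where m="\<lambda>i. N i \<omega>" and x="\<lambda>i t. \<xi> i t \<omega>" and v="\<lambda>i t. v i t \<omega>"])
       (use path d_pos track disj in blast)+
  also have "real (\<Sum>i<d. card (?sw i)) = total_flips \<omega>"
    unfolding of_nat_sum by (rule sum.cong[OF refl]) (use track in simp)
  finally show ?thesis unfolding angular_momentum_def .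
qed

text \<open>Every error term over a single cell is of order \<open>h\<^sup>2\<close>, and \<open>n h\<^sup>2 = T h\<close>. What remains as \<open>h \<rightarrow> 0\<close> is the probability
  of a large initial position, which is small for large \<open>K\<close>.\<close>

lemma num_jumps_eq_total_flips_whp:
  assumes T: "real n * h = T" and K: "T < K"
  shows "\<exists>E\<in>events. prob E \<le> real d * (2 * T * h * (flips_moment_bound T + 2) + T * h * K\<^sup>2
        + (\<integral>x. \<bar>x\<bar> \<partial>std_normal) / (K - T)) + (real d)\<^sup>2 * (T * h * K\<^sup>2)
      \<and> (\<forall>\<omega>\<in>space M - E. num_jumps T (\<lambda>t. angular_momentum d \<xi> v t \<omega>) = ereal (total_flips \<omega>))"
proof -
  have T0: "0 < T" using T h_pos n_pos by (auto simp: T[symmetric])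
  have K0: "0 \<le> K" using T0 K by simp
  obtain Z where Z: "Z \<in> null_sets M" and
    good: "{\<omega>\<in>space M. \<not> ((\<forall>i<d. \<forall>k. emeasure (N i \<omega>) (cell k \<times> {0..}) \<noteq> 0) \<and>
      (\<forall>i<d. switching_path (N i \<omega>) (\<lambda>t. \<xi> i t \<omega>) (\<lambda>t. v i t \<omega>)))} \<subseteq> Z"
  proof -
    have "AE \<omega> in M. (\<forall>i<d. \<forall>k. emeasure (N i \<omega>) (cell k \<times> {0..}) \<noteq> 0) \<and>
      (\<forall>i<d. switching_path (N i \<omega>) (\<lambda>t. \<xi> i t \<omega>) (\<lambda>t. v i t \<omega>))"
      using AE_cells_inhabited AE_switching_path by eventually_elim blast
    then show thesis
    proof (rule AE_E)
      fix Z assume "{\<omega>\<in>space M. \<not> ((\<forall>i<d. \<forall>k. emeasure (N i \<omega>) (cell k \<times> {0..}) \<noteq> 0) \<and>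
        (\<forall>i<d. switching_path (N i \<omega>) (\<lambda>t. \<xi> i t \<omega>) (\<lambda>t. v i t \<omega>)))} \<subseteq> Z" "emeasure M Z = 0" "Z \<in> events"
      then show thesis by (intro that[of Z]) (auto simp: null_sets_def)
    qed
  qed
  define E1 where "E1 = (\<Union>i<d. \<Union>k<n. coord_near_miss i k)"
  define E2 where "E2 = (\<Union>i<d. \<Union>k<n. crowded K i k)"
  define E3 where "E3 = (\<Union>i<d. far (K - T) i)"
  \<comment> \<open>\<open>E4\<close> carries the case distinction inside the union so that the index sets stay independent of each other.\<close>
  define E4 where "E4 = (\<Union>i<d. \<Union>j<d. \<Union>k<n. if i = j then {} else collision K i j k)"
  let ?b1 = "2 * h\<^sup>2 * (flips_moment_bound T + 2)"
  have union_le: "prob (\<Union>i<l. F i) \<le> real l * b" if "\<And>i. i < l \<Longrightarrow> F i \<in> events" "\<And>i. i < l \<Longrightarrow> prob (F i) \<le> b"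
    for l :: nat and F :: "nat \<Rightarrow> 'w set" and b
  proof -
    have "prob (\<Union>i<l. F i) \<le> (\<Sum>i<l. prob (F i))" by (rule measure_UNION_le) (use that in auto)
    also have "\<dots> \<le> (\<Sum>i<l. b)" by (rule sum_mono) (use that in auto)
    finally show ?thesis by simp
  qed
  have UN_ev: "(\<Union>i<l. F i) \<in> events" if "\<And>i. i < l \<Longrightarrow> F i \<in> events" for l :: nat and F :: "nat \<Rightarrow> 'w set"
    using that by (intro sets.finite_UN) auto
  have nh: "real n * h\<^sup>2 = T * h" using T by (simp add: power2_eq_square)
  have E1: "E1 \<in> events" "prob E1 \<le> real d * (real n * ?b1)"
    unfolding E1_def using prob_coord_near_miss[unfolded T]
    by (intro UN_ev union_le; blast)+
  have E2: "E2 \<in> events" "prob E2 \<le> real d * (real n * (h * K)\<^sup>2)"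
    unfolding E2_def using prob_crowded[OF _ K0]
    by (intro UN_ev union_le; blast)+
  have E3: "E3 \<in> events" "prob E3 \<le> real d * ((\<integral>x. \<bar>x\<bar> \<partial>std_normal) / (K - T))"
    unfolding E3_def using prob_far[of _ "K - T"] K
    by (intro UN_ev union_le; simp)+
  have c: "(if i = j then {} else collision K i j k) \<in> events"
    "prob (if i = j then {} else collision K i j k) \<le> (h * K)\<^sup>2" if "i < d" "j < d" "k < n" for i j k
    using prob_collision[OF that(1,2) _ that(3) K0] by (cases "i = j"; simp)+
  have E4: "E4 \<in> events" "prob E4 \<le> real d * (real d * (real n * (h * K)\<^sup>2))"
    unfolding E4_def using c by (intro UN_ev union_le; blast)+
  let ?E = "Z \<union> (E1 \<union> (E2 \<union> (E3 \<union> E4)))"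
  have ZE: "Z \<in> events" "prob Z = 0" using Z by (auto simp: null_sets_def measure_def)
  have "prob ?E \<le> prob Z + (prob E1 + (prob E2 + (prob E3 + prob E4)))"
    using ZE E1(1) E2(1) E3(1) E4(1)
    by (intro order_trans[OF measure_Un_le] add_mono order_refl) auto
  also have "\<dots> \<le> 0 + (real d * (real n * ?b1) + (real d * (real n * (h * K)\<^sup>2)
      + (real d * ((\<integral>x. \<bar>x\<bar> \<partial>std_normal) / (K - T)) + real d * (real d * (real n * (h * K)\<^sup>2)))))"
    using ZE(2) E1(2) E2(2) E3(2) E4(2) by linarith
  also have "\<dots> = real d * (2 * (real n * h\<^sup>2) * (flips_moment_bound T + 2) + (real n * h\<^sup>2) * K\<^sup>2
        + (\<integral>x. \<bar>x\<bar> \<partial>std_normal) / (K - T)) + (real d)\<^sup>2 * ((real n * h\<^sup>2) * K\<^sup>2)"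
    by (simp add: power2_eq_square algebra_simps)
  finally have bound: "prob ?E \<le> real d * (2 * T * h * (flips_moment_bound T + 2) + T * h * K\<^sup>2
        + (\<integral>x. \<bar>x\<bar> \<partial>std_normal) / (K - T)) + (real d)\<^sup>2 * (T * h * K\<^sup>2)"
    unfolding nh by (simp add: mult.assoc)
  have "num_jumps T (\<lambda>t. angular_momentum d \<xi> v t \<omega>) = ereal (total_flips \<omega>)" if \<omega>: "\<omega> \<in> space M - ?E" for \<omega>
  proof (rule num_jumps_eq_total_flips[OF _ _ _ T])
    show "\<omega> \<in> space M" using \<omega> by blast
    show "\<forall>i<d. \<forall>k. emeasure (N i \<omega>) (cell k \<times> {0..}) \<noteq> 0"
      "\<forall>i<d. switching_path (N i \<omega>) (\<lambda>t. \<xi> i t \<omega>) (\<lambda>t. v i t \<omega>)" using \<omega> good by blast+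
    show "\<omega> \<notin> coord_near_miss i k" if "i < d" "k < n" for i k using \<omega> that unfolding E1_def by blast
    show "\<omega> \<notin> crowded K i k" if "i < d" "k < n" for i k using \<omega> that unfolding E2_def by blast
    show "\<omega> \<notin> far (K - T) i" if "i < d" for i using \<omega> that unfolding E3_def by blast
    show "\<omega> \<notin> collision K i j k" if "i < d" "j < d" "i \<noteq> j" "k < n" for i j k
    proof
      assume "\<omega> \<in> collision K i j k"
      then have "\<omega> \<in> (if i = j then {} else collision K i j k)" using that(3) by simp
      then have "\<omega> \<in> E4" unfolding E4_def using that by blast
      then show False using \<omega> by blast
    qed
  qed
  moreover have "?E \<in> events" using ZE E1(1) E2(1) E3(1) E4(1) by blast
  ultimately show ?thesis using bound by blast
qed

lemma indep_vars_flips: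
  "indep_vars (\<lambda>_. borel) (\<lambda>i \<omega>. real (flips h (\<lambda>l. drive (i, l) \<omega>) n)) {..<d}"
proof -
  have "indep_vars (\<lambda>i. PiM ({i} \<times> {..n}) (\<lambda>_. borel)) (\<lambda>i \<omega>. restrict (\<lambda>p. drive p \<omega>) ({i} \<times> {..n})) {..<d}"
    by (rule indep_vars_restrict[OF indep_vars_drive]) (auto simp: disjoint_family_on_def)
  then have "indep_vars (\<lambda>_. borel) (\<lambda>i \<omega>. (\<lambda>c. real (flips h (\<lambda>l. c (i, l)) n)) (restrict (\<lambda>p. drive p \<omega>) ({i} \<times> {..n}))) {..<d}"
  proof (rule indep_vars_compose2)
    fix i
    have "(\<lambda>c. \<lambda>l\<in>{..n}. c (i, l)) \<in> measurable (PiM ({i} \<times> {..n}) (\<lambda>_. borel)) (PiM {..n} (\<lambda>_. borel :: real measure))"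
      by (intro measurable_restrict measurable_component_singleton) auto
    then have "(\<lambda>c. flips h (\<lambda>l\<in>{..n}. c (i, l)) n) \<in> measurable (PiM ({i} \<times> {..n}) (\<lambda>_. borel)) (count_space UNIV)"
      by (rule measurable_compose[OF _ measurable_flips]) simp
    moreover have "flips h (\<lambda>l\<in>{..n}. c (i, l)) n = flips h (\<lambda>l. c (i, l)) n" for c
      by (rule flips_cong) simp
    ultimately have "(\<lambda>c. flips h (\<lambda>l. c (i, l)) n) \<in> measurable (PiM ({i} \<times> {..n}) (\<lambda>_. borel)) (count_space UNIV)"
      by simp
    then show "(\<lambda>c. real (flips h (\<lambda>l. c (i, l)) n)) \<in> borel_measurable (PiM ({i} \<times> {..n}) (\<lambda>_. borel))"
      by measurable
  qed
  moreover have "flips h (\<lambda>l. restrict (\<lambda>p. drive p \<omega>) ({i} \<times> {..n}) (i, l)) n = flips h (\<lambda>l. drive (i, l) \<omega>) n" for i \<omega>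
    by (rule flips_cong) simp
  ultimately show ?thesis by (simp del: drive.simps)
qed

lemma total_flips_deviation:
  assumes \<epsilon>: "0 < \<epsilon>"
  shows "prob {\<omega>\<in>space M. \<epsilon> \<le> \<bar>total_flips \<omega> / real d - real n * flip_prob h\<bar>}
    \<le> flips_moment_bound (real n * h) / (real d * \<epsilon>\<^sup>2)"
proof (rule weak_law_bound[OF indep_vars_flips d_pos \<epsilon>])
  fix i assume i: "i < d"
  interpret W: walk_driver M "\<lambda>k. drive (i, k)" h n by (rule walk_driver_coordinate[OF i])
  let ?J = "\<lambda>\<omega>. real (flips h (\<lambda>l. drive (i, l) \<omega>) n)"
  have m: "?J \<in> borel_measurable M"
    using indep_vars_flips i unfolding indep_vars_def by auto
  have B0: "0 \<le> flips_moment_bound (real n * h)" using flips_moment_bound_nonneg h_pos by simp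
  show sq: "integrable M (\<lambda>\<omega>. (?J \<omega>)\<^sup>2)"
  proof (rule integrable_const_bound[where B="(real n)\<^sup>2"])
    show "AE \<omega> in M. norm ((?J \<omega>)\<^sup>2) \<le> (real n)\<^sup>2"
      using W.flips_le by (intro AE_I2) (simp add: power_mono)
    show "(\<lambda>\<omega>. (?J \<omega>)\<^sup>2) \<in> borel_measurable M" using m by measurable
  qed
  show "expectation ?J = real n * flip_prob h" by (rule W.expectation_J)
  have "ennreal (expectation (\<lambda>\<omega>. (?J \<omega>)\<^sup>2)) = (\<integral>\<^sup>+\<omega>. ennreal ((?J \<omega>)\<^sup>2) \<partial>M)"
    by (rule nn_integral_eq_integral[symmetric, OF sq]) simp
  also have "\<dots> \<le> ennreal (flips_moment_bound (real n * h))" by (rule W.nn_integral_J_square[OF n_pos])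
  finally show "expectation (\<lambda>\<omega>. (?J \<omega>)\<^sup>2) \<le> flips_moment_bound (real n * h)" using B0 by simp
qed

end

section \<open>Convergence in probability\<close>

context stationary_zigzag begin

text \<open>For fixed \<open>d\<close>, choose \<open>K\<close> first and then the grid: \<open>g\<close> is the average number of flips on a fine grid, \<open>\<mu>\<close> its mean.\<close>

lemma scaled_num_jumps_approximation:
  assumes d: "1 \<le> d" and T: "0 < T" and \<delta>: "0 < \<delta>" and \<eta>: "0 < \<eta>"
  obtains g E \<mu> where "g \<in> borel_measurable M" "E \<in> events" "prob E < \<delta>" "\<bar>\<mu> - T / sqrt (2 * pi)\<bar> < \<eta>"
    "\<And>\<omega>. \<omega> \<in> space M - E \<Longrightarrow>
      ereal (1 / real d) * num_jumps T (\<lambda>t. angular_momentum d \<xi> v t \<omega>) = ereal (g \<omega>)"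
    "\<And>\<epsilon>. 0 < \<epsilon> \<Longrightarrow> prob {\<omega>\<in>space M. \<epsilon> \<le> \<bar>g \<omega> - \<mu>\<bar>} \<le> flips_moment_bound T / (real d * \<epsilon>\<^sup>2)"
proof -
  define m where "m = (\<integral>x. \<bar>x\<bar> \<partial>std_normal)"
  have m0: "0 \<le> m" unfolding m_def by (rule Bochner_Integration.integral_nonneg) simp
  \<comment> \<open>This choice makes \<open>d\<close> times the Markov bound \<open>m / (K - T)\<close> for a large initial position less than \<open>\<delta> / 2\<close>.\<close>
  define K where "K = T + (2 * real d * m / \<delta> + 1)"
  have KT: "K - T = 2 * real d * m / \<delta> + 1" by (simp add: K_def)
  have KT0: "0 < K - T" unfolding KT using m0 \<delta> d by (intro add_nonneg_pos) auto
  have tail: "real d * (m / (K - T)) < \<delta> / 2"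
  proof -
    have "real d * m < \<delta> / 2 * (K - T)" unfolding KT using \<delta> by (simp add: field_simps)
    then show ?thesis using KT0 by (simp add: field_simps)
  qed
  let ?B = "flips_moment_bound T"
  define C where "C = real d * (2 * T * (?B + 2) + T * K\<^sup>2) + (real d)\<^sup>2 * (T * K\<^sup>2)"
  have "(\<lambda>n. C * T * inverse (real n)) \<longlonglongrightarrow> C * T * 0"
    by (intro tendsto_intros tendsto_inverse_0_at_top filterlim_real_sequentially)
  then have "\<forall>\<^sub>F n in sequentially. C * T * inverse (real n) < \<delta> / 2"
    using \<delta> by (intro order_tendstoD(2)) auto
  moreover have "\<forall>\<^sub>F n in sequentially. dist (real n * flip_prob (T / real n)) (T / sqrt (2 * pi)) < \<eta>"
    using flip_prob_limit[OF T] \<eta> by (rule tendstoD)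
  ultimately have "\<forall>\<^sub>F n in sequentially. C * T * inverse (real n) < \<delta> / 2 \<and>
      dist (real n * flip_prob (T / real n)) (T / sqrt (2 * pi)) < \<eta> \<and> 1 \<le> n"
    using eventually_ge_at_top[of 1] by eventually_elim blast
  then obtain n where n: "C * T * inverse (real n) < \<delta> / 2"
      "dist (real n * flip_prob (T / real n)) (T / sqrt (2 * pi)) < \<eta>" "1 \<le> n"
    using eventually_happens'[OF sequentially_bot] by blast
  define h where "h = T / real n"
  have h: "0 < h" "real n * h = T" using n(3) T by (simp_all add: h_def)
  interpret D: driven_zigzag M d N \<xi> v h n
    by unfold_locales (use h n(3) d in auto)
  obtain E where E: "E \<in> events" "prob E \<le> real d * (2 * T * h * (?B + 2) + T * h * K\<^sup>2 + m / (K - T)) + (real d)\<^sup>2 * (T * h * K\<^sup>2)"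
    and eq: "\<And>\<omega>. \<omega> \<in> space M - E \<Longrightarrow> num_jumps T (\<lambda>t. angular_momentum d \<xi> v t \<omega>) = ereal (D.total_flips \<omega>)"
    using D.num_jumps_eq_total_flips_whp[OF h(2), of K] KT0 unfolding m_def by auto
  have "real d * (2 * T * h * (?B + 2) + T * h * K\<^sup>2 + m / (K - T)) + (real d)\<^sup>2 * (T * h * K\<^sup>2) = C * h + real d * (m / (K - T))"
    by (simp add: C_def algebra_simps)
  also have "C * h = C * T * inverse (real n)" by (simp add: h_def divide_inverse)
  finally have PE: "prob E < \<delta>" using E(2) n(1) tail by linarith
  define g where "g \<omega> = D.total_flips \<omega> / real d" for \<omega>
  show thesis
  proof (rule that[of g E "real n * flip_prob h"])
    have "(\<lambda>\<omega>. real (flips h (\<lambda>l. D.drive (i, l) \<omega>) n)) \<in> borel_measurable M" if "i \<in> {..<d}" for i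
      using D.indep_vars_flips that unfolding indep_vars_def by auto
    then show "g \<in> borel_measurable M" unfolding g_def by measurable
    show "\<bar>real n * flip_prob h - T / sqrt (2 * pi)\<bar> < \<eta>" using n(2) by (simp add: h_def dist_real_def)
    show "ereal (1 / real d) * num_jumps T (\<lambda>t. angular_momentum d \<xi> v t \<omega>) = ereal (g \<omega>)" if "\<omega> \<in> space M - E" for \<omega>
      unfolding eq[OF that] g_def by simp
    show "prob {\<omega>\<in>space M. \<epsilon> \<le> \<bar>g \<omega> - real n * flip_prob h\<bar>} \<le> ?B / (real d * \<epsilon>\<^sup>2)" if "0 < \<epsilon>" for \<epsilon>
      using D.total_flips_deviation[OF that] unfolding g_def h(2) .
  qed (use E(1) PE in auto)
qed

text \<open>The deviation bound for \<open>g\<close> does not depend on the grid, hence survives the limit. Half of \<open>\<epsilon>\<close> is spent on the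
  distance of \<open>\<mu>\<close> from \<open>T / sqrt (2 \<pi>)\<close>, which accounts for the factor \<open>4\<close>.\<close>

lemma scaled_num_jumps_concentration:
  assumes d: "1 \<le> d" and T: "0 < T"
  shows "(\<lambda>\<omega>. ereal (1 / real d) * num_jumps T (\<lambda>t. angular_momentum d \<xi> v t \<omega>)) \<in> borel_measurable (completion M)"
      (is "?X \<in> _")
    and "0 < \<epsilon> \<Longrightarrow> measure (completion M) {\<omega>\<in>space M.
        ereal \<epsilon> < \<bar>ereal (1 / real d) * num_jumps T (\<lambda>t. angular_momentum d \<xi> v t \<omega>) - ereal (T / sqrt (2 * pi))\<bar>}
      \<le> 4 * flips_moment_bound T / (real d * \<epsilon>\<^sup>2)"
proof -
  show meas: "?X \<in> borel_measurable (completion M)"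
  proof (rule borel_measurable_completion_approx)
    fix \<delta> :: real assume "0 < \<delta>"
    then obtain g E \<mu> where "g \<in> borel_measurable M" "E \<in> events" "prob E < \<delta>"
      and "\<And>\<omega>. \<omega> \<in> space M - E \<Longrightarrow> ?X \<omega> = ereal (g \<omega>)"
      by (rule scaled_num_jumps_approximation[OF d T _ zero_less_one]) blast
    then show "\<exists>g\<in>borel_measurable M. \<exists>E\<in>events. prob E < \<delta> \<and> (\<forall>\<omega>\<in>space M - E. ?X \<omega> = g \<omega>)"
      by (intro bexI[of _ "\<lambda>\<omega>. ereal (g \<omega>)"] bexI[of _ E]) auto
  qed
  assume \<epsilon>: "0 < \<epsilon>"
  let ?c = "T / sqrt (2 * pi)"
  let ?A = "{\<omega>\<in>space M. ereal \<epsilon> < \<bar>?X \<omega> - ereal ?c\<bar>}"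
  interpret C: prob_space "completion M" by (rule prob_space_completion)
  have A: "?A \<in> sets (completion M)"
  proof -
    have "{\<omega>\<in>space (completion M). ereal \<epsilon> < \<bar>?X \<omega> - ereal ?c\<bar>} \<in> sets (completion M)"
      using meas by measurable
    then show ?thesis by simp
  qed
  show "measure (completion M) ?A \<le> 4 * flips_moment_bound T / (real d * \<epsilon>\<^sup>2)"
  proof (rule field_le_epsilon)
    fix \<delta> :: real assume \<delta>: "0 < \<delta>"
    have \<epsilon>2: "0 < \<epsilon> / 2" using \<epsilon> by simp
    obtain g E \<mu> where g[measurable]: "g \<in> borel_measurable M" and E: "E \<in> events" "prob E < \<delta>"
      and \<mu>: "\<bar>\<mu> - ?c\<bar> < \<epsilon> / 2" and eq: "\<And>\<omega>. \<omega> \<in> space M - E \<Longrightarrow> ?X \<omega> = ereal (g \<omega>)"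
      and dev: "\<And>\<epsilon>. 0 < \<epsilon> \<Longrightarrow> prob {\<omega>\<in>space M. \<epsilon> \<le> \<bar>g \<omega> - \<mu>\<bar>} \<le> flips_moment_bound T / (real d * \<epsilon>\<^sup>2)"
      by (rule scaled_num_jumps_approximation[OF d T \<delta> \<epsilon>2]) blast
    let ?G = "{\<omega>\<in>space M. \<epsilon> / 2 \<le> \<bar>g \<omega> - \<mu>\<bar>}"
    have G: "?G \<in> events" by measurable
    have "?A \<subseteq> E \<union> ?G"
    proof
      fix \<omega> assume \<omega>: "\<omega> \<in> ?A"
      show "\<omega> \<in> E \<union> ?G"
      proof (cases "\<omega> \<in> E")
        case False
        then have "?X \<omega> = ereal (g \<omega>)" using \<omega> eq by blast
        then have "\<epsilon> < \<bar>g \<omega> - ?c\<bar>" using \<omega> by simp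
        then have "\<epsilon> / 2 \<le> \<bar>g \<omega> - \<mu>\<bar>" using \<mu> by linarith
        then show ?thesis using \<omega> by blast
      qed simp
    qed
    then have "measure (completion M) ?A \<le> measure (completion M) (E \<union> ?G)"
      by (rule C.finite_measure_mono) (use E G in auto)
    also have "\<dots> = prob (E \<union> ?G)" by (rule measure_completion) (use E G in auto)
    also have "\<dots> \<le> prob E + prob ?G" by (rule measure_Un_le[OF E(1) G])
    also have "\<dots> \<le> \<delta> + flips_moment_bound T / (real d * (\<epsilon> / 2)\<^sup>2)"
      using E(2) dev[OF \<epsilon>2] by simp
    also have "\<dots> = 4 * flips_moment_bound T / (real d * \<epsilon>\<^sup>2) + \<delta>"
      by (simp add: power2_eq_square)
    finally show "measure (completion M) ?A \<le> 4 * flips_moment_bound T / (real d * \<epsilon>\<^sup>2) + \<delta>" .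
  qed
qed

end

theorem corollary2p3:
  fixes M :: "nat \<Rightarrow> 'w measure"
    and N :: "nat \<Rightarrow> nat \<Rightarrow> 'w \<Rightarrow> (real \<times> real) measure"
    and \<xi> v :: "nat \<Rightarrow> nat \<Rightarrow> real \<Rightarrow> 'w \<Rightarrow> real"
    and T :: real
  assumes "\<And>d. d \<ge> 1 \<Longrightarrow> stationary_zigzag (M d) d (N d) (\<xi> d) (v d)"
    and "T > 0"
  shows "tendsto_in_probability M
    (\<lambda>d \<omega>. ereal (1 / real d) * num_jumps T (\<lambda>t. angular_momentum d (\<xi> d) (v d) t \<omega>))
    (T / sqrt (2 * pi))"
  unfolding tendsto_in_probability_def
proof (intro conjI allI impI)
  show "\<forall>\<^sub>F d in sequentially. (\<lambda>\<omega>. ereal (1 / real d) * num_jumps T (\<lambda>t. angular_momentum d (\<xi> d) (v d) t \<omega>))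
      \<in> borel_measurable (completion (M d))"
    using eventually_ge_at_top[of 1]
    by eventually_elim (rule stationary_zigzag.scaled_num_jumps_concentration(1)[OF assms(1) _ assms(2)])
next
  fix \<epsilon> :: real assume \<epsilon>: "0 < \<epsilon>"
  let ?p = "\<lambda>d. measure (completion (M d)) {\<omega> \<in> space (M d). ereal \<epsilon>
      < \<bar>ereal (1 / real d) * num_jumps T (\<lambda>t. angular_momentum d (\<xi> d) (v d) t \<omega>) - ereal (T / sqrt (2 * pi))\<bar>}"
  let ?C = "4 * flips_moment_bound T / \<epsilon>\<^sup>2"
  have "(\<lambda>d. ?C * inverse (real d)) \<longlonglongrightarrow> ?C * 0"
    by (intro tendsto_intros tendsto_inverse_0_at_top filterlim_real_sequentially)
  then have lim: "(\<lambda>d. ?C * inverse (real d)) \<longlonglongrightarrow> 0" by simp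
  show "?p \<longlonglongrightarrow> 0"
  proof (rule tendsto_sandwich[OF _ _ tendsto_const lim])
    show "\<forall>\<^sub>F d in sequentially. 0 \<le> ?p d" by simp
    show "\<forall>\<^sub>F d in sequentially. ?p d \<le> ?C * inverse (real d)"
      using eventually_ge_at_top[of 1]
    proof eventually_elim
      case (elim d)
      have "?p d \<le> 4 * flips_moment_bound T / (real d * \<epsilon>\<^sup>2)"
        by (rule stationary_zigzag.scaled_num_jumps_concentration(2)[OF assms(1)[OF elim] elim assms(2) \<epsilon>])
      also have "\<dots> = ?C * inverse (real d)" by (simp add: field_simps)
      finally show ?case .
    qed
  qed
qed

end
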